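(* There is an absolute constant $C>0$ such that the following holds. The Projection Algorithm receives as input a real number $\lambda>0$, an $N$-element pseudometric space $(\mathcal M,\rho)$ and a closed half-plane $F(x)\subset\mathbb R^2$ for each $x\in\mathcal M$. Given this input, it produces one of the following two outcomes. Outcome 1 ("No Go"): it is guaranteed that there does not exist $f\in\mathrm{Lip}(\mathcal M)$ with Lipschitz seminorm $\|f\|_{\mathrm{Lip}(\mathcal M)}\le\lambda$ such that $f(x)\in F(x)$ for all $x\in\mathcal M$. Outcome 2 ("Success"): the algorithm produces a mapping $f:\mathcal M\to\mathbb R^2$ with $\|f\|_{\mathrm{Lip}(\mathcal M)}\le 3\lambda$ satisfying $f(x)\in F(x)$ for all $x\in\mathcal M$. The algorithm can be carried out with at most $CN^2$ computer operations and at most $CN^2$ units of computer memory.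
   Context: A pseudometric on $\mathcal M$ is a function $\rho:\mathcal M\times\mathcal M\to[0,+\infty]$ with $\rho(x,x)=0$, $\rho(x,y)=\rho(y,x)$ and $\rho(x,y)\le\rho(x,z)+\rho(z,y)$; $\rho(x,y)=0$ with $x\ne y$ and $\rho(x,y)=+\infty$ are allowed. $\|\cdot\|$ is the uniform norm on $\mathbb R^2$, $\|x\|=\max\{|x_1|,|x_2|\}$, $Q_0=[-1,1]^2$, $Q(a,r)=\{y:\|y-a\|\le r\}$, and $A+B$ is the Minkowski sum. For $f:\mathcal M\to\mathbb R^2$, $\|f\|_{\mathrm{Lip}(\mathcal M)}=\inf\{\lambda\ge0:\|f(x)-f(y)\|\le\lambda\rho(x,y)\ \forall x,y\in\mathcal M\}$ ($\inf\emptyset=+\infty$), and $\mathrm{Lip}(\mathcal M)$ is the set of $f$ for which this is finite. If $\rho(x,y)=+\infty$, the inequality $\|f(x)-f(y)\|\le\lambda\rho(x,y)$ is no constraint, and $A+\lambda\rho(x,y)Q_0=\mathbb R^2$ for nonempty $A$. A rectangle is a set $I_1\times I_2$ with $I_1,I_2\subset\mathbb R$ nonempty closed intervals (points and unbounded intervals allowed). For nonempty convex $S\subset\mathbb R^2$, $\mathcal H[S]$ is the smallest closed rectangle containing $S$. For a nonempty closed convex $S$ and $a\in\mathbb R^2$, $\mathbf{Pr}(a,S)=S\cap Q(a,\mathrm{dist}(a,S))$ is the metric projection in the uniform norm (a point or a segment parallel to a coordinate axis in case $S$ is a rectangle; a one-point set is identified with its point). $O=(0,0)$. Projection Algorithm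 with parameter $\lambda$ (that is, $\lambda_1=\lambda_2=\lambda$): Step 1: form $F^{[1]}[x:\lambda]=\bigcap_{y\in\mathcal M}[F(y)+\lambda\rho(x,y)Q_0]$ for $x\in\mathcal M$; if some such set is empty, output "No Go" and stop. Step 2: form $\mathcal T(x)=\mathcal H[F^{[1]}[x:\lambda]]$. Step 3: form $\mathcal T^{[1]}(x)=\bigcap_{y\in\mathcal M}[\mathcal T(y)+\lambda\rho(x,y)Q_0]$; if some such set is empty, output "No Go" and stop. Step 4: let $g(x)$ be the center of $\mathbf{Pr}(O,\mathcal T^{[1]}(x))$. Step 5: output "Success" and $f(x)=\mathbf{Pr}(g(x),F^{[1]}[x:\lambda])$, $x\in\mathcal M$. Computational model: an idealized von Neumann computer handling exact real numbers; an operation is an arithmetic operation (addition, subtraction, multiplication, division, comparison of two real numbers) or an access to a value in RAM. The pseudometric is given by its $N\times N$ table of values, and each half-plane is given as $F(x)=\{u:\langle \mathbf h(x),u\rangle+\alpha(x)\le0\}$ by a nonzero vector $\mathbf h(x)\in\mathbb R^2$ and $\alpha(x)\in\mathbb R$. *)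

theory Defs
  imports "HOL-Analysis.Analysis"
begin

definition pseudometric_on :: "'a set \<Rightarrow> ('a \<Rightarrow> 'a \<Rightarrow> ennreal) \<Rightarrow> bool" where
  "pseudometric_on M \<rho> \<longleftrightarrow>
     (\<forall>x\<in>M. \<rho> x x = 0) \<and>
     (\<forall>x\<in>M. \<forall>y\<in>M. \<rho> x y = \<rho> y x) \<and>
     (\<forall>x\<in>M. \<forall>y\<in>M. \<forall>z\<in>M. \<rho> x y \<le> \<rho> x z + \<rho> z y)"

text \<open>
  The plane is \<open>real \<times> real\<close>; its class-instance \<open>norm\<close> and \<open>dist\<close> are Euclidean, so the uniform
  norm is written \<open>infnorm\<close> throughout.  The disjunct \<open>\<rho> x y = \<infinity>\<close> is needed because
  \<open>0 * \<infinity> = 0\<close> in \<open>ennreal\<close>, whereas an infinite distance imposes no constraint even for \<open>L = 0\<close>.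
\<close>

definition lip_seminorm ::
    "'a set \<Rightarrow> ('a \<Rightarrow> 'a \<Rightarrow> ennreal) \<Rightarrow> ('a \<Rightarrow> real \<times> real) \<Rightarrow> ennreal" where
  "lip_seminorm M \<rho> f =
     Inf {ennreal L | L. 0 \<le> L \<and>
       (\<forall>x\<in>M. \<forall>y\<in>M. \<rho> x y = \<infinity> \<or> ennreal (infnorm (f x - f y)) \<le> ennreal L * \<rho> x y)}"

definition Lip :: "'a set \<Rightarrow> ('a \<Rightarrow> 'a \<Rightarrow> ennreal) \<Rightarrow> ('a \<Rightarrow> real \<times> real) set" where
  "Lip M \<rho> = {f. lip_seminorm M \<rho> f < \<infinity>}"

definition square :: "real \<times> real \<Rightarrow> real \<Rightarrow> (real \<times> real) set" where
  "square a r = {y. infnorm (y - a) \<le> r}"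

definition scaled_unit_square :: "ennreal \<Rightarrow> (real \<times> real) set" where
  "scaled_unit_square t =
     (if t = \<infinity> then UNIV else (\<lambda>u. enn2real t *\<^sub>R u) ` square 0 1)"

definition half_plane :: "real \<times> real \<Rightarrow> real \<Rightarrow> (real \<times> real) set" where
  "half_plane h \<alpha> = {u. h \<bullet> u + \<alpha> \<le> 0}"

definition closed_half_plane :: "(real \<times> real) set \<Rightarrow> bool" where
  "closed_half_plane S \<longleftrightarrow> (\<exists>h \<alpha>. h \<noteq> 0 \<and> S = half_plane h \<alpha>)"

definition rectangle :: "(real \<times> real) set \<Rightarrow> bool" where
  "rectangle R \<longleftrightarrow> (\<exists>I J :: real set.
     is_interval I \<and> closed I \<and> I \<noteq> {} \<and> is_interval J \<and> closed J \<and> J \<noteq> {} \<and> R = I \<times> J)"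

definition uniform_setdist :: "real \<times> real \<Rightarrow> (real \<times> real) set \<Rightarrow> real" where
  "uniform_setdist a S = Inf ((\<lambda>s. infnorm (a - s)) ` S)"

definition Pr :: "real \<times> real \<Rightarrow> (real \<times> real) set \<Rightarrow> (real \<times> real) set" where
  "Pr a S = S \<inter> square a (uniform_setdist a S)"

text \<open>
  Only applied to metric projections onto rectangles, which are points or segments.
\<close>

definition center :: "(real \<times> real) set \<Rightarrow> real \<times> real" where
  "center S = (THE c. \<exists>a b. S = closed_segment a b \<and> c = midpoint a b)"

definition refine ::
    "real \<Rightarrow> 'a set \<Rightarrow> ('a \<Rightarrow> 'a \<Rightarrow> ennreal) \<Rightarrow> ('a \<Rightarrow> (real \<times> real) set) \<Rightarrow> 'a \<Rightarrow> (real \<times> real) set"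
  where "refine l M \<rho> F x = (\<Inter>y\<in>M. F y + scaled_unit_square (ennreal l * \<rho> x y))"

datatype 'a outcome = No_Go | Success "'a \<Rightarrow> real \<times> real"

text \<open>
  \<open>the_elem\<close> identifies a one-point set with its point.  It is unspecified on other sets, and values
  of the resulting map outside \<open>M\<close> are irrelevant.
\<close>

definition projection_algorithm ::
    "real \<Rightarrow> 'a set \<Rightarrow> ('a \<Rightarrow> 'a \<Rightarrow> ennreal) \<Rightarrow> ('a \<Rightarrow> (real \<times> real) set) \<Rightarrow> 'a outcome" where
  "projection_algorithm l M \<rho> F =
     (let F1 = refine l M \<rho> F;
          T = (\<lambda>x. rectangle hull F1 x);
          T1 = refine l M \<rho> T;
          g = (\<lambda>x. center (Pr (0, 0) (T1 x)))
      in if \<exists>x\<in>M. F1 x = {} then No_Go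
         else if \<exists>x\<in>M. T1 x = {} then No_Go
         else Success (\<lambda>x. the_elem (Pr (g x) (F1 x))))"

text \<open>
  A random access machine over exact reals.  The memory is a sequence of real cells; constant
  addresses serve as registers.  An address is itself a computed real, which must be a natural number
  below the memory size \<open>S\<close>; otherwise, and on division by zero, evaluation is undefined and the
  execution has no result.  In particular there is no rounding operation.
\<close>

datatype expr =
    Const int
  | Load expr
  | Add expr expr
  | Sub expr expr
  | Mul expr expr
  | Quot expr expr

datatype cond = Less expr expr

datatype prog =
    Skip
  | Store expr expr \<comment> \<open>address, value\<close>
  | Seq prog prog
  | Branch cond prog prog
  | Loop cond prog

type_synonym memory = "nat \<Rightarrow> real"

definition address :: "nat \<Rightarrow> real \<Rightarrow> nat option" where
  "address S v = (if v \<in> \<nat> \<and> v < real S then Some (nat \<lfloor>v\<rfloor>) else None)"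

fun expr_val :: "nat \<Rightarrow> memory \<Rightarrow> expr \<Rightarrow> real option" where
  "expr_val S m (Const c) = Some (of_int c)"
| "expr_val S m (Load e) =
     Option.bind (expr_val S m e) (\<lambda>v. map_option m (address S v))"
| "expr_val S m (Add d e) =
     Option.bind (expr_val S m d) (\<lambda>v. Option.bind (expr_val S m e) (\<lambda>w. Some (v + w)))"
| "expr_val S m (Sub d e) =
     Option.bind (expr_val S m d) (\<lambda>v. Option.bind (expr_val S m e) (\<lambda>w. Some (v - w)))"
| "expr_val S m (Mul d e) =
     Option.bind (expr_val S m d) (\<lambda>v. Option.bind (expr_val S m e) (\<lambda>w. Some (v * w)))"
| "expr_val S m (Quot d e) =
     Option.bind (expr_val S m d) (\<lambda>v. Option.bind (expr_val S m e)
       (\<lambda>w. if w = 0 then None else Some (v / w)))"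

fun cond_val :: "nat \<Rightarrow> memory \<Rightarrow> cond \<Rightarrow> bool option" where
  "cond_val S m (Less d e) =
     Option.bind (expr_val S m d) (\<lambda>v. Option.bind (expr_val S m e) (\<lambda>w. Some (v < w)))"

text \<open>
  One operation is charged for every arithmetic operation, comparison and memory access.
\<close>

fun expr_ops :: "expr \<Rightarrow> nat" where
  "expr_ops (Const c) = 0"
| "expr_ops (Load e) = expr_ops e + 1"
| "expr_ops (Add d e) = expr_ops d + expr_ops e + 1"
| "expr_ops (Sub d e) = expr_ops d + expr_ops e + 1"
| "expr_ops (Mul d e) = expr_ops d + expr_ops e + 1"
| "expr_ops (Quot d e) = expr_ops d + expr_ops e + 1"

fun cond_ops :: "cond \<Rightarrow> nat" where
  "cond_ops (Less d e) = expr_ops d + expr_ops e + 1"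

text \<open>
  \<open>exec S p m t m'\<close>: on a machine with \<open>S\<close> memory cells, program \<open>p\<close> started with memory contents \<open>m\<close>
  halts with contents \<open>m'\<close> after exactly \<open>t\<close> operations.
\<close>

inductive exec :: "nat \<Rightarrow> prog \<Rightarrow> memory \<Rightarrow> nat \<Rightarrow> memory \<Rightarrow> bool" for S :: nat where
  exec_Skip: "exec S Skip m 0 m"
| exec_Store: "\<lbrakk>expr_val S m d = Some v; address S v = Some a; expr_val S m e = Some w\<rbrakk>
    \<Longrightarrow> exec S (Store d e) m (expr_ops d + expr_ops e + 1) (m(a := w))"
| exec_Seq: "\<lbrakk>exec S p m t m'; exec S q m' t' m''\<rbrakk> \<Longrightarrow> exec S (Seq p q) m (t + t') m''"
| exec_Branch_True: "\<lbrakk>cond_val S m c = Some True; exec S p m t m'\<rbrakk>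
    \<Longrightarrow> exec S (Branch c p q) m (cond_ops c + t) m'"
| exec_Branch_False: "\<lbrakk>cond_val S m c = Some False; exec S q m t m'\<rbrakk>
    \<Longrightarrow> exec S (Branch c p q) m (cond_ops c + t) m'"
| exec_Loop_False: "cond_val S m c = Some False \<Longrightarrow> exec S (Loop c p) m (cond_ops c) m"
| exec_Loop_True: "\<lbrakk>cond_val S m c = Some True; exec S p m t m'; exec S (Loop c p) m' t' m''\<rbrakk>
    \<Longrightarrow> exec S (Loop c p) m (cond_ops c + t + t') m''"

text \<open>
  Input and output format for the space \<open>{..<N}\<close>.  Cells hold reals, so the value \<open>\<infinity>\<close> of a
  pseudometric is represented by \<open>-1\<close>.  Cells not mentioned have arbitrary contents.
\<close>

definition encode_dist :: "ennreal \<Rightarrow> real" where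
  "encode_dist r = (if r = \<infinity> then - 1 else enn2real r)"

definition encodes_input ::
    "nat \<Rightarrow> real \<Rightarrow> (nat \<Rightarrow> nat \<Rightarrow> ennreal) \<Rightarrow> (nat \<Rightarrow> real \<times> real) \<Rightarrow> (nat \<Rightarrow> real) \<Rightarrow> memory \<Rightarrow> bool"
  where
  "encodes_input N l \<rho> h \<alpha> m \<longleftrightarrow>
     m 0 = real N \<and> m 1 = l \<and>
     (\<forall>i<N. \<forall>j<N. m (2 + N * i + j) = encode_dist (\<rho> i j)) \<and>
     (\<forall>i<N. m (2 + N\<^sup>2 + 3 * i) = fst (h i) \<and>
            m (2 + N\<^sup>2 + 3 * i + 1) = snd (h i) \<and>
            m (2 + N\<^sup>2 + 3 * i + 2) = \<alpha> i)"

fun encodes_outcome :: "nat \<Rightarrow> nat outcome \<Rightarrow> memory \<Rightarrow> bool" where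
  "encodes_outcome N No_Go m \<longleftrightarrow> m 0 = 0"
| "encodes_outcome N (Success f) m \<longleftrightarrow>
     m 0 = 1 \<and> (\<forall>i<N. m (1 + 2 * i) = fst (f i) \<and> m (1 + 2 * i + 1) = snd (f i))"

end

theory Submission
  imports Defs
begin

text \<open>
  Normalise each half-plane to \<open>p\<^sub>y u\<^sub>1 + q\<^sub>y u\<^sub>2 + b\<^sub>y \<le> 0\<close> with \<open>\<bar>p\<^sub>y\<bar> + \<bar>q\<^sub>y\<bar> = 1\<close>.  Then Step 1 forms the
  polygons \<open>K(x) = {u. \<forall>y. p\<^sub>y u\<^sub>1 + q\<^sub>y u\<^sub>2 + b\<^sub>y \<le> \<lambda> \<rho>(x, y)}\<close>.  For a point \<open>a\<close> of the rectangular
  hull of \<open>K(x)\<close> the projection is decided by a single constraint: if \<open>r > 0\<close> is the largest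
  violation at \<open>a\<close>, attained at \<open>y\<close>, then \<open>Pr(a, K(x))\<close> is the corner \<open>a - r (sgn p\<^sub>y, sgn q\<^sub>y)\<close>.
  The centres \<open>g(x)\<close> are \<open>\<lambda>\<close>-Lipschitz, so the violations at \<open>g(x)\<close> and \<open>g(x')\<close> differ by at most
  \<open>2 \<lambda> \<rho>(x, x')\<close>; if the two corners point in different directions, testing both active
  constraints on points of the two polygons bounds the sum of the radii by \<open>2 \<lambda> \<rho>(x, x')\<close>.
  Together this gives the Lipschitz constant \<open>3 \<lambda>\<close>.

  For the running time the only nontrivial step is the bounding box of each polygon.  All polygons
  share the same normals, so the half-planes are sorted by slope once, in quadratic time, and each
  of the four linear programs of a point is then solved in linear time by an amortised sweep with a
  deque.  Emptiness of the polygons need not be tested beforehand: a candidate selection is computed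
  regardless, and the input is infeasible if it does not lie in the polygons.
\<close>


section \<open>Linear programming in the plane\<close>

text \<open>Dividing a normal by the sum of the absolute values of its coefficients matches the
  uniform norm, whose dual is the l1 norm: inflating a half-plane by \<open>t\<close> adds exactly
  \<open>t\<close> to its right-hand side, and a positive violation of a constraint is the uniform
  distance to its half-plane. When the base point changes, the movement of the centre costs one unit
  of violation and the change of the right-hand sides another, whence the factor 2; the movement of
  the centre itself is the third unit.

  The obstacle to a running time of order N^2 is that each of N polygons has up to N constraints, so
  only linear time is available per polygon. Fourier-Motzkin elimination turns the minimum of a
  coordinate into the maximum of a finite set of reals, but this set can have quadratic size; the
  sorted order makes it possible to find the maximum without listing the set. The set is also
  defined for an empty polygon, so the sweep runs without a feasibility test.\<close>

definition slope :: "('i \<Rightarrow> real) \<Rightarrow> ('i \<Rightarrow> real) \<Rightarrow> 'i \<Rightarrow> real" where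
  "slope U V i = - U i / V i"

text \<open>Fourier-Motzkin elimination of \<open>s\<close> from the constraints
  \<open>U i * t + V i * s \<le> c i\<close>: these are the resulting lower bounds on
  \<open>t\<close>. A lower line whose slope is not smaller than that of the upper line gives an
  upper bound on \<open>t\<close>, or a condition free of \<open>t\<close>, and contributes nothing
  here.\<close>

definition roots :: "('i \<Rightarrow> real) \<Rightarrow> ('i \<Rightarrow> real) \<Rightarrow> ('i \<Rightarrow> real) \<Rightarrow> 'i set \<Rightarrow> real set" where
  "roots U V c I =
     {c i / U i | i. i \<in> I \<and> V i = 0 \<and> U i < 0} \<union>
     {(c i / V i - c j / V j) / (slope U V j - slope U V i) | i j.
        i \<in> I \<and> j \<in> I \<and> V i < 0 \<and> 0 < V j \<and> slope U V i < slope U V j}"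

lemma finite_roots:
  assumes "finite I"
  shows "finite (roots U V c I)"
proof -
  have "roots U V c I \<subseteq> (\<lambda>i. c i / U i) ` I \<union>
    (\<lambda>(i, j). (c i / V i - c j / V j) / (slope U V j - slope U V i)) ` (I \<times> I)"
    unfolding roots_def by auto
  then show ?thesis
    using assms by (meson finite_SigmaI finite_UnI finite_imageI finite_subset)
qed

lemma lower_constraint:
  assumes "V i < 0"
  shows "U i * t + V i * s \<le> c i \<longleftrightarrow> slope U V i * t + c i / V i \<le> s"
  using assms unfolding slope_def by (simp add: field_simps)

lemma upper_constraint:
  assumes "0 < V j"
  shows "U j * t + V j * s \<le> c j \<longleftrightarrow> s \<le> slope U V j * t + c j / V j"
  using assms unfolding slope_def by (simp add: field_simps)

lemma roots_le:
  assumes "\<forall>i\<in>I. U i * t + V i * s \<le> c i" and "r \<in> roots U V c I"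
  shows "r \<le> t"
  using assms(2) unfolding roots_def
proof (elim UnE CollectE exE conjE)
  fix i assume "r = c i / U i" "i \<in> I" "V i = 0" "U i < 0"
  moreover from this assms(1) have "U i * t \<le> c i" by force
  ultimately show ?thesis by (simp add: neg_divide_le_eq mult.commute)
next
  fix i j assume *: "r = (c i / V i - c j / V j) / (slope U V j - slope U V i)"
    "i \<in> I" "j \<in> I" "V i < 0" "0 < V j" "slope U V i < slope U V j"
  have "slope U V i * t + c i / V i \<le> s" using assms(1) * lower_constraint[of V i] by blast
  moreover have "s \<le> slope U V j * t + c j / V j"
    using assms(1) * upper_constraint[of V j] by blast
  ultimately have "c i / V i - c j / V j \<le> t * (slope U V j - slope U V i)"
    by (simp add: algebra_simps)
  then show ?thesis using * by (simp add: pos_divide_le_eq)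
qed

text \<open>The consequences of the elimination that bound \<open>t\<close> from above survive a
  decrease of \<open>t\<close>, and the feasible starting point supplies them together with the
  conditions free of \<open>t\<close>. Only the lower bounds collected in \<open>roots\<close> can
  obstruct the decrease.\<close>

lemma feasible_down:
  assumes fin: "finite I" and feas: "\<forall>i\<in>I. U i * t + V i * s \<le> c i"
    and le: "t' \<le> t" and rt: "\<forall>r\<in>roots U V c I. r \<le> t'"
  shows "\<exists>s'. \<forall>i\<in>I. U i * t' + V i * s' \<le> c i"
proof -
  define lo where "lo i = slope U V i * t' + c i / V i" for i
  let ?L = "{i \<in> I. V i < 0}" and ?H = "{j \<in> I. 0 < V j}"
  have vert: "U i * t' \<le> c i" if "i \<in> I" "V i = 0" for i
  proof (cases "U i < 0")
    case True
    then have "c i / U i \<in> roots U V c I" using that unfolding roots_def by blast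
    then show ?thesis using rt True by (auto simp: field_simps)
  next
    case False
    then have "U i * t' \<le> U i * t" using le by (simp add: mult_left_mono)
    then show ?thesis using feas that by force
  qed
  have pair: "lo i \<le> lo j" if i: "i \<in> I" "V i < 0" and j: "j \<in> I" "0 < V j" for i j
  proof (cases "slope U V i < slope U V j")
    case True
    then have "(c i / V i - c j / V j) / (slope U V j - slope U V i) \<in> roots U V c I"
      using i j unfolding roots_def by blast
    then have "(c i / V i - c j / V j) / (slope U V j - slope U V i) \<le> t'" using rt by blast
    then show ?thesis using True by (simp add: lo_def pos_divide_le_eq algebra_simps)
  next
    case False
    have "slope U V i * t + c i / V i \<le> slope U V j * t + c j / V j"
      using feas i j lower_constraint[of V i U t s c] upper_constraint[of V j U t s c] by force
    moreover have "(slope U V i - slope U V j) * t' \<le> (slope U V i - slope U V j) * t"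
      using False le by (intro mult_left_mono) auto
    ultimately show ?thesis by (simp add: lo_def algebra_simps)
  qed
  \<comment> \<open>In one variable pairwise compatibility of lower and upper bounds suffices: take
    the largest lower bound, or the smallest upper bound if there is no lower one.\<close>
  have "\<exists>s'. (\<forall>i\<in>?L. lo i \<le> s') \<and> (\<forall>j\<in>?H. s' \<le> lo j)"
  proof (cases "?L = {}")
    case True
    show ?thesis
    proof (cases "?H = {}")
      case False
      then show ?thesis using True fin by (intro exI[of _ "Min (lo ` ?H)"]) auto
    qed (use True in auto)
  next
    case False
    then show ?thesis using fin pair by (intro exI[of _ "Max (lo ` ?L)"]) auto
  qed
  then obtain s' where s': "\<forall>i\<in>?L. lo i \<le> s'" "\<forall>j\<in>?H. s' \<le> lo j" by blast
  have "U i * t' + V i * s' \<le> c i" if "i \<in> I" for i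
  proof (cases "V i" "0::real" rule: linorder_cases)
    case less
    then show ?thesis using s' that lower_constraint[of V i U t' s' c] unfolding lo_def by blast
  next
    case equal
    then show ?thesis using vert that by simp
  next
    case greater
    then show ?thesis using s' that upper_constraint[of V i U t' s' c] unfolding lo_def by blast
  qed
  then show ?thesis by blast
qed

section \<open>Metric projection onto an intersection of half-planes\<close>

lemma infnorm_pair: "infnorm (u :: real \<times> real) = max \<bar>fst u\<bar> \<bar>snd u\<bar>"
proof -
  have "((\<lambda>i. \<bar>u \<bullet> i\<bar>) ` Basis) = {\<bar>fst u\<bar>, \<bar>snd u\<bar>}"
    unfolding Basis_prod_def by (auto simp: inner_prod_def)
  then show ?thesis unfolding infnorm_Max by simp
qed

text \<open>
  The corner \<open>(r, r)\<close> of the square of radius \<open>r\<close> satisfies every constraint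
  \<open>P z\<^sub>1 + Q z\<^sub>2 \<ge> k\<close> with \<open>k \<le> r\<close> that is compatible with the constraint \<open>i\<close> and with the origin
  lying in the rectangular hull.
\<close>
lemma corner_feasible:
  fixes P Q k r Pi Qi z1 z2 w1 w2 :: real
  assumes i: "Pi > 0" "Qi > 0" "Pi + Qi = 1" and r: "r > 0"
    and PQ: "\<bar>P\<bar> + \<bar>Q\<bar> = 1" "k \<le> r"
    and z: "z1 \<le> 0" "Pi * z1 + Qi * z2 \<ge> r" "P * z1 + Q * z2 \<ge> k"
    and w: "w2 \<le> 0" "Pi * w1 + Qi * w2 \<ge> r" "P * w1 + Q * w2 \<ge> k"
  shows "P * r + Q * r \<ge> k"
proof -
  have z2: "z2 \<ge> r"
  proof -
    have "Pi * z1 \<le> 0" using i z by (simp add: mult_nonneg_nonpos)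
    then have "Qi * z2 \<ge> r" using z by linarith
    moreover have "Qi * z2 \<le> z2" if "z2 \<ge> 0" using that i by (simp add: mult_left_le_one_le)
    moreover have "z2 \<ge> 0"
      using \<open>Qi * z2 \<ge> r\<close> r i by (smt (verit) mult_pos_neg)
    ultimately show ?thesis by linarith
  qed
  have w1: "w1 \<ge> r"
  proof -
    have "Qi * w2 \<le> 0" using i w by (simp add: mult_nonneg_nonpos)
    then have "Pi * w1 \<ge> r" using w by linarith
    moreover have "Pi * w1 \<le> w1" if "w1 \<ge> 0" using that i by (simp add: mult_left_le_one_le)
    moreover have "w1 \<ge> 0"
      using \<open>Pi * w1 \<ge> r\<close> r i by (smt (verit) mult_pos_neg)
    ultimately show ?thesis by linarith
  qed
  consider "P \<ge> 0" "Q \<ge> 0" | "P \<ge> 0" "Q < 0" | "P < 0" "Q \<ge> 0" | "P < 0" "Q < 0" by linarith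
  then show ?thesis
  proof cases
    case 1
    then have "P * r + Q * r = r" using PQ by (simp flip: distrib_right)
    then show ?thesis using PQ by simp
  next
    case 2
    have "P * z1 \<le> 0" using 2 z by (simp add: mult_nonneg_nonpos)
    moreover have "Q * z2 \<le> Q * r" using 2 z2 by (simp add: mult_left_mono_neg)
    moreover have "P * r \<ge> 0" using 2 r by simp
    ultimately show ?thesis using z by linarith
  next
    case 3
    have "Q * w2 \<le> 0" using 3 w by (simp add: mult_nonneg_nonpos)
    moreover have "P * w1 \<le> P * r" using 3 w1 by (simp add: mult_left_mono_neg)
    moreover have "Q * r \<ge> 0" using 3 r by simp
    ultimately show ?thesis using w by linarith
  next
    case 4
    then have s: "- P - Q = 1" using PQ by linarith
    have "P * r + Q * r = (P + Q) * r" by (simp add: distrib_right)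
    moreover have "P + Q = - 1" using s by linarith
    ultimately have eq: "P * r + Q * r = - r" by simp
    \<comment> \<open>The weights \<open>(Pi, Qi)\<close> and \<open>(- P, - Q)\<close> both sum to
      1. The witness is chosen so that passing from the first pair to the second moves weight to its
      positive coordinate; the constraint \<open>i\<close> then yields
      \<open>r \<le> - k\<close>.\<close>
    show ?thesis
    proof (cases "Pi \<le> - P")
      case True
      then have "Pi * w1 \<le> - P * w1" using w1 r by (intro mult_right_mono) auto
      moreover have "Qi * w2 \<le> - Q * w2" using True s i w by (intro mult_right_mono_neg) auto
      ultimately show ?thesis using w eq by linarith
    next
      case False
      then have "Qi * z2 \<le> - Q * z2" using z2 r s i by (intro mult_right_mono) auto
      moreover have "Pi * z1 \<le> - P * z1" using False s i z by (intro mult_right_mono_neg) auto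
      ultimately show ?thesis using z eq by linarith
    qed
  qed
qed

text \<open>The signs are chosen so that each of the four sides of a box is a lower bound on some
  \<open>dir d\<close>; one minimisation routine then serves all sides.\<close>

definition dir :: "nat \<Rightarrow> real \<times> real \<Rightarrow> real" where
  "dir d u = (if d = 0 then fst u else if d = 1 then - fst u else if d = 2 then snd u else - snd u)"

lemma dir_simps [simp]:
  "dir 0 u = fst u" "dir (Suc 0) u = - fst u" "dir 2 u = snd u" "dir 3 u = - snd u"
  by (simp_all add: dir_def)

lemma all_less_4: "(\<forall>d<4. P d) \<longleftrightarrow> P 0 \<and> P (Suc 0) \<and> P 2 \<and> P (3::nat)"
  by (auto simp: numeral_eq_Suc less_Suc_eq)

definition polygon :: "'i set \<Rightarrow> ('i \<Rightarrow> real) \<Rightarrow> ('i \<Rightarrow> real) \<Rightarrow> ('i \<Rightarrow> real) \<Rightarrow> (real \<times> real) set" where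
  "polygon I p q c = {u. \<forall>i\<in>I. p i * fst u + q i * snd u \<le> c i}"

text \<open>Witnesses in \<open>K\<close> take the place of infima, so unbounded sides need no
  separate case. Agreement with the closed rectangular hull relies on finite minima being attained,
  as they are on polygons.\<close>

definition boxhull :: "(real \<times> real) set \<Rightarrow> (real \<times> real) set" where
  "boxhull K = {a. \<forall>d<4. \<exists>u\<in>K. dir d u \<le> dir d a}"

lemma boxhull_signed:
  assumes "a \<in> boxhull K"
  shows "\<exists>u\<in>K. 0 \<le> c * (fst u - fst a)" "\<exists>u\<in>K. 0 \<le> c * (snd u - snd a)"
proof -
  have ex: "\<exists>u\<in>K. fst u \<le> fst a" "\<exists>u\<in>K. - fst u \<le> - fst a"
    "\<exists>u\<in>K. snd u \<le> snd a" "\<exists>u\<in>K. - snd u \<le> - snd a"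
    using assms unfolding boxhull_def all_less_4 by auto
  then show "\<exists>u\<in>K. 0 \<le> c * (fst u - fst a)" "\<exists>u\<in>K. 0 \<le> c * (snd u - snd a)"
    by (metis diff_ge_0_iff_ge diff_le_0_iff_le linear neg_le_iff_le zero_le_mult_iff)+
qed

text \<open>Reflecting the axes by the signs of the active coefficients reduces the membership of
  the corner to \<open>corner_feasible\<close> centred at \<open>a\<close>. A vanishing active
  coefficient would make the constraint depend on one coordinate only, and it would then separate
  \<open>a\<close> from the polygon in that coordinate, against membership in the hull.\<close>

lemma corner_projection:
  assumes nrm: "\<And>i. i \<in> I \<Longrightarrow> \<bar>p i\<bar> + \<bar>q i\<bar> = 1"
    and a: "a \<in> boxhull (polygon I p q c)"
    and i: "i \<in> I" and r: "r > 0" "p i * fst a + q i * snd a - c i = r"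
    and le: "\<And>j. j \<in> I \<Longrightarrow> p j * fst a + q j * snd a - c j \<le> r"
  shows "p i \<noteq> 0" "q i \<noteq> 0"
    "(fst a - r * sgn (p i), snd a - r * sgn (q i)) \<in> polygon I p q c"
proof -
  have ci: "p i * (fst u - fst a) + q i * (snd u - snd a) \<le> - r" if "u \<in> polygon I p q c" for u
    using that i r unfolding polygon_def by (auto simp: algebra_simps)
  show p0: "p i \<noteq> 0"
  proof
    assume "p i = 0"
    then have "\<bar>q i\<bar> = 1" using nrm[OF i] by simp
    moreover have "\<exists>u\<in>polygon I p q c. 0 \<le> q i * (snd u - snd a)"
      using boxhull_signed(2)[OF a] .
    ultimately show False using ci \<open>p i = 0\<close> r by force
  qed
  show q0: "q i \<noteq> 0"
  proof
    assume "q i = 0"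
    then have "\<bar>p i\<bar> = 1" using nrm[OF i] by simp
    moreover have "\<exists>u\<in>polygon I p q c. 0 \<le> p i * (fst u - fst a)"
      using boxhull_signed(1)[OF a] .
    ultimately show False using ci \<open>q i = 0\<close> r by force
  qed
  define s t where "s = - sgn (p i)" and "t = - sgn (q i)"
  have s: "\<bar>s\<bar> = 1" "s * s = 1" and t: "\<bar>t\<bar> = 1" "t * t = 1"
    using p0 q0 by (auto simp: s_def t_def sgn_if)
  have neg: "- (s * p i) > 0" "- (t * q i) > 0" "- (s * p i) + - (t * q i) = 1"
    using p0 q0 nrm[OF i] by (auto simp: s_def t_def sgn_if split: if_splits)
  obtain u where u: "u \<in> polygon I p q c" "s * (fst u - fst a) \<le> 0"
    using boxhull_signed(1)[OF a, of "- s"] by auto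
  obtain v where v: "v \<in> polygon I p q c" "t * (snd v - snd a) \<le> 0"
    using boxhull_signed(2)[OF a, of "- t"] by auto
  have sw: "- (s * P) * (s * x) + - (t * Q) * (t * y) = - (P * x + Q * y)" for P Q x y
  proof -
    have "- (s * P) * (s * x) + - (t * Q) * (t * y) = - ((s * s) * (P * x)) - (t * t) * (Q * y)"
      by (simp add: algebra_simps)
    then show ?thesis unfolding s(2) t(2) by simp
  qed
  have "p j * (fst a + s * r) + q j * (snd a + t * r) \<le> c j" if j: "j \<in> I" for j
  proof -
    let ?k = "p j * fst a + q j * snd a - c j"
    have cj: "p j * (fst u - fst a) + q j * (snd u - snd a) \<le> - ?k" if "u \<in> polygon I p q c" for u
      using that j unfolding polygon_def by (auto simp: algebra_simps)
    have nj: "\<bar>- (s * p j)\<bar> + \<bar>- (t * q j)\<bar> = 1" using nrm[OF j] s t by (simp add: abs_mult)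
    have "- (s * p j) * r + - (t * q j) * r \<ge> ?k"
      by (rule corner_feasible[OF neg r(1) nj le[OF j] u(2) _ _ v(2), of "t * (snd u - snd a)" "s * (fst v - fst a)"])
        (unfold sw, (use ci[OF u(1)] ci[OF v(1)] cj[OF u(1)] cj[OF v(1)] in linarith)+)
    then show ?thesis by (simp add: algebra_simps)
  qed
  then show "(fst a - r * sgn (p i), snd a - r * sgn (q i)) \<in> polygon I p q c"
    unfolding polygon_def s_def t_def by (auto simp: algebra_simps)
qed


section \<open>Bounding boxes of polygons\<close>

definition other :: "nat \<Rightarrow> real \<times> real \<Rightarrow> real" where
  "other d u = (if d < 2 then snd u else fst u)"

definition dir_coeff :: "nat \<Rightarrow> ('i \<Rightarrow> real) \<Rightarrow> ('i \<Rightarrow> real) \<Rightarrow> 'i \<Rightarrow> real" where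
  "dir_coeff d p q i = (if d = 0 then p i else if d = 1 then - p i else if d = 2 then q i else - q i)"

definition other_coeff :: "nat \<Rightarrow> ('i \<Rightarrow> real) \<Rightarrow> ('i \<Rightarrow> real) \<Rightarrow> 'i \<Rightarrow> real" where
  "other_coeff d p q i = (if d < 2 then q i else p i)"

definition dir_roots ::
    "nat \<Rightarrow> 'i set \<Rightarrow> ('i \<Rightarrow> real) \<Rightarrow> ('i \<Rightarrow> real) \<Rightarrow> ('i \<Rightarrow> real) \<Rightarrow> real set" where
  "dir_roots d I p q c = roots (dir_coeff d p q) (other_coeff d p q) c I"

text \<open>A set with at most one element instead of a number: for a nonempty polygon it is empty
  exactly when \<open>dir d\<close> is unbounded below, which stands for the value minus
  infinity.\<close>

definition dir_min :: "nat \<Rightarrow> (real \<times> real) set \<Rightarrow> real set" where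
  "dir_min d K = {A. (\<exists>u\<in>K. dir d u = A) \<and> (\<forall>u\<in>K. A \<le> dir d u)}"

lemma dir_other_coeff:
  "dir_coeff d p q i * dir d u + other_coeff d p q i * other d u = p i * fst u + q i * snd u"
  by (auto simp: dir_coeff_def other_coeff_def dir_def other_def)

lemma polygon_dir:
  "u \<in> polygon I p q c \<longleftrightarrow>
     (\<forall>i\<in>I. dir_coeff d p q i * dir d u + other_coeff d p q i * other d u \<le> c i)"
  unfolding polygon_def dir_other_coeff by simp

lemma exists_dir_other: "\<exists>u. dir d u = t \<and> other d u = s"
  by (rule exI[of _ "if d = 0 then (t, s) else if d = 1 then (- t, s) else if d = 2 then (s, t) else (s, - t)"])
    (auto simp: dir_def other_def)

lemma dir_roots_le:
  assumes "u \<in> polygon I p q c" "r \<in> dir_roots d I p q c"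
  shows "r \<le> dir d u"
  using assms roots_le unfolding polygon_dir[of u I p q c d] dir_roots_def by blast

lemma polygon_dir_down:
  assumes "finite I" "u \<in> polygon I p q c" "t \<le> dir d u" "\<forall>r\<in>dir_roots d I p q c. r \<le> t"
  shows "\<exists>v\<in>polygon I p q c. dir d v = t"
proof -
  obtain s where "\<forall>i\<in>I. dir_coeff d p q i * t + other_coeff d p q i * s \<le> c i"
    using feasible_down[OF assms(1) assms(2)[unfolded polygon_dir[of u I p q c d]] assms(3)] assms(4)
    unfolding dir_roots_def by blast
  moreover obtain v where "dir d v = t" "other d v = s" using exists_dir_other by blast
  ultimately show ?thesis by (intro bexI[of _ v]) (simp_all add: polygon_dir[of _ I p q c d])
qed

text \<open>Every root is a lower bound of \<open>dir d\<close>, and from any point of the polygon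
  one can descend to the largest root.\<close>

lemma dir_min_eq_Max:
  assumes fin: "finite I" and ne: "polygon I p q c \<noteq> {}" and rt: "dir_roots d I p q c \<noteq> {}"
  shows "dir_min d (polygon I p q c) = {Max (dir_roots d I p q c)}"
proof -
  let ?A = "Max (dir_roots d I p q c)"
  have fr: "finite (dir_roots d I p q c)" using finite_roots[OF fin] unfolding dir_roots_def .
  have le: "?A \<le> dir d u" if "u \<in> polygon I p q c" for u
    using dir_roots_le[OF that] Max_in[OF fr rt] by blast
  obtain u where u: "u \<in> polygon I p q c" using ne by blast
  obtain v where v: "v \<in> polygon I p q c" "dir d v = ?A"
    using polygon_dir_down[OF fin u le[OF u]] fr by auto
  have "A = ?A" if "\<exists>u\<in>polygon I p q c. dir d u = A" "\<forall>u\<in>polygon I p q c. A \<le> dir d u" for A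
    using le v that by (metis order_antisym)
  then show ?thesis unfolding dir_min_def using le v by auto
qed

lemma dir_unbounded:
  assumes fin: "finite I" and ne: "polygon I p q c \<noteq> {}" and rt: "dir_roots d I p q c = {}"
  shows "\<exists>u\<in>polygon I p q c. dir d u \<le> t"
proof -
  obtain u where u: "u \<in> polygon I p q c" using ne by blast
  show ?thesis
    using polygon_dir_down[OF fin u, of "min t (dir d u)" d] rt by (metis empty_iff min.cobounded1 min.cobounded2)
qed

lemma dir_min_eq:
  assumes fin: "finite I" and ne: "polygon I p q c \<noteq> {}"
  shows "dir_min d (polygon I p q c) =
    (if dir_roots d I p q c = {} then {} else {Max (dir_roots d I p q c)})"
proof (cases "dir_roots d I p q c = {}")
  case True
  have "A \<notin> dir_min d (polygon I p q c)" for A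
    using dir_unbounded[OF fin ne True, of "A - 1"] unfolding dir_min_def by force
  then show ?thesis using True by auto
qed (use dir_min_eq_Max[OF fin ne] in auto)

lemma exists_dir_le_iff:
  assumes fin: "finite I" and ne: "polygon I p q c \<noteq> {}"
  shows "(\<exists>u\<in>polygon I p q c. dir d u \<le> t) \<longleftrightarrow> (\<forall>A\<in>dir_min d (polygon I p q c). A \<le> t)"
proof (cases "dir_roots d I p q c = {}")
  case True
  then show ?thesis using dir_unbounded[OF fin ne True] dir_min_eq[OF fin ne, of d] by auto
next
  case False
  then have eq: "dir_min d (polygon I p q c) = {Max (dir_roots d I p q c)}"
    using dir_min_eq[OF fin ne] by simp
  then have "Max (dir_roots d I p q c) \<in> dir_min d (polygon I p q c)" by simp
  then obtain v where "v \<in> polygon I p q c" "dir d v = Max (dir_roots d I p q c)"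
    "\<forall>u\<in>polygon I p q c. Max (dir_roots d I p q c) \<le> dir d u"
    unfolding dir_min_def by blast
  then show ?thesis unfolding eq by (metis order_trans singleton_iff)
qed

text \<open>The set is a closed half-line, or the whole line, because a finite minimum is attained.
  Rectangles have closed sides, so this is what makes \<open>boxhull\<close> of a polygon a
  rectangle.\<close>

lemma closed_exists_dir_le:
  assumes "finite I" "polygon I p q c \<noteq> {}"
  shows "closed {t. \<exists>u\<in>polygon I p q c. dir d u \<le> t}"
proof -
  have "{t. \<exists>u\<in>polygon I p q c. dir d u \<le> t} = (\<Inter>A\<in>dir_min d (polygon I p q c). {A..})"
    unfolding exists_dir_le_iff[OF assms] by auto
  then show ?thesis by auto
qed

lemma closed_exists_dir_ge:
  assumes "finite I" "polygon I p q c \<noteq> {}"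
  shows "closed {t. \<exists>u\<in>polygon I p q c. dir d u \<le> - t}"
proof -
  have "{t. \<exists>u\<in>polygon I p q c. dir d u \<le> - t} = uminus ` {t. \<exists>u\<in>polygon I p q c. dir d u \<le> t}"
    by (auto simp: image_iff) (metis minus_minus)
  then show ?thesis using closed_negations[OF closed_exists_dir_le[OF assms]] by simp
qed

lemma polygon_subset_boxhull: "K \<subseteq> boxhull K"
  unfolding boxhull_def by auto

lemma rectangle_hull_polygon:
  assumes fin: "finite I" and ne: "polygon I p q c \<noteq> {}"
  shows "rectangle hull polygon I p q c = boxhull (polygon I p q c)"
proof
  let ?K = "polygon I p q c"
  let ?X = "\<lambda>d d'. {t. (\<exists>u\<in>?K. dir d u \<le> t) \<and> (\<exists>u\<in>?K. dir d' u \<le> - t)}"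
  have cl: "closed (?X d d')" for d d'
    unfolding Collect_conj_eq using closed_exists_dir_le[OF assms] closed_exists_dir_ge[OF assms] by blast
  have int: "is_interval (?X d d')" for d d'
    unfolding is_interval_1 by (auto intro: order_trans) (meson neg_le_iff_le order_trans)+
  obtain u where u: "u \<in> ?K" using ne by blast
  have eq: "boxhull ?K = ?X 0 1 \<times> ?X 2 3"
    unfolding boxhull_def all_less_4 by (rule set_eqI) (simp add: mem_Times_iff conj_assoc)
  have "rectangle (boxhull ?K)"
    unfolding rectangle_def
    apply (rule exI[of _ "?X 0 1"], rule exI[of _ "?X 2 3"])
    using cl int eq u polygon_subset_boxhull[of ?K] by blast
  then show "rectangle hull ?K \<subseteq> boxhull ?K"
    by (intro hull_minimal polygon_subset_boxhull)
  have "a \<in> R" if R: "rectangle R" "?K \<subseteq> R" and a: "a \<in> boxhull ?K" for a R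
  proof -
    obtain I1 I2 :: "real set" where I: "is_interval I1" "is_interval I2" "R = I1 \<times> I2"
      using R unfolding rectangle_def by blast
    have *: "\<exists>u\<in>?K. fst u \<le> fst a" "\<exists>u\<in>?K. fst a \<le> fst u"
      "\<exists>u\<in>?K. snd u \<le> snd a" "\<exists>u\<in>?K. snd a \<le> snd u"
      using a unfolding boxhull_def all_less_4 by auto
    have K: "fst u \<in> I1" "snd u \<in> I2" if "u \<in> ?K" for u
      using that R I by auto
    have "fst a \<in> I1" "snd a \<in> I2"
      using * K I(1,2) unfolding is_interval_1 by blast+
    then show ?thesis using I(3) by (simp add: mem_Times_iff)
  qed
  then show "boxhull ?K \<subseteq> rectangle hull ?K"
    unfolding hull_def by blast
qed

section \<open>The projection algorithm for normalised half-planes\<close>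

text \<open>
  Two half-planes whose projections push \<open>u\<close> in opposite vertical directions, tested at a point
  displaced by \<open>(\<alpha>, \<beta>)\<close> with \<open>\<alpha>\<close> helping neither of them.
\<close>
lemma opposite_push:
  fixes pi qi pj qj :: real
  assumes "pi * pj > 0" "qi * qj < 0" "0 \<le> pi * \<alpha>"
    and "r + pi * \<alpha> + qi * \<beta> \<le> 0" "r' + pj * \<alpha> + qj * \<beta> \<le> 0"
  shows "\<bar>qj\<bar> * r + \<bar>qi\<bar> * r' \<le> 0"
proof -
  have "0 \<le> pj * \<alpha>"
    using assms(1,3) by (cases "pi > 0") (auto simp: zero_le_mult_iff zero_less_mult_iff)
  then have "qi * \<beta> \<le> - r" "qj * \<beta> \<le> - r'" using assms by linarith+
  then have "\<bar>qj\<bar> * (qi * \<beta>) \<le> \<bar>qj\<bar> * - r" "\<bar>qi\<bar> * (qj * \<beta>) \<le> \<bar>qi\<bar> * - r'"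
    by (simp_all only: mult_left_mono abs_ge_zero)
  moreover have "\<bar>qj\<bar> * (qi * \<beta>) + \<bar>qi\<bar> * (qj * \<beta>) = 0"
    using assms(2) by (auto simp: abs_if mult_less_0_iff)
  ultimately show ?thesis by auto
qed

text \<open>If \<open>a\<close> is the smaller weight, then \<open>a * r \<le> b * r\<close> and
  \<open>a\<close> factors out of the first inequality; otherwise \<open>b\<close> factors out of
  the second. In the application \<open>a\<close> and \<open>b\<close> are absolute coefficients of
  two active constraints whose order is unknown.\<close>

lemma sum_le_of_weighted:
  fixes a b r r' s :: real
  assumes "0 < a" "0 < b" "0 \<le> r" "0 \<le> r'"
    and "b * r + a * (r' - s) \<le> 0" "a * r' + b * (r - s) \<le> 0"
  shows "r + r' \<le> s"
proof (cases "a \<le> b")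
  case True
  then have "a * r \<le> b * r" using assms by (intro mult_right_mono)
  then have "a * (r + r' - s) \<le> 0" using assms by (simp add: algebra_simps)
  then show ?thesis using assms by (simp add: mult_le_0_iff)
next
  case False
  then have "b * r' \<le> a * r'" using assms by (intro mult_right_mono) auto
  then have "b * (r + r' - s) \<le> 0" using assms by (simp add: algebra_simps)
  then show ?thesis using assms by (simp add: mult_le_0_iff)
qed

text \<open>Finite distance is the relation \<open>act\<close>, an equivalence on \<open>M\<close>,
  and \<open>w\<close> is the scaled distance as a real number. The triangle inequality is asked for
  only along finite distances, where no value infinity can interfere.\<close>

locale halfplanes =
  fixes M :: "'a set" and w :: "'a \<Rightarrow> 'a \<Rightarrow> real" and act :: "'a \<Rightarrow> 'a \<Rightarrow> bool"
    and p q b :: "'a \<Rightarrow> real"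
  assumes finite_M: "finite M"
    and norm1: "y \<in> M \<Longrightarrow> \<bar>p y\<bar> + \<bar>q y\<bar> = 1"
    and w_nonneg: "w x y \<ge> 0"
    and act_refl: "x \<in> M \<Longrightarrow> act x x" and w_refl: "x \<in> M \<Longrightarrow> w x x = 0"
    and act_sym: "x \<in> M \<Longrightarrow> y \<in> M \<Longrightarrow> act x y \<Longrightarrow> act y x"
    and w_sym: "x \<in> M \<Longrightarrow> y \<in> M \<Longrightarrow> w x y = w y x"
    and act_trans: "x \<in> M \<Longrightarrow> y \<in> M \<Longrightarrow> z \<in> M \<Longrightarrow> act x z \<Longrightarrow> act z y \<Longrightarrow> act x y"
    and w_triangle: "x \<in> M \<Longrightarrow> y \<in> M \<Longrightarrow> z \<in> M \<Longrightarrow> act x z \<Longrightarrow> act z y \<Longrightarrow> w x y \<le> w x z + w z y"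
begin

definition K :: "'a \<Rightarrow> (real \<times> real) set" where
  "K x = polygon {y \<in> M. act x y} p q (\<lambda>y. w x y - b y)"

definition T1 :: "'a \<Rightarrow> (real \<times> real) set" where
  "T1 x = {a. \<forall>y\<in>M. act x y \<longrightarrow> (\<forall>d<4. \<exists>u\<in>K y. dir d u \<le> dir d a + w x y)}"

definition lower_bounds :: "nat \<Rightarrow> 'a \<Rightarrow> real set" where
  "lower_bounds d x = (\<Union>y\<in>{y \<in> M. act x y}. (\<lambda>A. A - w x y) ` dir_min d (K y))"

text \<open>The uniform distance from the origin to \<open>T1 x\<close> when that box is nonempty: a
  point with \<open>r \<le> dir d a\<close> has uniform norm at least \<open>r\<close>. The element
  0 covers the origin lying in the box.\<close>

definition rad :: "'a \<Rightarrow> real" where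
  "rad x = Max (insert 0 (\<Union>d<4. lower_bounds d x))"

text \<open>The sides of the box obtained by cutting \<open>T1 x\<close> with the square of radius
  \<open>rad x\<close> about the origin, that is, of the projection of the origin.\<close>

definition lo :: "nat \<Rightarrow> 'a \<Rightarrow> real" where
  "lo d x = Max (insert (- rad x) (lower_bounds d x))"

definition g :: "'a \<Rightarrow> real \<times> real" where
  "g x = ((lo 0 x - lo 1 x) / 2, (lo 2 x - lo 3 x) / 2)"

definition excess :: "'a \<Rightarrow> 'a \<Rightarrow> real" where
  "excess x y = p y * fst (g x) + q y * snd (g x) + b y - w x y"

text \<open>For feasible \<open>x\<close> this turns out to be the uniform distance from
  \<open>g x\<close> to \<open>K x\<close>, the element 0 covering a centre that already lies in
  \<open>K x\<close>.\<close>

definition R :: "'a \<Rightarrow> real" where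
  "R x = Max (insert 0 (excess x ` {y \<in> M. act x y}))"

definition corner :: "'a \<Rightarrow> 'a \<Rightarrow> real \<times> real" where
  "corner x y = (fst (g x) - R x * sgn (p y), snd (g x) - R x * sgn (q y))"

definition f :: "'a \<Rightarrow> real \<times> real" where
  "f x = the_elem (Pr (g x) (K x))"

text \<open>The two coordinates of a box are independent, so it is nonempty as soon as opposite
  sides do not cross.\<close>

definition feasible :: "'a \<Rightarrow> bool" where
  "feasible x \<longleftrightarrow> (\<forall>a\<in>lower_bounds 0 x. \<forall>b\<in>lower_bounds 1 x. a + b \<le> 0) \<and> (\<forall>a\<in>lower_bounds 2 x. \<forall>b\<in>lower_bounds 3 x. a + b \<le> 0)"

lemma finite_active: "finite {y \<in> M. act x y}"
  using finite_M by simp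

lemma mem_K: "u \<in> K x \<longleftrightarrow> (\<forall>y\<in>M. act x y \<longrightarrow> p y * fst u + q y * snd u + b y \<le> w x y)"
  unfolding K_def polygon_def by (auto simp: algebra_simps)

lemma K_excess:
  assumes "u \<in> K x" "y \<in> M" "act x y"
  shows "excess x y + p y * (fst u - fst (g x)) + q y * (snd u - snd (g x)) \<le> 0"
  using assms unfolding mem_K excess_def by (auto simp: algebra_simps)

lemma excess_le_R: "y \<in> M \<Longrightarrow> act x y \<Longrightarrow> excess x y \<le> R x"
  unfolding R_def using finite_active by auto

lemma R_nonneg: "0 \<le> R x"
  unfolding R_def using finite_active by auto

lemma R_attained: "R x = 0 \<or> (\<exists>y\<in>M. act x y \<and> excess x y = R x)"
proof -
  have "R x \<in> insert 0 (excess x ` {y \<in> M. act x y})"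
    unfolding R_def using finite_active by (intro Max_in) auto
  then show ?thesis by auto
qed

context
  assumes K_ne: "\<And>x. x \<in> M \<Longrightarrow> K x \<noteq> {}"
begin

section \<open>Projection of the origin onto the intersected boxes\<close>

lemma finite_lower_bounds: "finite (lower_bounds d x)"
proof -
  have "finite (dir_min d (K y))" if "y \<in> M" for y
    using dir_min_eq[OF finite_active K_ne[OF that, unfolded K_def]] unfolding K_def by simp
  then show ?thesis unfolding lower_bounds_def using finite_M by auto
qed

lemma T1_iff: "a \<in> T1 x \<longleftrightarrow> (\<forall>d<4. \<forall>r\<in>lower_bounds d x. r \<le> dir d a)"
proof -
  have "(\<exists>u\<in>K y. dir d u \<le> t) \<longleftrightarrow> (\<forall>A\<in>dir_min d (K y). A \<le> t)" if "y \<in> M" for y d t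
    using exists_dir_le_iff[OF finite_active K_ne[OF that, unfolded K_def]] unfolding K_def by blast
  then show ?thesis unfolding T1_def lower_bounds_def by (auto simp: algebra_simps)
qed

lemma T1_subset_boxhull: "x \<in> M \<Longrightarrow> T1 x \<subseteq> boxhull (K x)"
  unfolding T1_def boxhull_def using act_refl w_refl by force

lemma finite_rad_set: "finite (insert 0 (\<Union>d<4. lower_bounds d x))"
  using finite_lower_bounds by simp

lemma rad_nonneg: "0 \<le> rad x"
  unfolding rad_def using finite_rad_set by (intro Max_ge) auto

lemma lbs_le_rad: "r \<in> lower_bounds d x \<Longrightarrow> d < 4 \<Longrightarrow> r \<le> rad x"
  unfolding rad_def using finite_rad_set by (intro Max_ge) auto

lemma rad_attained: "rad x = 0 \<or> (\<exists>d<4. rad x \<in> lower_bounds d x)"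
  using Max_in[OF finite_rad_set] unfolding rad_def by blast

lemma lbs_le_lo: "r \<in> lower_bounds d x \<Longrightarrow> r \<le> lo d x"
  unfolding lo_def using finite_lower_bounds by (intro Max_ge) auto

lemma lo_ge: "- rad x \<le> lo d x"
  unfolding lo_def using finite_lower_bounds by (intro Max_ge) auto

lemma lo_attained: "lo d x = - rad x \<or> lo d x \<in> lower_bounds d x"
  using Max_in[of "insert (- rad x) (lower_bounds d x)"] finite_lower_bounds unfolding lo_def by blast

lemma lo_le: "d < 4 \<Longrightarrow> lo d x \<le> rad x"
  using lo_attained[of d x] lbs_le_rad[of "lo d x" d x] rad_nonneg[of x] by auto

lemma feasible_lo:
  assumes "feasible x"
  shows "lo 0 x + lo 1 x \<le> 0" "lo 2 x + lo 3 x \<le> 0"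
proof -
  have pair: "lo d x + lo d' x \<le> 0"
    if "\<forall>a\<in>lower_bounds d x. \<forall>b\<in>lower_bounds d' x. a + b \<le> 0" "d < 4" "d' < 4" for d d'
    using that lo_attained[of d x] lo_attained[of d' x] lo_le[of d x] lo_le[of d' x] rad_nonneg[of x]
    by (elim disjE) (blast | linarith)+
  show "lo 0 x + lo 1 x \<le> 0" "lo 2 x + lo 3 x \<le> 0"
    using assms unfolding feasible_def by (auto intro: pair)
qed

lemma lo_le_dir_g:
  assumes "feasible x" "d < 4"
  shows "lo d x \<le> dir d (g x)"
proof -
  have "\<forall>d<4. lo d x \<le> dir d (g x)"
    unfolding all_less_4 dir_simps g_def fst_conv snd_conv
    using feasible_lo[OF assms(1)] by (auto simp: field_simps)
  then show ?thesis using assms by blast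
qed

lemma g_in_T1: "feasible x \<Longrightarrow> g x \<in> T1 x"
  unfolding T1_iff using lo_le_dir_g lbs_le_lo order_trans by blast

lemma T1_ne_iff: "T1 x \<noteq> {} \<longleftrightarrow> feasible x"
proof
  assume "T1 x \<noteq> {}"
  then obtain a where "\<forall>d<4. \<forall>r\<in>lower_bounds d x. r \<le> dir d a" unfolding T1_iff[symmetric] by blast
  then show "feasible x" unfolding all_less_4 feasible_def by fastforce
qed (use g_in_T1 in blast)

lemma infnorm_g: "infnorm (g x) \<le> rad x"
proof -
  have "\<bar>lo d x\<bar> \<le> rad x" if "d < 4" for d
    using lo_le[OF that, of x] lo_ge[of x d] by linarith
  from this[of 0] this[of 1] this[of 2] this[of 3]
  have "\<bar>(lo 0 x - lo 1 x) / 2\<bar> \<le> rad x" "\<bar>(lo 2 x - lo 3 x) / 2\<bar> \<le> rad x" by simp_all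
  then show ?thesis unfolding infnorm_pair g_def by simp
qed

lemma dir_le_infnorm: "dir d a \<le> infnorm a"
  unfolding infnorm_pair dir_def by auto

lemma rad_le_infnorm:
  assumes "a \<in> T1 x"
  shows "rad x \<le> infnorm a"
  using rad_attained[of x]
proof
  assume "\<exists>d<4. rad x \<in> lower_bounds d x"
  then show ?thesis using assms dir_le_infnorm order_trans unfolding T1_iff by blast
qed (simp add: infnorm_pos_le)

lemma setdist_T1:
  assumes "feasible x"
  shows "uniform_setdist (0, 0) (T1 x) = rad x"
  unfolding uniform_setdist_def
proof (rule cInf_eq_minimum)
  have "infnorm (g x) = rad x"
    using infnorm_g rad_le_infnorm[OF g_in_T1[OF assms]] by (simp add: order_antisym)
  then show "rad x \<in> (\<lambda>s. infnorm ((0, 0) - s)) ` T1 x"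
    using g_in_T1[OF assms] by (auto simp: image_iff infnorm_neg simp flip: zero_prod_def intro!: bexI[of _ "g x"])
  show "rad x \<le> r" if "r \<in> (\<lambda>s. infnorm ((0, 0) - s)) ` T1 x" for r
    using that rad_le_infnorm by (auto simp: infnorm_neg simp flip: zero_prod_def)
qed

lemma Pr_T1:
  assumes "feasible x"
  shows "Pr (0, 0) (T1 x) = {a. \<forall>d<4. lo d x \<le> dir d a}"
proof -
  have "a \<in> T1 x \<and> infnorm a \<le> rad x \<longleftrightarrow> (\<forall>d<4. lo d x \<le> dir d a)" for a
  proof
    assume a: "a \<in> T1 x \<and> infnorm a \<le> rad x"
    then have "- rad x \<le> dir d a" for d
      unfolding infnorm_pair dir_def by auto
    then show "\<forall>d<4. lo d x \<le> dir d a"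
      using a lo_attained[of _ x] unfolding T1_iff by metis
  next
    assume a: "\<forall>d<4. lo d x \<le> dir d a"
    then have "a \<in> T1 x" unfolding T1_iff using lbs_le_lo order_trans by blast
    moreover have "\<forall>d<4. - rad x \<le> dir d a" using a lo_ge order_trans by blast
    then have "infnorm a \<le> rad x" unfolding all_less_4 infnorm_pair by auto
    ultimately show "a \<in> T1 x \<and> infnorm a \<le> rad x" by blast
  qed
  then show ?thesis
    unfolding Pr_def setdist_T1[OF assms] square_def by (auto simp flip: zero_prod_def)
qed

text \<open>At least one side of the projection is a point: if \<open>rad x\<close> is attained in direction \<open>d\<close>, then
  both bounds in that direction and its opposite are \<open>rad x\<close> and \<open>- rad x\<close>.\<close>
lemma lo_degenerate:
  assumes "feasible x"
  shows "lo 0 x + lo 1 x = 0 \<or> lo 2 x + lo 3 x = 0"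
proof (cases "rad x = 0")
  case True
  then show ?thesis using lo_ge[of x 0] lo_ge[of x 1] lo_le[of 0 x] lo_le[of 1 x] by auto
next
  case False
  then obtain d where d: "d < 4" "rad x \<in> lower_bounds d x" using rad_attained by blast
  then have "lo d x = rad x" using lbs_le_lo lo_le by (simp add: order_antisym)
  moreover have "d = 0 \<or> d = 1 \<or> d = 2 \<or> d = 3" using d(1) by linarith
  ultimately show ?thesis
    using feasible_lo[OF assms] lo_ge[of x 0] lo_ge[of x 1] lo_ge[of x 2] lo_ge[of x 3] by force
qed

lemma closed_segment_same_fst:
  fixes a c e :: real
  assumes "c \<le> e"
  shows "closed_segment (a, c) (a, e) = {a} \<times> {c..e}" "closed_segment (c, a) (e, a) = {c..e} \<times> {a}"
proof -
  have *: "(1 - u) * a + u * a = a" for u by (simp add: algebra_simps)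
  show "closed_segment (a, c) (a, e) = {a} \<times> {c..e}" "closed_segment (c, a) (e, a) = {c..e} \<times> {a}"
    unfolding closed_segment_eq_real_ivl1[OF assms, symmetric]
    by (auto simp: closed_segment_def * )
qed

lemma center_Pr_T1:
  assumes "feasible x"
  shows "center (Pr (0, 0) (T1 x)) = g x"
proof -
  let ?s = "(lo 0 x, lo 2 x)" and ?t = "(- lo 1 x, - lo 3 x)"
  have "Pr (0, 0) (T1 x) = {lo 0 x..- lo 1 x} \<times> {lo 2 x..- lo 3 x}"
    unfolding Pr_T1[OF assms] all_less_4 by auto
  also have "\<dots> = closed_segment ?s ?t"
  proof (cases "lo 0 x + lo 1 x = 0")
    case True
    then have "lo 0 x = - lo 1 x" by linarith
    then show ?thesis using closed_segment_same_fst(1)[of "lo 2 x" "- lo 3 x" "- lo 1 x"]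
        feasible_lo[OF assms] by auto
  next
    case False
    then have "lo 2 x = - lo 3 x" using lo_degenerate[OF assms] by linarith
    then show ?thesis using closed_segment_same_fst(2)[of "lo 0 x" "- lo 1 x" "- lo 3 x"]
        feasible_lo[OF assms] by auto
  qed
  finally have eq: "Pr (0, 0) (T1 x) = closed_segment ?s ?t" .
  have mid: "midpoint ?s ?t = g x"
    unfolding g_def midpoint_def by (auto simp: field_simps)
  show ?thesis
    unfolding center_def eq
  proof (rule the_equality)
    show "\<exists>a b. closed_segment ?s ?t = closed_segment a b \<and> g x = midpoint a b"
      by (intro exI[of _ ?s] exI[of _ ?t] conjI refl mid[symmetric])
    fix c assume "\<exists>a b. closed_segment ?s ?t = closed_segment a b \<and> c = midpoint a b"
    then obtain a e where ae: "closed_segment ?s ?t = closed_segment a e" "c = midpoint a e" by blast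
    \<comment> \<open>A segment determines its endpoints up to order, and the midpoint is symmetric
      in them; this is the uniqueness that the definite description in \<open>center\<close>
      requires.\<close>
    have "?s = a \<and> ?t = e \<or> ?s = e \<and> ?t = a"
      using ae(1) unfolding closed_segment_eq doubleton_eq_iff .
    then show "c = g x"
      using mid midpoint_sym[of ?s ?t] ae(2) by fastforce
  qed
qed

section \<open>Lipschitz continuity of the box centres\<close>

lemma lbs_shift:
  assumes "x \<in> M" "y \<in> M" "act x y" "r \<in> lower_bounds d x"
  shows "\<exists>r'\<in>lower_bounds d y. r \<le> r' + w x y"
proof -
  have "r \<in> (\<Union>y\<in>{y \<in> M. act x y}. (\<lambda>A. A - w x y) ` dir_min d (K y))"
    using assms(4) unfolding lower_bounds_def .
  then obtain z where z0: "z \<in> {y \<in> M. act x y}" "r \<in> (\<lambda>A. A - w x z) ` dir_min d (K z)"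
    by (rule UN_E)
  from z0(2) obtain A where A: "r = A - w x z" "A \<in> dir_min d (K z)" by (rule imageE)
  have z: "z \<in> M" "act x z" "A \<in> dir_min d (K z)" "r = A - w x z" using z0 A by simp_all
  \<comment> \<open>Finite distance is transitive, so the polygon of \<open>z\<close> also bounds
    the box of \<open>y\<close>, and the triangle inequality limits the change of the offset to
    \<open>w x y\<close>.\<close>
  have yx: "act y x" using act_sym assms by blast
  then have "act y z" using act_trans[OF _ _ _ yx] assms z by blast
  then have "A - w y z \<in> lower_bounds d y" using z(1,3) unfolding lower_bounds_def by blast
  moreover have "w y z \<le> w x y + w x z"
    using w_triangle[OF assms(2) z(1) assms(1) yx z(2)] w_sym[OF assms(1,2)] by linarith
  then have "r \<le> A - w y z + w x y" using z(4) by linarith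
  ultimately show ?thesis by blast
qed

lemma rad_shift:
  assumes "x \<in> M" "y \<in> M" "act x y"
  shows "rad x \<le> rad y + w x y"
  using rad_attained[of x]
proof
  assume "\<exists>d<4. rad x \<in> lower_bounds d x"
  then obtain d r' where "d < 4" "r' \<in> lower_bounds d y" "rad x \<le> r' + w x y"
    using lbs_shift[OF assms] by blast
  then show ?thesis using lbs_le_rad[of r' d y] by linarith
qed (use rad_nonneg[of y] w_nonneg[of x y] in linarith)

lemma lo_shift:
  assumes "x \<in> M" "y \<in> M" "act x y"
  shows "lo d x \<le> lo d y + w x y"
  using lo_attained[of d x]
proof
  assume "lo d x = - rad x"
  then show ?thesis
    using lo_ge[of y d] rad_shift[OF assms(2,1) act_sym[OF assms]] w_sym[OF assms(1,2)] by linarith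
next
  assume "lo d x \<in> lower_bounds d x"
  then obtain r' where "r' \<in> lower_bounds d y" "lo d x \<le> r' + w x y"
    using lbs_shift[OF assms] by blast
  then show ?thesis using lbs_le_lo[of r' d y] by linarith
qed

text \<open>Each coordinate of the centre is half the difference of two side bounds, and each of
  these moves by at most \<open>w x y\<close>; the half compensates for the two
  contributions.\<close>

lemma g_lipschitz:
  assumes "x \<in> M" "y \<in> M" "act x y"
  shows "\<bar>fst (g x) - fst (g y)\<bar> \<le> w x y" "\<bar>snd (g x) - snd (g y)\<bar> \<le> w x y"
proof -
  have "\<bar>lo d x - lo d y\<bar> \<le> w x y" for d
    using lo_shift[OF assms, of d] lo_shift[OF assms(2,1) act_sym[OF assms], of d] w_sym[OF assms(1,2)]
    by linarith
  note * = this[of 0] this[of 1] this[of 2] this[of 3]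
  show "\<bar>fst (g x) - fst (g y)\<bar> \<le> w x y"
    using *(1,2) unfolding g_def fst_conv abs_le_iff by (auto simp: field_simps)
  show "\<bar>snd (g x) - snd (g y)\<bar> \<le> w x y"
    using *(3,4) unfolding g_def snd_conv abs_le_iff by (auto simp: field_simps)
qed

section \<open>Projection of a centre onto its polygon\<close>

lemma Pr_K:
  assumes x: "x \<in> M" and f: "feasible x"
  shows "R x = 0 \<Longrightarrow> Pr (g x) (K x) = {g x}"
    and "y \<in> M \<Longrightarrow> act x y \<Longrightarrow> excess x y = R x \<Longrightarrow> R x > 0 \<Longrightarrow>
      p y \<noteq> 0 \<and> q y \<noteq> 0 \<and> corner x y \<in> K x \<and> Pr (g x) (K x) = {corner x y}"
proof -
  assume R0: "R x = 0"
  have gK: "g x \<in> K x"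
    using excess_le_R[of _ x] unfolding R0 mem_K excess_def by auto
  have "uniform_setdist (g x) (K x) = 0"
    unfolding uniform_setdist_def
  proof (rule cInf_eq_minimum)
    show "0 \<in> (\<lambda>s. infnorm (g x - s)) ` K x" using gK by (intro image_eqI[of _ _ "g x"]) (simp_all add: infnorm_0)
  qed (auto simp: infnorm_pos_le)
  then show "Pr (g x) (K x) = {g x}"
    unfolding Pr_def square_def using gK
    by (auto simp: infnorm_0 dest!: order_antisym[OF _ infnorm_pos_le] simp add: infnorm_eq_0)
next
  assume y: "y \<in> M" "act x y" and e: "excess x y = R x" and pos: "R x > 0"
  have bh: "g x \<in> boxhull (polygon {y \<in> M. act x y} p q (\<lambda>y. w x y - b y))"
    using T1_subset_boxhull[OF x] g_in_T1[OF f] unfolding K_def by blast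
  have le: "p z * fst (g x) + q z * snd (g x) - (w x z - b z) \<le> R x" if "z \<in> {y \<in> M. act x y}" for z
    using excess_le_R[of z x] that unfolding excess_def by auto
  have eq: "p y * fst (g x) + q y * snd (g x) - (w x y - b y) = R x"
    using e unfolding excess_def by simp
  have pq: "p y \<noteq> 0" "q y \<noteq> 0" and c: "corner x y \<in> K x"
    using corner_projection[OF _ bh, of y "R x"] norm1 y pos eq le
    unfolding corner_def K_def by auto
  \<comment> \<open>In reflected coordinates the constraint \<open>y\<close> says that a weighted
    mean of \<open>\<alpha>\<close> and \<open>\<beta>\<close> is at least \<open>R x\<close>, while
    neither exceeds \<open>R x\<close>. Both weights are positive, so
    \<open>\<alpha> = \<beta> = R x\<close>.\<close>
  have only: "a = corner x y" if a: "a \<in> K x" "infnorm (a - g x) \<le> R x" for a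
  proof -
    let ?s = "sgn (p y)" and ?t = "sgn (q y)"
    define \<alpha> \<beta> where "\<alpha> = - ?s * (fst a - fst (g x))" and "\<beta> = - ?t * (snd a - snd (g x))"
    have "\<bar>?s\<bar> = 1" "\<bar>?t\<bar> = 1" using pq by (simp_all add: sgn_if)
    then have "\<bar>\<alpha>\<bar> \<le> R x" "\<bar>\<beta>\<bar> \<le> R x"
      using a(2) unfolding infnorm_pair \<alpha>_def \<beta>_def by (auto simp: abs_mult)
    moreover have "\<bar>p y\<bar> * \<alpha> + \<bar>q y\<bar> * \<beta> \<ge> R x"
    proof -
      have "\<bar>p y\<bar> * \<alpha> = - (p y * (fst a - fst (g x)))" "\<bar>q y\<bar> * \<beta> = - (q y * (snd a - snd (g x)))"
        unfolding \<alpha>_def \<beta>_def by (auto simp: sgn_if)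
      then show ?thesis using K_excess[OF a(1) y] e by linarith
    qed
    moreover have "\<bar>p y\<bar> * R x + \<bar>q y\<bar> * R x = R x"
      using norm1[OF y(1)] by (simp flip: distrib_right)
    ultimately have "\<bar>p y\<bar> * (R x - \<alpha>) + \<bar>q y\<bar> * (R x - \<beta>) \<le> 0" "0 \<le> R x - \<alpha>" "0 \<le> R x - \<beta>"
      by (auto simp: algebra_simps)
    moreover from this have "0 \<le> \<bar>p y\<bar> * (R x - \<alpha>)" "0 \<le> \<bar>q y\<bar> * (R x - \<beta>)" by simp_all
    ultimately have "\<bar>p y\<bar> * (R x - \<alpha>) = 0" "\<bar>q y\<bar> * (R x - \<beta>) = 0" by linarith+
    then have "\<alpha> = R x" "\<beta> = R x" using pq by auto
    then show ?thesis
      unfolding corner_def \<alpha>_def \<beta>_def using pq by (auto simp: sgn_if prod_eq_iff split: if_splits)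
  qed
  have nc: "infnorm (corner x y - g x) = R x"
    unfolding corner_def infnorm_pair using pq pos by (auto simp: sgn_if)
  have far: "R x \<le> infnorm (a - g x)" if "a \<in> K x" for a
    using only[OF that] nc by (cases "infnorm (a - g x) \<le> R x") auto
  have "uniform_setdist (g x) (K x) = R x"
    unfolding uniform_setdist_def
  proof (rule cInf_eq_minimum)
    show "R x \<in> (\<lambda>s. infnorm (g x - s)) ` K x"
      using c nc by (auto simp: image_iff infnorm_sub intro!: bexI[of _ "corner x y"])
    show "R x \<le> r" if "r \<in> (\<lambda>s. infnorm (g x - s)) ` K x" for r
      using that far by (auto simp: infnorm_sub[of "g x"])
  qed
  then have "Pr (g x) (K x) = {a \<in> K x. infnorm (a - g x) \<le> R x}"
    unfolding Pr_def square_def by auto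
  also have "\<dots> = {corner x y}"
    using c nc by (auto intro: only)
  finally show "p y \<noteq> 0 \<and> q y \<noteq> 0 \<and> corner x y \<in> K x \<and> Pr (g x) (K x) = {corner x y}"
    using pq c by blast
qed

lemma f_cases:
  assumes "x \<in> M" "feasible x"
  obtains "R x = 0" "f x = g x" "f x \<in> K x"
    | y where "y \<in> M" "act x y" "excess x y = R x" "R x > 0" "p y \<noteq> 0" "q y \<noteq> 0"
      "f x = corner x y" "f x \<in> K x"
proof (cases "R x = 0")
  case True
  then have "g x \<in> K x"
    using Pr_K(1)[OF assms True] unfolding Pr_def by blast
  then show ?thesis using that(1) True Pr_K(1)[OF assms True] unfolding f_def by simp
next
  case False
  then obtain y where "y \<in> M" "act x y" "excess x y = R x" using R_attained by blast
  moreover have "R x > 0" using False R_nonneg[of x] by simp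
  moreover note Pr_K(2)[OF assms calculation]
  ultimately show ?thesis using that(2)[of y] unfolding f_def by simp
qed

lemma f_in_K: "x \<in> M \<Longrightarrow> feasible x \<Longrightarrow> f x \<in> K x"
  by (erule (1) f_cases)

section \<open>Lipschitz continuity of the selection\<close>

lemma excess_shift:
  assumes "x \<in> M" "y \<in> M" "z \<in> M" "act x y" "act x z"
  shows "excess x z \<le> excess y z + 2 * w x y"
proof -
  \<comment> \<open>One \<open>w x y\<close> is spent here on the movement of the centre, measured
    with coefficients of l1 norm 1; the second is spent below on the right-hand side of the
    constraint \<open>z\<close>.\<close>
  have "\<bar>p z * (fst (g x) - fst (g y))\<bar> \<le> \<bar>p z\<bar> * w x y" "\<bar>q z * (snd (g x) - snd (g y))\<bar> \<le> \<bar>q z\<bar> * w x y"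
    unfolding abs_mult using g_lipschitz[OF assms(1,2,4)] by (auto intro: mult_left_mono)
  moreover have "\<bar>p z\<bar> * w x y + \<bar>q z\<bar> * w x y = w x y"
    using norm1[OF assms(3)] by (simp flip: distrib_right)
  moreover have "w y z \<le> w x y + w x z"
    using w_triangle[OF assms(2,3,1) act_sym[OF assms(1,2,4)] assms(5)] w_sym[OF assms(1,2)] by linarith
  ultimately show ?thesis unfolding excess_def right_diff_distrib by linarith
qed

lemma R_shift:
  assumes "x \<in> M" "y \<in> M" "act x y"
  shows "R x \<le> R y + 2 * w x y"
  using R_attained[of x]
proof
  assume "\<exists>z\<in>M. act x z \<and> excess x z = R x"
  then obtain z where z: "z \<in> M" "act x z" "excess x z = R x" by blast
  then have "act y z" using act_trans[OF assms(2) z(1) assms(1) act_sym[OF assms]] by blast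
  then show ?thesis
    using excess_shift[OF assms(1,2) z(1) assms(3) z(2)] z(3) excess_le_R[OF z(1), of y] by linarith
qed (use R_nonneg[of y] w_nonneg[of x y] in linarith)

lemma opposite_radii:
  assumes x: "x \<in> M" "feasible x" and y: "y \<in> M" "feasible y" and xy: "act x y"
    and i: "i \<in> M" "act x i" "excess x i = R x" "R x > 0" "p i \<noteq> 0" "q i \<noteq> 0" "corner x i \<in> K x"
    and j: "j \<in> M" "act y j" "excess y j = R y" "R y > 0" "p j \<noteq> 0" "q j \<noteq> 0"
    and opp: "p i * p j < 0 \<or> q i * q j < 0"
  shows "R x + R y \<le> 2 * w x y"
proof -
  have yx: "act y x" using act_sym[OF x(1) y(1) xy] .
  have xj: "act x j" using act_trans[OF x(1) j(1) y(1) xy j(2)] .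
  have yi: "act y i" using act_trans[OF y(1) i(1) x(1) yx i(2)] .
  have ej: "R y - 2 * w x y \<le> excess x j"
    using excess_shift[OF y(1) x(1) j(1) yx j(2)] j(3) w_sym[OF x(1) y(1)] by linarith
  have ei: "R x - 2 * w x y \<le> excess y i"
    using excess_shift[OF x(1) y(1) i(1) xy i(2)] i(3) by linarith
  have hx: "g x \<in> boxhull (K x)" using T1_subset_boxhull[OF x(1)] g_in_T1[OF x(2)] by blast
  have hy: "g y \<in> boxhull (K y)" using T1_subset_boxhull[OF y(1)] g_in_T1[OF y(2)] by blast
  consider "p i * p j < 0" "q i * q j < 0" | "p i * p j > 0" "q i * q j < 0" | "p i * p j < 0" "q i * q j > 0"
    using opp i(5,6) j(5,6) by (metis linorder_neqE_linordered_idom mult_eq_0_iff)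
  then show ?thesis
  proof cases
    case 1
    \<comment> \<open>With both signs opposite, the step from \<open>g x\<close> to its corner
      increases the left-hand side of constraint \<open>j\<close> by exactly \<open>R x\<close>. The
      corner lies in \<open>K x\<close>, so \<open>excess x j + R x \<le> 0\<close>.\<close>
    have "p j * - sgn (p i) = \<bar>p j\<bar>" "q j * - sgn (q i) = \<bar>q j\<bar>"
      using 1 by (auto simp: sgn_if mult_less_0_iff)
    then have "p j * - sgn (p i) * R x + q j * - sgn (q i) * R x = R x"
      using norm1[OF j(1)] by (simp flip: distrib_right)
    then show ?thesis
      using K_excess[OF i(7) j(1) xj] ej unfolding corner_def by (simp add: algebra_simps)
  next
    case 2
    \<comment> \<open>The first coordinates agree in sign, so \<open>u\<close> and \<open>v\<close>
      are taken on the side where the first coordinate helps neither constraint. One point from each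
      polygon gives the two weighted inequalities, one for either order of the weights.\<close>
    obtain u where u: "u \<in> K x" "0 \<le> p i * (fst u - fst (g x))" using boxhull_signed(1)[OF hx] by blast
    obtain v where v: "v \<in> K y" "0 \<le> p j * (fst v - fst (g y))" using boxhull_signed(1)[OF hy] by blast
    have "\<bar>q j\<bar> * R x + \<bar>q i\<bar> * (R y - 2 * w x y) \<le> 0"
      using opposite_push[OF 2 u(2), of "R x" "snd u - snd (g x)" "R y - 2 * w x y"]
        K_excess[OF u(1) i(1,2)] K_excess[OF u(1) j(1) xj] i(3) ej by linarith
    moreover have "\<bar>q i\<bar> * R y + \<bar>q j\<bar> * (R x - 2 * w x y) \<le> 0"
      using opposite_push[of "p j" "p i" "q j" "q i" _ "R y" "snd v - snd (g y)" "R x - 2 * w x y", OF _ _ v(2)]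
        K_excess[OF v(1) j(1,2)] K_excess[OF v(1) i(1) yi] j(3) ei 2 by (simp add: mult.commute)
    ultimately show ?thesis
      using sum_le_of_weighted[of "\<bar>q i\<bar>" "\<bar>q j\<bar>" "R x" "R y"] i j by simp
  next
    case 3
    obtain u where u: "u \<in> K x" "0 \<le> q i * (snd u - snd (g x))" using boxhull_signed(2)[OF hx] by blast
    obtain v where v: "v \<in> K y" "0 \<le> q j * (snd v - snd (g y))" using boxhull_signed(2)[OF hy] by blast
    have "\<bar>p j\<bar> * R x + \<bar>p i\<bar> * (R y - 2 * w x y) \<le> 0"
      using opposite_push[OF 3(2,1) u(2), of "R x" "fst u - fst (g x)" "R y - 2 * w x y"]
        K_excess[OF u(1) i(1,2)] K_excess[OF u(1) j(1) xj] i(3) ej by linarith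
    moreover have "\<bar>p i\<bar> * R y + \<bar>p j\<bar> * (R x - 2 * w x y) \<le> 0"
      using opposite_push[of "q j" "q i" "p j" "p i" _ "R y" "fst v - fst (g y)" "R x - 2 * w x y", OF _ _ v(2)]
        K_excess[OF v(1) j(1,2)] K_excess[OF v(1) i(1) yi] j(3) ei 3 by (simp add: mult.commute)
    ultimately show ?thesis
      using sum_le_of_weighted[of "\<bar>p i\<bar>" "\<bar>p j\<bar>" "R x" "R y"] i j by simp
  qed
qed

text \<open>In a coordinate with equal signs the claim is that the radii are close; with opposite
  signs it is a bound on their sum, and there \<open>opposite_radii\<close> applies because one
  opposite coordinate is enough.\<close>

lemma signed_radii_close:
  assumes x: "x \<in> M" "feasible x" and y: "y \<in> M" "feasible y" and xy: "act x y"
    and i: "i \<in> M" "act x i" "excess x i = R x" "R x > 0" "p i \<noteq> 0" "q i \<noteq> 0" "corner x i \<in> K x"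
    and j: "j \<in> M" "act y j" "excess y j = R y" "R y > 0" "p j \<noteq> 0" "q j \<noteq> 0"
  shows "\<bar>R x * sgn (p i) - R y * sgn (p j)\<bar> \<le> 2 * w x y" "\<bar>R x * sgn (q i) - R y * sgn (q j)\<bar> \<le> 2 * w x y"
proof -
  have close: "\<bar>R x - R y\<bar> \<le> 2 * w x y"
    using R_shift[OF x(1) y(1) xy] R_shift[OF y(1) x(1) act_sym[OF x(1) y(1) xy]] w_sym[OF x(1) y(1)]
    by linarith
  note opp = opposite_radii[OF x y xy i j]
  show "\<bar>R x * sgn (p i) - R y * sgn (p j)\<bar> \<le> 2 * w x y"
    using opp close i(4,5) j(4,5) by (cases "p i" "0::real" rule: linorder_cases;
        cases "p j" "0::real" rule: linorder_cases) (auto simp: mult_less_0_iff)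
  show "\<bar>R x * sgn (q i) - R y * sgn (q j)\<bar> \<le> 2 * w x y"
    using opp close i(4,6) j(4,6) by (cases "q i" "0::real" rule: linorder_cases;
        cases "q j" "0::real" rule: linorder_cases) (auto simp: mult_less_0_iff)
qed

text \<open>In each coordinate the centres differ by at most \<open>w x y\<close> and the
  displacements from them by at most \<open>2 * w x y\<close>. A centre already in its polygon
  counts as displaced by 0, and then \<open>R_shift\<close> alone bounds the other
  displacement.\<close>

lemma f_lipschitz:
  assumes x: "x \<in> M" "feasible x" and y: "y \<in> M" "feasible y" and xy: "act x y"
  shows "infnorm (f x - f y) \<le> 3 * w x y"
proof -
  have lip: "\<bar>fst (g x) - fst (g y)\<bar> \<le> w x y" "\<bar>snd (g x) - snd (g y)\<bar> \<le> w x y"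
    using g_lipschitz[OF x(1) y(1) xy] .
  have Rx: "R x \<le> R y + 2 * w x y" using R_shift[OF x(1) y(1) xy] .
  have Ry: "R y \<le> R x + 2 * w x y"
    using R_shift[OF y(1) x(1) act_sym[OF x(1) y(1) xy]] w_sym[OF x(1) y(1)] by simp
  have "\<exists>s t s' t'. f x = (fst (g x) - s, snd (g x) - t) \<and> f y = (fst (g y) - s', snd (g y) - t')
    \<and> \<bar>s - s'\<bar> \<le> 2 * w x y \<and> \<bar>t - t'\<bar> \<le> 2 * w x y"
  proof (rule f_cases[OF x]; rule f_cases[OF y])
    assume "R x = 0" "f x = g x" "R y = 0" "f y = g y"
    then show ?thesis using w_nonneg[of x y] by (intro exI[of _ 0]) auto
  next
    fix j assume "R x = 0" "f x = g x" "0 < R y" "p j \<noteq> 0" "q j \<noteq> 0" "f y = corner y j"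
    then show ?thesis using Ry
      by (intro exI[of _ 0] exI[of _ "R y * sgn (p j)"] exI[of _ "R y * sgn (q j)"])
        (auto simp: corner_def sgn_if abs_mult)
  next
    fix i assume "R y = 0" "f y = g y" "0 < R x" "p i \<noteq> 0" "q i \<noteq> 0" "f x = corner x i"
    then show ?thesis using Rx
      by (intro exI[of _ "R x * sgn (p i)"] exI[of _ "R x * sgn (q i)"] exI[of _ 0])
        (auto simp: corner_def sgn_if abs_mult)
  next
    fix i j assume *: "i \<in> M" "act x i" "excess x i = R x" "0 < R x" "p i \<noteq> 0" "q i \<noteq> 0"
      "f x = corner x i" "f x \<in> K x"
      "j \<in> M" "act y j" "excess y j = R y" "0 < R y" "p j \<noteq> 0" "q j \<noteq> 0" "f y = corner y j"
    then show ?thesis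
      using signed_radii_close[OF x y xy, of i j] unfolding corner_def by fastforce
  qed
  then obtain s t s' t' where st: "f x = (fst (g x) - s, snd (g x) - t)"
    "f y = (fst (g y) - s', snd (g y) - t')" "\<bar>s - s'\<bar> \<le> 2 * w x y" "\<bar>t - t'\<bar> \<le> 2 * w x y" by blast
  then have "\<bar>fst (f x - f y)\<bar> \<le> 3 * w x y" "\<bar>snd (f x - f y)\<bar> \<le> 3 * w x y"
    using lip unfolding st fst_diff snd_diff fst_conv snd_conv by linarith+
  then show ?thesis unfolding infnorm_pair by simp
qed

end

end

section \<open>Correctness of the algorithm\<close>

lemma half_plane_normalised:
  assumes "h \<noteq> 0"
  defines "n \<equiv> \<bar>fst h\<bar> + \<bar>snd h\<bar>"
  shows "\<bar>fst h / n\<bar> + \<bar>snd h / n\<bar> = 1"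
    and "half_plane h \<alpha> = {u. fst h / n * fst u + snd h / n * snd u + \<alpha> / n \<le> 0}"
proof -
  have n: "n > 0"
    using assms by (auto simp: n_def prod_eq_iff)
  then show "\<bar>fst h / n\<bar> + \<bar>snd h / n\<bar> = 1"
    unfolding abs_divide by (simp flip: add_divide_distrib) (simp add: n_def)
  have "fst h / n * fst u + snd h / n * snd u + \<alpha> / n = (h \<bullet> u + \<alpha>) / n" for u
    by (simp add: inner_prod_def add_divide_distrib)
  then show "half_plane h \<alpha> = {u. fst h / n * fst u + snd h / n * snd u + \<alpha> / n \<le> 0}"
    unfolding half_plane_def using n by (simp add: divide_le_0_iff)
qed

lemma mem_scaled_unit_square:
  assumes "t \<noteq> top"
  shows "v \<in> scaled_unit_square t \<longleftrightarrow> infnorm v \<le> enn2real t"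
proof
  assume "v \<in> scaled_unit_square t"
  then obtain u where "v = enn2real t *\<^sub>R u" "infnorm u \<le> 1"
    using assms unfolding scaled_unit_square_def square_def by auto
  then show "infnorm v \<le> enn2real t"
    by (simp add: infnorm_mul mult_left_le)
next
  assume v: "infnorm v \<le> enn2real t"
  show "v \<in> scaled_unit_square t"
  proof (cases "enn2real t = 0")
    case True
    then have "v = enn2real t *\<^sub>R 0" "infnorm (0 :: real \<times> real) \<le> 1"
      using v infnorm_pos_le[of v] by (auto simp: infnorm_eq_0 infnorm_0)
    then show ?thesis using assms unfolding scaled_unit_square_def square_def by auto
  next
    case False
    then have t: "enn2real t > 0" by (simp add: order_less_le)
    then have "v = enn2real t *\<^sub>R (inverse (enn2real t) *\<^sub>R v)"
      "infnorm (inverse (enn2real t) *\<^sub>R v) \<le> 1"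
      using v by (auto simp: infnorm_mul field_simps)
    then show ?thesis
      using assms unfolding scaled_unit_square_def square_def by (auto intro!: image_eqI)
  qed
qed

lemma scaled_unit_square_infty:
  assumes "A \<noteq> {}"
  shows "A + scaled_unit_square top = UNIV"
proof -
  obtain a where a: "a \<in> A" using assms by blast
  have "u \<in> A + UNIV" for u
    using set_plus_intro[OF a UNIV_I, of "u - a"] by simp
  then show ?thesis unfolding scaled_unit_square_def by auto
qed

text \<open>The vector \<open>r *\<^sub>R (sgn p, sgn q)\<close> has uniform norm at most
  \<open>\<bar>r\<bar>\<close> and changes the left-hand side by exactly \<open>r\<close>, because
  the coefficients have l1 norm 1; no other vector of that norm can change it by more.\<close>

lemma half_plane_inflate:
  fixes p q b :: real
  assumes "\<bar>p\<bar> + \<bar>q\<bar> = 1"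
  shows "{u. p * fst u + q * snd u + b \<le> 0} + scaled_unit_square t =
    (if t = top then UNIV else {u. p * fst u + q * snd u + b \<le> enn2real t})"
proof -
  define ex where "ex u = p * fst u + q * snd u + b" for u
  have sg: "p * sgn p + q * sgn q = 1"
    using assms[unfolded abs_sgn] .
  have shift: "ex (u - r *\<^sub>R (sgn p, sgn q)) = ex u - r" for u r
  proof -
    have "ex (u - r *\<^sub>R (sgn p, sgn q)) = ex u - r * (p * sgn p + q * sgn q)"
      unfolding ex_def by (simp add: algebra_simps)
    then show ?thesis unfolding sg by simp
  qed
  have nrm: "infnorm (r *\<^sub>R (sgn p, sgn q)) \<le> \<bar>r\<bar>" for r
    unfolding infnorm_pair by (auto simp: abs_mult abs_sgn_eq)
  have ne: "{u. ex u \<le> 0} \<noteq> {}"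
  proof -
    have "0 - ex 0 *\<^sub>R (sgn p, sgn q) \<in> {u. ex u \<le> 0}" using shift[of 0 "ex 0"] by simp
    then show ?thesis by blast
  qed
  show ?thesis
  proof (cases "t = top")
    case True
    then show ?thesis using scaled_unit_square_infty[OF ne] unfolding ex_def by simp
  next
    case False
    have "u \<in> {u. ex u \<le> 0} + scaled_unit_square t \<longleftrightarrow> ex u \<le> enn2real t" for u
    proof
      assume "u \<in> {u. ex u \<le> 0} + scaled_unit_square t"
      then obtain v s where vs: "u = v + s" "ex v \<le> 0" "infnorm s \<le> enn2real t"
        using mem_scaled_unit_square[OF False] by (auto simp: set_plus_def)
      have "p * fst s \<le> \<bar>p\<bar> * infnorm s" "q * snd s \<le> \<bar>q\<bar> * infnorm s"
        using abs_ge_self[of "p * fst s"] abs_ge_self[of "q * snd s"]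
          mult_left_mono[of "\<bar>fst s\<bar>" "infnorm s" "\<bar>p\<bar>"] mult_left_mono[of "\<bar>snd s\<bar>" "infnorm s" "\<bar>q\<bar>"]
        unfolding abs_mult infnorm_pair by simp_all
      moreover have "\<bar>p\<bar> * infnorm s + \<bar>q\<bar> * infnorm s = infnorm s"
        using assms by (simp flip: distrib_right)
      moreover have "ex u = ex v + p * fst s + q * snd s"
        unfolding ex_def vs by (simp add: algebra_simps)
      ultimately show "ex u \<le> enn2real t" using vs by linarith
    next
      assume u: "ex u \<le> enn2real t"
      let ?r = "max 0 (ex u)"
      have "ex (u - ?r *\<^sub>R (sgn p, sgn q)) \<le> 0" unfolding shift by simp
      moreover have "?r *\<^sub>R (sgn p, sgn q) \<in> scaled_unit_square t"
        unfolding mem_scaled_unit_square[OF False]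
        using nrm[of ?r] u enn2real_nonneg[of t] by linarith
      ultimately show "u \<in> {u. ex u \<le> 0} + scaled_unit_square t"
        using set_plus_intro[of "u - ?r *\<^sub>R (sgn p, sgn q)" "{u. ex u \<le> 0}" "?r *\<^sub>R (sgn p, sgn q)"]
        by (simp only: mem_Collect_eq diff_add_cancel)
    qed
    then show ?thesis using False unfolding ex_def by auto
  qed
qed

lemma boxhull_inflate:
  assumes "K \<noteq> {}"
  shows "boxhull K + scaled_unit_square t =
    (if t = top then UNIV else {a. \<forall>d<4. \<exists>u\<in>K. dir d u \<le> dir d a + enn2real t})"
proof (cases "t = top")
  case True
  then show ?thesis using scaled_unit_square_infty polygon_subset_boxhull[of K] assms by auto
next
  case False
  let ?t = "enn2real t"
  \<comment> \<open>The coordinates can be treated separately. The value \<open>\<phi> u\<close>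
    serves if it is at least \<open>a - ?t\<close>; otherwise \<open>a - ?t\<close> itself lies
    between two values that \<open>\<phi>\<close> takes on \<open>K\<close>.\<close>
  have one: "\<exists>v. (\<exists>u\<in>K. \<phi> u \<le> v) \<and> (\<exists>u\<in>K. - \<phi> u \<le> - v) \<and> \<bar>a - v\<bar> \<le> ?t"
    if ex: "\<exists>u\<in>K. \<phi> u \<le> a + ?t" "\<exists>u\<in>K. - \<phi> u \<le> - a + ?t" for \<phi> :: "real \<times> real \<Rightarrow> real" and a
  proof -
    obtain u where u: "u \<in> K" "\<phi> u \<le> a + ?t" using ex(1) by (rule bexE)
    obtain u' where u': "u' \<in> K" "- \<phi> u' \<le> - a + ?t" using ex(2) by (rule bexE)
    show ?thesis
    proof (cases "a - ?t \<le> \<phi> u")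
      case True
      then show ?thesis using u by (intro exI[of _ "\<phi> u"]) (auto intro: bexI[of _ u])
    next
      case False
      have "\<exists>u\<in>K. \<phi> u \<le> a - ?t" using False u by (intro bexI[of _ u]) auto
      moreover have "\<exists>u\<in>K. - \<phi> u \<le> - (a - ?t)" using u' by (intro bexI[of _ u']) auto
      ultimately show ?thesis by (intro exI[of _ "a - ?t"]) simp
    qed
  qed
  have "a \<in> boxhull K + scaled_unit_square t \<longleftrightarrow> (\<forall>d<4. \<exists>u\<in>K. dir d u \<le> dir d a + ?t)" for a
  proof
    assume "a \<in> boxhull K + scaled_unit_square t"
    then obtain v s where vs: "a = v + s" "v \<in> boxhull K" "infnorm s \<le> ?t"
      using mem_scaled_unit_square[OF False] by (auto simp: set_plus_def)
    have "dir d v \<le> dir d a + ?t" for d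
      using vs(3) unfolding infnorm_pair vs(1) dir_def by auto
    then show "\<forall>d<4. \<exists>u\<in>K. dir d u \<le> dir d a + ?t"
      using vs(2) order_trans unfolding boxhull_def by blast
  next
    assume "\<forall>d<4. \<exists>u\<in>K. dir d u \<le> dir d a + ?t"
    then have *: "\<exists>u\<in>K. fst u \<le> fst a + ?t" "\<exists>u\<in>K. - fst u \<le> - fst a + ?t"
      "\<exists>u\<in>K. snd u \<le> snd a + ?t" "\<exists>u\<in>K. - snd u \<le> - snd a + ?t"
      unfolding all_less_4 dir_simps by blast+
    obtain v1 where v1: "\<exists>u\<in>K. fst u \<le> v1" "\<exists>u\<in>K. - fst u \<le> - v1" "\<bar>fst a - v1\<bar> \<le> ?t"
      using one[OF *(1,2)] by blast
    obtain v2 where v2: "\<exists>u\<in>K. snd u \<le> v2" "\<exists>u\<in>K. - snd u \<le> - v2" "\<bar>snd a - v2\<bar> \<le> ?t"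
      using one[OF *(3,4)] by blast
    have "(v1, v2) \<in> boxhull K"
      unfolding boxhull_def all_less_4 using v1 v2 by simp
    moreover have "a - (v1, v2) \<in> scaled_unit_square t"
      unfolding mem_scaled_unit_square[OF False] infnorm_pair using v1 v2 by simp
    moreover have "a = (v1, v2) + (a - (v1, v2))" by simp
    ultimately show "a \<in> boxhull K + scaled_unit_square t" by (metis set_plus_intro)
  qed
  then show ?thesis using False by auto
qed

section \<open>The algorithm on a finite pseudometric space\<close>

locale halfplane_space =
  fixes l :: real and M :: "'a set" and \<rho> :: "'a \<Rightarrow> 'a \<Rightarrow> ennreal"
    and F :: "'a \<Rightarrow> (real \<times> real) set" and p q b :: "'a \<Rightarrow> real"
  assumes l_pos: "l > 0" and fin: "finite M" and metric: "pseudometric_on M \<rho>"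
    and nrm: "y \<in> M \<Longrightarrow> \<bar>p y\<bar> + \<bar>q y\<bar> = 1"
    and F_eq: "y \<in> M \<Longrightarrow> F y = {u. p y * fst u + q y * snd u + b y \<le> 0}"
begin

lemma scaled_dist_infty: "ennreal l * \<rho> x y = top \<longleftrightarrow> \<rho> x y = top"
  using l_pos by (simp add: ennreal_mult_eq_top_iff)

lemma scaled_dist_real: "enn2real (ennreal l * \<rho> x y) = l * enn2real (\<rho> x y)"
  using l_pos by (simp add: enn2real_mult)

sublocale halfplanes M "\<lambda>x y. l * enn2real (\<rho> x y)" "\<lambda>x y. \<rho> x y \<noteq> top" p q b
proof unfold_locales
  have sym: "\<rho> x y = \<rho> y x" if "x \<in> M" "y \<in> M" for x y
    using metric that unfolding pseudometric_on_def by blast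
  have tri: "\<rho> x y \<le> \<rho> x z + \<rho> z y" if "x \<in> M" "y \<in> M" "z \<in> M" for x y z
    using metric that unfolding pseudometric_on_def by blast
  have zero: "\<rho> x x = 0" if "x \<in> M" for x
    using metric that unfolding pseudometric_on_def by blast
  show "finite M" by (rule fin)
  show "\<bar>p y\<bar> + \<bar>q y\<bar> = 1" if "y \<in> M" for y using nrm[OF that] .
  show "0 \<le> l * enn2real (\<rho> x y)" for x y using l_pos by simp
  show "\<rho> x x \<noteq> top" "l * enn2real (\<rho> x x) = 0" if "x \<in> M" for x using zero[OF that] by simp_all
  show "\<rho> y x \<noteq> top" if "x \<in> M" "y \<in> M" "\<rho> x y \<noteq> top" for x y using sym that by simp
  show "l * enn2real (\<rho> x y) = l * enn2real (\<rho> y x)" if "x \<in> M" "y \<in> M" for x y using sym[OF that] by simp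
  fix x y z assume *: "x \<in> M" "y \<in> M" "z \<in> M" "\<rho> x z \<noteq> top" "\<rho> z y \<noteq> top"
  then have sum: "\<rho> x z + \<rho> z y < top" by (simp add: less_top)
  then show "\<rho> x y \<noteq> top" using tri[OF *(1,2,3)] by (metis leD infinity_ennreal_def)
  have "enn2real (\<rho> x y) \<le> enn2real (\<rho> x z + \<rho> z y)"
    using tri[OF *(1,2,3)] sum by (intro enn2real_mono) auto
  also have "\<dots> = enn2real (\<rho> x z) + enn2real (\<rho> z y)"
    using * by (intro enn2real_plus) (auto simp: less_top)
  finally show "l * enn2real (\<rho> x y) \<le> l * enn2real (\<rho> x z) + l * enn2real (\<rho> z y)"
    using l_pos by (simp flip: distrib_left)
qed

lemma refine_F: "refine l M \<rho> F x = K x"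
proof -
  have "F y + scaled_unit_square (ennreal l * \<rho> x y) =
    (if \<rho> x y = top then UNIV else {u. p y * fst u + q y * snd u + b y \<le> l * enn2real (\<rho> x y)})"
    if "y \<in> M" for y
    using half_plane_inflate[OF nrm[OF that]] F_eq[OF that] scaled_dist_infty scaled_dist_real by simp
  then have "u \<in> F y + scaled_unit_square (ennreal l * \<rho> x y) \<longleftrightarrow>
    (\<rho> x y \<noteq> top \<longrightarrow> p y * fst u + q y * snd u + b y \<le> l * enn2real (\<rho> x y))" if "y \<in> M" for y u
    using that by simp
  then show ?thesis unfolding refine_def by (intro set_eqI) (simp only: INT_iff mem_K cong: ball_cong)
qed

text \<open>All polygons must be nonempty: the Minkowski sum of an empty hull with any set is empty,
  even at infinite distance, whereas \<open>T1\<close> ignores points at infinite distance.\<close>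

lemma refine_T:
  assumes "\<forall>y\<in>M. K y \<noteq> {}"
  shows "refine l M \<rho> (\<lambda>y. rectangle hull K y) x = T1 x"
proof -
  have "rectangle hull K y + scaled_unit_square (ennreal l * \<rho> x y) =
    (if \<rho> x y = top then UNIV else {a. \<forall>d<4. \<exists>u\<in>K y. dir d u \<le> dir d a + l * enn2real (\<rho> x y)})"
    if "y \<in> M" for y
    using boxhull_inflate[of "K y"] rectangle_hull_polygon[OF finite_active, of y p q]
      that assms scaled_dist_infty scaled_dist_real unfolding K_def by simp
  then have "u \<in> rectangle hull K y + scaled_unit_square (ennreal l * \<rho> x y) \<longleftrightarrow>
    (\<rho> x y \<noteq> top \<longrightarrow> (\<forall>d<4. \<exists>v\<in>K y. dir d v \<le> dir d u + l * enn2real (\<rho> x y)))" if "y \<in> M" for y u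
    using that by simp
  then show ?thesis unfolding refine_def T1_def
    by (intro set_eqI) (simp only: INT_iff mem_Collect_eq cong: ball_cong)
qed

lemma projection_algorithm_empty:
  "\<exists>x\<in>M. K x = {} \<Longrightarrow> projection_algorithm l M \<rho> F = No_Go"
  unfolding projection_algorithm_def Let_def refine_F by simp

lemma projection_algorithm_infeasible:
  assumes "\<forall>x\<in>M. K x \<noteq> {}" "\<exists>x\<in>M. \<not> feasible x"
  shows "projection_algorithm l M \<rho> F = No_Go"
proof -
  have ne: "K x \<noteq> {}" if "x \<in> M" for x using assms(1) that by blast
  have "\<exists>x\<in>M. T1 x = {}" using assms(2) T1_ne_iff[OF ne] by blast
  then show ?thesis
    unfolding projection_algorithm_def Let_def refine_F refine_T[OF assms(1)] by simp
qed

lemma projection_algorithm_success: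
  assumes "\<forall>x\<in>M. K x \<noteq> {}" "\<forall>x\<in>M. feasible x"
  shows "\<exists>f'. projection_algorithm l M \<rho> F = Success f' \<and> (\<forall>x\<in>M. f' x = f x)"
proof -
  have ne: "K x \<noteq> {}" if "x \<in> M" for x using assms(1) that by blast
  have "T1 x \<noteq> {}" if "x \<in> M" for x
    using T1_ne_iff[OF ne] assms(2) that by blast
  then have "projection_algorithm l M \<rho> F = Success (\<lambda>x. the_elem (Pr (center (Pr (0, 0) (T1 x))) (K x)))"
    using assms unfolding projection_algorithm_def Let_def refine_F refine_T[OF assms(1)] by auto
  moreover have "\<forall>x\<in>M. the_elem (Pr (center (Pr (0, 0) (T1 x))) (K x)) = f x"
    using center_Pr_T1[OF ne] assms(2) by (simp add: f_def)
  ultimately show ?thesis by blast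
qed

lemma selection_in_K:
  assumes f': "lip_seminorm M \<rho> f' \<le> ennreal l" "\<forall>y\<in>M. f' y \<in> F y" and x: "x \<in> M"
  shows "f' x \<in> K x"
    and "y \<in> M \<Longrightarrow> \<rho> x y \<noteq> top \<Longrightarrow> infnorm (f' x - f' y) \<le> l * enn2real (\<rho> x y)"
proof -
  show lip: "infnorm (f' x - f' y) \<le> l * enn2real (\<rho> x y)" if y: "y \<in> M" "\<rho> x y \<noteq> top" for y
  proof (rule field_le_epsilon)
    fix e :: real assume e: "e > 0"
    \<comment> \<open>The seminorm is an infimum, so an admissible constant is only known below
      \<open>l + d\<close>. The choice of \<open>d\<close> keeps the surplus below \<open>e\<close>,
      and the summand 1 takes care of distance 0.\<close>
    define d where "d = e / (enn2real (\<rho> x y) + 1)"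
    have d: "d > 0" using e by (simp add: d_def add_nonneg_pos)
    have "lip_seminorm M \<rho> f' < ennreal (l + d)"
      using d l_pos by (intro le_less_trans[OF f'(1)]) (simp add: ennreal_less_iff)
    then obtain L where L: "0 \<le> L" "ennreal L < ennreal (l + d)"
      "ennreal (infnorm (f' x - f' y)) \<le> ennreal L * \<rho> x y"
      unfolding lip_seminorm_def Inf_less_iff using x y by auto
    have "\<rho> x y = ennreal (enn2real (\<rho> x y))" using y by (simp add: less_top)
    then have "ennreal (infnorm (f' x - f' y)) \<le> ennreal (L * enn2real (\<rho> x y))"
      using L(1,3) by (simp add: ennreal_mult)
    then have "infnorm (f' x - f' y) \<le> L * enn2real (\<rho> x y)"
      using L by (simp add: ennreal_le_iff)
    also have "\<dots> \<le> (l + d) * enn2real (\<rho> x y)"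
      using L by (intro mult_right_mono) (auto simp: ennreal_less_iff)
    also have "\<dots> = l * enn2real (\<rho> x y) + e * (enn2real (\<rho> x y) / (enn2real (\<rho> x y) + 1))"
      unfolding d_def by (simp add: algebra_simps)
    also have "\<dots> \<le> l * enn2real (\<rho> x y) + e"
      using e by (intro add_left_mono mult_left_le) (auto simp: divide_le_eq add_nonneg_pos)
    finally show "infnorm (f' x - f' y) \<le> l * enn2real (\<rho> x y) + e" .
  qed
  show "f' x \<in> K x" unfolding refine_F[symmetric] refine_def
  proof (rule INT_I)
    fix y assume y: "y \<in> M"
    have "f' y \<in> F y" using f'(2) y by blast
    show "f' x \<in> F y + scaled_unit_square (ennreal l * \<rho> x y)"
    proof (cases "\<rho> x y = top")
      case True
      then have "ennreal l * \<rho> x y = top" using scaled_dist_infty by blast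
      moreover have "F y \<noteq> {}" using \<open>f' y \<in> F y\<close> by blast
      ultimately show ?thesis by (simp add: scaled_unit_square_infty)
    next
      case False
      then have "f' x - f' y \<in> scaled_unit_square (ennreal l * \<rho> x y)"
        using lip[OF y False] mem_scaled_unit_square scaled_dist_infty scaled_dist_real by simp
      from set_plus_intro[OF \<open>f' y \<in> F y\<close> this] show ?thesis by simp
    qed
  qed
qed

text \<open>For the negative outcome: the values of a selection with constant \<open>l\<close> lie
  in every \<open>K x\<close>, and they witness all sides of the inflated boxes, so they lie in
  every \<open>T1 x\<close> too. An empty set at either stage therefore refutes the
  selection.\<close>

lemma algorithm_correct:
  "case projection_algorithm l M \<rho> F of
     No_Go \<Rightarrow> \<not> (\<exists>f'\<in>Lip M \<rho>. lip_seminorm M \<rho> f' \<le> ennreal l \<and> (\<forall>x\<in>M. f' x \<in> F x))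
   | Success f' \<Rightarrow> lip_seminorm M \<rho> f' \<le> ennreal (3 * l) \<and> (\<forall>x\<in>M. f' x \<in> F x)"
proof (cases "(\<forall>x\<in>M. K x \<noteq> {}) \<and> (\<forall>x\<in>M. feasible x)")
  case True
  then obtain f' where f': "projection_algorithm l M \<rho> F = Success f'" "\<forall>x\<in>M. f' x = f x"
    using projection_algorithm_success by blast
  have ne: "K x \<noteq> {}" if "x \<in> M" for x using True that by blast
  have K: "f' x \<in> K x" if "x \<in> M" for x
    using f_in_K[OF ne that] True f'(2) that by simp
  have "f' x \<in> F x" if "x \<in> M" for x
    using K[OF that] F_eq[OF that] act_refl[OF that] w_refl[OF that] that unfolding mem_K by force
  moreover have "\<rho> x y = top \<or> ennreal (infnorm (f' x - f' y)) \<le> ennreal (3 * l) * \<rho> x y"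
    if "x \<in> M" "y \<in> M" for x y
  proof (cases "\<rho> x y = top")
    case False
    then have "infnorm (f' x - f' y) \<le> 3 * l * enn2real (\<rho> x y)"
      using f_lipschitz[OF ne that(1) _ that(2)] True that f'(2) by simp
    then have "ennreal (infnorm (f' x - f' y)) \<le> ennreal (3 * l) * ennreal (enn2real (\<rho> x y))"
      using l_pos by (simp add: ennreal_leI flip: ennreal_mult)
    then show ?thesis using False by (simp add: less_top)
  qed simp
  then have "lip_seminorm M \<rho> f' \<le> ennreal (3 * l)"
    unfolding lip_seminorm_def using l_pos
    by (intro Inf_lower CollectI exI[of _ "3 * l"]) simp
  ultimately show ?thesis using f' by simp
next
  case False
  then have no: "projection_algorithm l M \<rho> F = No_Go"
    using projection_algorithm_empty projection_algorithm_infeasible by blast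
  have "False" if f': "lip_seminorm M \<rho> f' \<le> ennreal l" "\<forall>x\<in>M. f' x \<in> F x" for f'
  proof -
    note sel = selection_in_K[OF f']
    have ne: "\<And>x. x \<in> M \<Longrightarrow> K x \<noteq> {}" using sel(1) by blast
    have "f' x \<in> T1 x" if x: "x \<in> M" for x
      unfolding T1_def
    proof (intro CollectI ballI impI allI)
      fix y d assume y: "y \<in> M" "\<rho> x y \<noteq> top"
      have "dir d (f' y) \<le> dir d (f' x) + l * enn2real (\<rho> x y)"
        using sel(2)[OF x y] unfolding infnorm_pair dir_def by auto
      then show "\<exists>u\<in>K y. dir d u \<le> dir d (f' x) + l * enn2real (\<rho> x y)"
        using sel(1)[OF y(1)] by blast
    qed
    then show False using False ne T1_ne_iff[OF ne] by blast
  qed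
  then show ?thesis unfolding no outcome.case by blast
qed

end

lemma halfplane_space_normalised:
  assumes "l > 0" "finite M" "pseudometric_on M \<rho>" "\<forall>x\<in>M. h x \<noteq> 0"
  shows "halfplane_space l M \<rho> (\<lambda>x. half_plane (h x) (\<alpha> x))
    (\<lambda>x. fst (h x) / (\<bar>fst (h x)\<bar> + \<bar>snd (h x)\<bar>)) (\<lambda>x. snd (h x) / (\<bar>fst (h x)\<bar> + \<bar>snd (h x)\<bar>))
    (\<lambda>x. \<alpha> x / (\<bar>fst (h x)\<bar> + \<bar>snd (h x)\<bar>))"
  using assms half_plane_normalised by unfold_locales auto

theorem projection_algorithm_correct:
  assumes "l > 0" "finite M" "pseudometric_on M \<rho>" "\<forall>x\<in>M. closed_half_plane (F x)"
  shows "case projection_algorithm l M \<rho> F of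
     No_Go \<Rightarrow> \<not> (\<exists>f\<in>Lip M \<rho>. lip_seminorm M \<rho> f \<le> ennreal l \<and> (\<forall>x\<in>M. f x \<in> F x))
   | Success f \<Rightarrow> lip_seminorm M \<rho> f \<le> ennreal (3 * l) \<and> (\<forall>x\<in>M. f x \<in> F x)"
proof -
  obtain h \<alpha> where h: "\<forall>x\<in>M. h x \<noteq> 0 \<and> F x = half_plane (h x) (\<alpha> x)"
    using assms(4) unfolding closed_half_plane_def by metis
  then have "\<forall>x\<in>M. h x \<noteq> 0" by blast
  from halfplane_space_normalised[OF assms(1-3) this, of \<alpha>] h
  have "halfplane_space l M \<rho> F
    (\<lambda>x. fst (h x) / (\<bar>fst (h x)\<bar> + \<bar>snd (h x)\<bar>)) (\<lambda>x. snd (h x) / (\<bar>fst (h x)\<bar> + \<bar>snd (h x)\<bar>))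
    (\<lambda>x. \<alpha> x / (\<bar>fst (h x)\<bar> + \<bar>snd (h x)\<bar>))"
    unfolding halfplane_space_def by simp
  then show ?thesis by (rule halfplane_space.algorithm_correct)
qed

section \<open>A structured language compiled to the random access machine\<close>

text \<open>
  Cells \<open>1, \<dots>, 6 N\<^sup>2 - 1\<close> (\<open>low\<close>) contain the input and later the output; cell 0 holds \<open>N\<close>
  throughout.  Registers and arrays of length \<open>N\<close> live from address \<open>6 N\<^sup>2\<close> on.
\<close>

record store =
  nv :: "nat \<Rightarrow> nat"
  rv :: "nat \<Rightarrow> real"
  ra :: "nat \<Rightarrow> nat \<Rightarrow> real"
  low :: "nat \<Rightarrow> real"

datatype nexp = NC nat | NN | NV nat | NPlus nexp nexp | NMinus nexp nexp | NMul nexp nexp | NA nat nexp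

datatype rexp = RC int | RV nat | RA nat nexp | RLow nexp
  | RPlus rexp rexp | RMinus rexp rexp | RMul rexp rexp | RDiv rexp rexp

datatype test = RLt rexp rexp | NLt nexp nexp

datatype cmd =
    CSkip
  | CNat nat nexp
  | CReal nat rexp
  | CArr nat nexp rexp
  | CNArr nat nexp nexp
  | CLow nexp rexp
  | CSeq cmd cmd (infixr \<open>;;\<close> 60)
  | CIf test cmd cmd
  | CFor nat nat cmd \<comment> \<open>\<open>CFor v k c\<close>: for \<open>v = 0, \<dots>, k N - 1\<close>\<close>

section \<open>Values and definedness of expressions\<close>

primrec nval :: "nat \<Rightarrow> store \<Rightarrow> nexp \<Rightarrow> nat" where
  "nval N s (NC c) = c"
| "nval N s NN = N"
| "nval N s (NV k) = nv s k"
| "nval N s (NPlus d e) = nval N s d + nval N s e"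
| "nval N s (NMinus d e) = nval N s d - nval N s e"
| "nval N s (NMul d e) = nval N s d * nval N s e"
| "nval N s (NA a e) = nat \<lfloor>ra s a (nval N s e)\<rfloor>"

text \<open>Definedness excludes what the machine cannot follow. Subtraction of naturals must not
  truncate, because the machine subtracts reals; an index read from an array cell must already be a
  natural number, because there is no rounding.\<close>

primrec ndef :: "nat \<Rightarrow> store \<Rightarrow> nexp \<Rightarrow> bool" where
  "ndef N s (NC c) \<longleftrightarrow> True"
| "ndef N s NN \<longleftrightarrow> True"
| "ndef N s (NV k) \<longleftrightarrow> k < 32"
| "ndef N s (NPlus d e) \<longleftrightarrow> ndef N s d \<and> ndef N s e"
| "ndef N s (NMinus d e) \<longleftrightarrow> ndef N s d \<and> ndef N s e \<and> nval N s e \<le> nval N s d"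
| "ndef N s (NMul d e) \<longleftrightarrow> ndef N s d \<and> ndef N s e"
| "ndef N s (NA a e) \<longleftrightarrow> a < 32 \<and> ndef N s e \<and> nval N s e < N \<and> ra s a (nval N s e) \<in> \<nat>"

primrec rval :: "nat \<Rightarrow> store \<Rightarrow> rexp \<Rightarrow> real" where
  "rval N s (RC c) = of_int c"
| "rval N s (RV k) = rv s k"
| "rval N s (RA a e) = ra s a (nval N s e)"
| "rval N s (RLow e) = low s (nval N s e)"
| "rval N s (RPlus d e) = rval N s d + rval N s e"
| "rval N s (RMinus d e) = rval N s d - rval N s e"
| "rval N s (RMul d e) = rval N s d * rval N s e"
| "rval N s (RDiv d e) = rval N s d / rval N s e"

text \<open>Address 0 is not part of \<open>low\<close>: that cell keeps \<open>N\<close>, from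
  which all addresses are computed.\<close>

primrec rdef :: "nat \<Rightarrow> store \<Rightarrow> rexp \<Rightarrow> bool" where
  "rdef N s (RC c) \<longleftrightarrow> True"
| "rdef N s (RV k) \<longleftrightarrow> k < 32"
| "rdef N s (RA a e) \<longleftrightarrow> a < 32 \<and> ndef N s e \<and> nval N s e < N"
| "rdef N s (RLow e) \<longleftrightarrow> ndef N s e \<and> 0 < nval N s e \<and> nval N s e < 6 * N * N"
| "rdef N s (RPlus d e) \<longleftrightarrow> rdef N s d \<and> rdef N s e"
| "rdef N s (RMinus d e) \<longleftrightarrow> rdef N s d \<and> rdef N s e"
| "rdef N s (RMul d e) \<longleftrightarrow> rdef N s d \<and> rdef N s e"
| "rdef N s (RDiv d e) \<longleftrightarrow> rdef N s d \<and> rdef N s e \<and> rval N s e \<noteq> 0"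

primrec tval :: "nat \<Rightarrow> store \<Rightarrow> test \<Rightarrow> bool" where
  "tval N s (RLt d e) \<longleftrightarrow> rval N s d < rval N s e"
| "tval N s (NLt d e) \<longleftrightarrow> nval N s d < nval N s e"

primrec tdef :: "nat \<Rightarrow> store \<Rightarrow> test \<Rightarrow> bool" where
  "tdef N s (RLt d e) \<longleftrightarrow> rdef N s d \<and> rdef N s e"
| "tdef N s (NLt d e) \<longleftrightarrow> ndef N s d \<and> ndef N s e"

text \<open>Every loop has a trip count known in advance, so its precondition unrolls by recursion
  and termination is built in. The body has to leave the counter unchanged. The sweep, by nature a
  while loop, is fitted in by letting surplus rounds do nothing.\<close>

primrec for_wp :: "((store \<Rightarrow> bool) \<Rightarrow> store \<Rightarrow> bool) \<Rightarrow> nat \<Rightarrow> nat \<Rightarrow> (store \<Rightarrow> bool) \<Rightarrow> store \<Rightarrow> bool" where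
  "for_wp W v 0 Q s = Q s"
| "for_wp W v (Suc n) Q s =
     W (\<lambda>s'. nv s' v = nv s v \<and> for_wp W v n Q (s'\<lparr>nv := (nv s')(v := Suc (nv s v))\<rparr>)) s"

primrec wp :: "nat \<Rightarrow> cmd \<Rightarrow> (store \<Rightarrow> bool) \<Rightarrow> store \<Rightarrow> bool" where
  "wp N CSkip = (\<lambda>Q s. Q s)"
| "wp N (CNat k e) = (\<lambda>Q s. k < 32 \<and> ndef N s e \<and> Q (s\<lparr>nv := (nv s)(k := nval N s e)\<rparr>))"
| "wp N (CReal k e) = (\<lambda>Q s. k < 32 \<and> rdef N s e \<and> Q (s\<lparr>rv := (rv s)(k := rval N s e)\<rparr>))"
| "wp N (CArr a i e) = (\<lambda>Q s. a < 32 \<and> ndef N s i \<and> nval N s i < N \<and> rdef N s e \<and>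
     Q (s\<lparr>ra := (ra s)(a := (ra s a)(nval N s i := rval N s e))\<rparr>))"
| "wp N (CNArr a i e) = (\<lambda>Q s. a < 32 \<and> ndef N s i \<and> nval N s i < N \<and> ndef N s e \<and>
     Q (s\<lparr>ra := (ra s)(a := (ra s a)(nval N s i := real (nval N s e)))\<rparr>))"
| "wp N (CLow i e) = (\<lambda>Q s. ndef N s i \<and> 0 < nval N s i \<and> nval N s i < 6 * N * N \<and> rdef N s e \<and>
     Q (s\<lparr>low := (low s)(nval N s i := rval N s e)\<rparr>))"
| "wp N (CSeq c d) = (\<lambda>Q. wp N c (wp N d Q))"
| "wp N (CIf b c d) = (\<lambda>Q s. tdef N s b \<and> (if tval N s b then wp N c Q s else wp N d Q s))"
| "wp N (CFor v k c) = (\<lambda>Q s. v < 32 \<and> for_wp (wp N c) v (k * N) Q (s\<lparr>nv := (nv s)(v := 0)\<rparr>))"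

section \<open>Frame conditions\<close>

datatype location = LNat nat | LReal nat | LArr nat | LLow

primrec mods :: "cmd \<Rightarrow> location set" where
  "mods CSkip = {}"
| "mods (CNat k e) = {LNat k}"
| "mods (CReal k e) = {LReal k}"
| "mods (CArr a i e) = {LArr a}"
| "mods (CNArr a i e) = {LArr a}"
| "mods (CLow i e) = {LLow}"
| "mods (CSeq c d) = mods c \<union> mods d"
| "mods (CIf b c d) = mods c \<union> mods d"
| "mods (CFor v k c) = insert (LNat v) (mods c)"

definition frame :: "cmd \<Rightarrow> store \<Rightarrow> store \<Rightarrow> bool" where
  "frame c s s' \<longleftrightarrow> (\<forall>k. LNat k \<notin> mods c \<longrightarrow> nv s' k = nv s k) \<and> (\<forall>k. LReal k \<notin> mods c \<longrightarrow> rv s' k = rv s k) \<and>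
     (\<forall>a. LArr a \<notin> mods c \<longrightarrow> ra s' a = ra s a) \<and> (LLow \<notin> mods c \<longrightarrow> low s' = low s)"

lemma frameD:
  assumes "frame c s s'"
  shows "LNat k \<notin> mods c \<Longrightarrow> nv s' k = nv s k" "LReal k \<notin> mods c \<Longrightarrow> rv s' k = rv s k"
    "LArr a \<notin> mods c \<Longrightarrow> ra s' a = ra s a" "LLow \<notin> mods c \<Longrightarrow> low s' = low s"
  using assms unfolding frame_def by blast+

lemma for_wp_mono:
  assumes W: "\<And>Q Q' s. W Q s \<Longrightarrow> (\<And>s'. Q s' \<Longrightarrow> Q' s') \<Longrightarrow> W Q' s"
  shows "for_wp W v n Q s \<Longrightarrow> (\<And>s'. Q s' \<Longrightarrow> Q' s') \<Longrightarrow> for_wp W v n Q' s"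
proof (induction n arbitrary: s)
  case (Suc n)
  show ?case
    using Suc.prems(1) unfolding for_wp.simps
    by (rule W) (use Suc.IH Suc.prems(2) in blast)
qed simp

lemma wp_mono: "wp N c Q s \<Longrightarrow> (\<And>s'. Q s' \<Longrightarrow> Q' s') \<Longrightarrow> wp N c Q' s"
proof (induction c arbitrary: Q Q' s)
  case (CSeq c d)
  show ?case using CSeq.prems(1) unfolding wp.simps
    by (rule CSeq.IH(1)) (use CSeq.IH(2) CSeq.prems(2) in blast)
next
  case (CFor v k c)
  then show ?case using for_wp_mono[of "wp N c", OF CFor.IH] by auto
qed (auto split: if_splits)

lemma for_wp_cons:
  assumes "for_wp (wp N c) v n Q s" "\<And>s'. Q s' \<Longrightarrow> Q' s'"
  shows "for_wp (wp N c) v n Q' s"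
  by (rule for_wp_mono[of "wp N c", OF wp_mono assms])

lemma for_wp_frame:
  assumes W: "\<And>Q s. wp N c Q s \<Longrightarrow> wp N c (\<lambda>s'. Q s' \<and> frame c s s') s"
  shows "for_wp (wp N c) v n Q s \<Longrightarrow> for_wp (wp N c) v n (\<lambda>s'. Q s' \<and> frame (CFor v k c) s s') s"
proof (induction n arbitrary: s)
  case 0
  then show ?case by (simp add: frame_def)
next
  case (Suc n)
  show ?case
    unfolding for_wp.simps
  proof (rule wp_mono[OF W[OF Suc.prems[unfolded for_wp.simps]]])
    fix s' assume "(nv s' v = nv s v \<and> for_wp (wp N c) v n Q (s'\<lparr>nv := (nv s')(v := Suc (nv s v))\<rparr>)) \<and> frame c s s'"
    then have *: "nv s' v = nv s v" "frame c s s'"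
      "for_wp (wp N c) v n Q (s'\<lparr>nv := (nv s')(v := Suc (nv s v))\<rparr>)" by blast+
    from Suc.IH[OF *(3)]
    have "for_wp (wp N c) v n (\<lambda>s'. Q s' \<and> frame (CFor v k c) s s') (s'\<lparr>nv := (nv s')(v := Suc (nv s v))\<rparr>)"
      by (rule for_wp_cons) (use *(2) in \<open>auto simp: frame_def\<close>)
    then show "nv s' v = nv s v \<and>
      for_wp (wp N c) v n (\<lambda>s'. Q s' \<and> frame (CFor v k c) s s') (s'\<lparr>nv := (nv s')(v := Suc (nv s v))\<rparr>)"
      using * by blast
  qed
qed

text \<open>A specification thus needs to mention only what its command establishes; everything else
  is recovered from the syntactic set \<open>mods\<close>.\<close>

lemma wp_frame: "wp N c Q s \<Longrightarrow> wp N c (\<lambda>s'. Q s' \<and> frame c s s') s"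
proof (induction c arbitrary: Q s)
  case (CSeq c d)
  from CSeq.IH(1)[OF CSeq.prems[unfolded wp.simps]]
  show ?case unfolding wp.simps
  proof (rule wp_mono)
    fix s' assume "wp N d Q s' \<and> frame c s s'"
    then have "wp N d (\<lambda>s''. Q s'' \<and> frame d s' s'') s'" "frame c s s'" using CSeq.IH(2) by blast+
    then show "wp N d (\<lambda>s''. Q s'' \<and> frame (c;; d) s s'') s'"
      by (elim wp_mono) (auto simp: frame_def)
  qed
next
  case (CIf b c d)
  show ?case
  proof (cases "tval N s b")
    case True
    then have "wp N c (\<lambda>s'. Q s' \<and> frame c s s') s" using CIf by simp
    then have "wp N c (\<lambda>s'. Q s' \<and> frame (CIf b c d) s s') s"
      by (rule wp_mono) (auto simp: frame_def)
    then show ?thesis using True CIf.prems by simp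
  next
    case False
    then have "wp N d (\<lambda>s'. Q s' \<and> frame d s s') s" using CIf by simp
    then have "wp N d (\<lambda>s'. Q s' \<and> frame (CIf b c d) s s') s"
      by (rule wp_mono) (auto simp: frame_def)
    then show ?thesis using False CIf.prems by simp
  qed
next
  case (CFor v k c)
  let ?s = "s\<lparr>nv := (nv s)(v := 0)\<rparr>"
  have "for_wp (wp N c) v (k * N) (\<lambda>s'. Q s' \<and> frame (CFor v k c) ?s s') ?s"
    using for_wp_frame[of N c, OF CFor.IH] CFor.prems by simp
  then have "for_wp (wp N c) v (k * N) (\<lambda>s'. Q s' \<and> frame (CFor v k c) s s') ?s"
    by (rule for_wp_cons) (auto simp: frame_def)
  then show ?case using CFor.prems by simp
qed (auto simp: frame_def)

lemma wp_cons:
  assumes "wp N c Q s" "\<And>s'. Q s' \<Longrightarrow> frame c s s' \<Longrightarrow> Q' s'"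
  shows "wp N c Q' s"
  using wp_mono[OF wp_frame[OF assms(1)]] assms(2) by blast

text \<open>The step may use the frame relative to the store before the loop, so invariants can
  leave out all unmodified data. The invariant is re-established for the store in which the counter
  has already been increased.\<close>

lemma wp_for:
  assumes v: "v < 32" "LNat v \<notin> mods c"
    and init: "I 0 (s\<lparr>nv := (nv s)(v := 0)\<rparr>)"
    and step: "\<And>i s'. i < k * N \<Longrightarrow> nv s' v = i \<Longrightarrow> frame (CFor v k c) s s' \<Longrightarrow> I i s' \<Longrightarrow>
      wp N c (\<lambda>s''. I (Suc i) (s''\<lparr>nv := (nv s'')(v := Suc i)\<rparr>)) s'"
    and final: "\<And>s'. I (k * N) s' \<Longrightarrow> frame (CFor v k c) s s' \<Longrightarrow> Q s'"
  shows "wp N (CFor v k c) Q s"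
proof -
  have "for_wp (wp N c) v n Q s'"
    if "nv s' v + n = k * N" "frame (CFor v k c) s s'" "I (nv s' v) s'" for n s'
    using that
  proof (induction n arbitrary: s')
    case 0
    then show ?case using final by simp
  next
    case (Suc n)
    from Suc.prems have "wp N c (\<lambda>s''. I (Suc (nv s' v)) (s''\<lparr>nv := (nv s'')(v := Suc (nv s' v))\<rparr>)) s'"
      by (intro step) auto
    then show ?case
      unfolding for_wp.simps
    proof (rule wp_cons)
      fix s'' assume *: "I (Suc (nv s' v)) (s''\<lparr>nv := (nv s'')(v := Suc (nv s' v))\<rparr>)" "frame c s' s''"
      have "frame (CFor v k c) s (s''\<lparr>nv := (nv s'')(v := Suc (nv s' v))\<rparr>)"
        using Suc.prems(2) *(2) unfolding frame_def by auto
      then have "for_wp (wp N c) v n Q (s''\<lparr>nv := (nv s'')(v := Suc (nv s' v))\<rparr>)"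
        using Suc.prems(1) *(1) by (intro Suc.IH) auto
      then show "nv s'' v = nv s' v \<and> for_wp (wp N c) v n Q (s''\<lparr>nv := (nv s'')(v := Suc (nv s' v))\<rparr>)"
        using frameD(1)[OF *(2) v(2)] by blast
    qed
  qed
  then show ?thesis using v init by (simp add: frame_def)
qed

subsection \<open>Compilation\<close>

text \<open>The program text cannot depend on \<open>N\<close>, so addresses are recomputed from
  cell 0 at each access, at constant cost. The factor 6 comes from the input, which occupies 2 + N^2
  + 3 N cells, exactly 6 for \<open>N = 1\<close> and at most 6 N^2 in general.\<close>

definition base :: expr where
  "base = Mul (Const 6) (Mul (Load (Const 0)) (Load (Const 0)))"

abbreviation nreg :: "nat \<Rightarrow> expr" where "nreg k \<equiv> Add base (Const (int k))"
abbreviation rreg :: "nat \<Rightarrow> expr" where "rreg k \<equiv> Add base (Const (32 + int k))"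
abbreviation cell :: "nat \<Rightarrow> expr \<Rightarrow> expr" where
  "cell a e \<equiv> Add (Add base (Add (Const 64) (Mul (Const (int a)) (Load (Const 0))))) e"

primrec ncomp :: "nexp \<Rightarrow> expr" where
  "ncomp (NC c) = Const (int c)"
| "ncomp NN = Load (Const 0)"
| "ncomp (NV k) = Load (nreg k)"
| "ncomp (NPlus d e) = Add (ncomp d) (ncomp e)"
| "ncomp (NMinus d e) = Sub (ncomp d) (ncomp e)"
| "ncomp (NMul d e) = Mul (ncomp d) (ncomp e)"
| "ncomp (NA a e) = Load (cell a (ncomp e))"

primrec rcomp :: "rexp \<Rightarrow> expr" where
  "rcomp (RC c) = Const c"
| "rcomp (RV k) = Load (rreg k)"
| "rcomp (RA a e) = Load (cell a (ncomp e))"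
| "rcomp (RLow e) = Load (ncomp e)"
| "rcomp (RPlus d e) = Add (rcomp d) (rcomp e)"
| "rcomp (RMinus d e) = Sub (rcomp d) (rcomp e)"
| "rcomp (RMul d e) = Mul (rcomp d) (rcomp e)"
| "rcomp (RDiv d e) = Quot (rcomp d) (rcomp e)"

primrec tcomp :: "test \<Rightarrow> cond" where
  "tcomp (RLt d e) = Less (rcomp d) (rcomp e)"
| "tcomp (NLt d e) = Less (ncomp d) (ncomp e)"

primrec compile :: "cmd \<Rightarrow> prog" where
  "compile CSkip = Skip"
| "compile (CNat k e) = Store (nreg k) (ncomp e)"
| "compile (CReal k e) = Store (rreg k) (rcomp e)"
| "compile (CArr a i e) = Store (cell a (ncomp i)) (rcomp e)"
| "compile (CNArr a i e) = Store (cell a (ncomp i)) (ncomp e)"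
| "compile (CLow i e) = Store (ncomp i) (rcomp e)"
| "compile (CSeq c d) = Seq (compile c) (compile d)"
| "compile (CIf b c d) = Branch (tcomp b) (compile c) (compile d)"
| "compile (CFor v k c) = Seq (Store (nreg v) (Const 0))
     (Loop (Less (Load (nreg v)) (Mul (Const (int k)) (Load (Const 0))))
       (Seq (compile c) (Store (nreg v) (Add (Load (nreg v)) (Const 1)))))"

primrec store_ops :: "prog \<Rightarrow> nat" where
  "store_ops Skip = 0"
| "store_ops (Store d e) = expr_ops d + expr_ops e + 1"
| "store_ops (Seq p q) = 0"
| "store_ops (Branch c p q) = 0"
| "store_ops (Loop c p) = 0"

text \<open>The leading coefficient in the time bound \<open>cost c * N ^ nesting c\<close>. Both
  branches of a conditional are added up, and 60 generously covers the initialisation, test and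
  increment of a counter, which take 6, 9 and 13 operations.\<close>

primrec cost :: "cmd \<Rightarrow> nat" where
  "cost CSkip = 0"
| "cost (CNat k e) = store_ops (compile (CNat k e))"
| "cost (CReal k e) = store_ops (compile (CReal k e))"
| "cost (CArr a i e) = store_ops (compile (CArr a i e))"
| "cost (CNArr a i e) = store_ops (compile (CNArr a i e))"
| "cost (CLow i e) = store_ops (compile (CLow i e))"
| "cost (CSeq c d) = cost c + cost d"
| "cost (CIf b c d) = cond_ops (tcomp b) + cost c + cost d"
| "cost (CFor v k c) = 60 + k * (cost c + 60)"

primrec nesting :: "cmd \<Rightarrow> nat" where
  "nesting CSkip = 0"
| "nesting (CNat k e) = 0"
| "nesting (CReal k e) = 0"
| "nesting (CArr a i e) = 0"
| "nesting (CNArr a i e) = 0"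
| "nesting (CLow i e) = 0"
| "nesting (CSeq c d) = max (nesting c) (nesting d)"
| "nesting (CIf b c d) = max (nesting c) (nesting d)"
| "nesting (CFor v k c) = Suc (nesting c)"

section \<open>Memory layout and simulation of commands\<close>

definition naddr :: "nat \<Rightarrow> nat \<Rightarrow> nat" where "naddr N k = 6 * N * N + k"
definition raddr :: "nat \<Rightarrow> nat \<Rightarrow> nat" where "raddr N k = 6 * N * N + 32 + k"
definition aaddr :: "nat \<Rightarrow> nat \<Rightarrow> nat \<Rightarrow> nat" where "aaddr N a i = 6 * N * N + 64 + a * N + i"
definition mem_size :: "nat \<Rightarrow> nat" where "mem_size N = 6 * N * N + 64 + 32 * N"

definition represents :: "nat \<Rightarrow> store \<Rightarrow> memory \<Rightarrow> bool" where
  "represents N s m \<longleftrightarrow> m 0 = real N \<and> (\<forall>a. 0 < a \<and> a < 6 * N * N \<longrightarrow> m a = low s a) \<and>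
     (\<forall>k<32. m (naddr N k) = real (nv s k)) \<and> (\<forall>k<32. m (raddr N k) = rv s k) \<and>
     (\<forall>a<32. \<forall>i<N. m (aaddr N a i) = ra s a i)"

lemma address_of_nat: "n < S \<Longrightarrow> address S (real n) = Some n"
  unfolding address_def by simp

lemma aaddr_inj:
  assumes "i < N" "i' < N"
  shows "aaddr N a i = aaddr N a' i' \<longleftrightarrow> a = a' \<and> i = i'"
proof
  assume "aaddr N a i = aaddr N a' i'"
  then have eq: "i + a * N = i' + a' * N" unfolding aaddr_def by simp
  have "(i + a * N) div N = a" "(i' + a' * N) div N = a'" using assms by auto
  then show "a = a' \<and> i = i'" using eq by simp
qed simp

lemma addr_bounds:
  assumes "N \<ge> 1"
  shows "k < 32 \<Longrightarrow> naddr N k < mem_size N" "k < 32 \<Longrightarrow> raddr N k < mem_size N"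
    "a < 32 \<Longrightarrow> i < N \<Longrightarrow> aaddr N a i < mem_size N" "n < 6 * N * N \<Longrightarrow> n < mem_size N"
proof -
  show "aaddr N a i < mem_size N" if "a < 32" "i < N"
  proof -
    have "a * N + i < (a + 1) * N" using that by simp
    also have "\<dots> \<le> 32 * N" using that by (intro mult_right_mono) auto
    finally show ?thesis unfolding aaddr_def mem_size_def by linarith
  qed
qed (auto simp: naddr_def raddr_def mem_size_def)

context
  fixes N :: nat and s :: store and m :: memory
  assumes N: "N \<ge> 1" and rep: "represents N s m"
begin

lemma base_val: "expr_val (mem_size N) m base = Some (real (6 * N * N))"
  using rep address_of_nat[of 0 "mem_size N"] N unfolding base_def represents_def mem_size_def by simp

lemma N_val: "expr_val (mem_size N) m (Load (Const 0)) = Some (real N)"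
  using rep address_of_nat[of 0 "mem_size N"] N unfolding represents_def mem_size_def by simp

lemma nreg_val:
  "expr_val (mem_size N) m (nreg k) = Some (real (naddr N k))"
  by (simp add: base_val naddr_def)

lemma rreg_val:
  "expr_val (mem_size N) m (rreg k) = Some (real (raddr N k))"
  by (simp add: base_val raddr_def)

lemma cell_val:
  "expr_val (mem_size N) m e = Some (real i) \<Longrightarrow>
    expr_val (mem_size N) m (cell a e) = Some (real (aaddr N a i))"
  using N_val by (auto simp: base_val aaddr_def)

lemma nreg_load: "k < 32 \<Longrightarrow> expr_val (mem_size N) m (Load (nreg k)) = Some (real (nv s k))"
  using nreg_val[of k] address_of_nat[OF addr_bounds(1)[OF N]] rep
  unfolding expr_val.simps(2) represents_def by simp

lemma for_test_val:
  "v < 32 \<Longrightarrow> cond_val (mem_size N) m (Less (Load (nreg v)) (Mul (Const (int k)) (Load (Const 0)))) =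
    Some (nv s v < k * N)"
  using nreg_load N_val by (simp del: expr_val.simps(2) flip: of_nat_mult)

lemma incr_val:
  "v < 32 \<Longrightarrow> expr_val (mem_size N) m (Add (Load (nreg v)) (Const 1)) = Some (real (Suc (nv s v)))"
  using nreg_load by (simp del: expr_val.simps(2))

lemma ncomp_val: "ndef N s e \<Longrightarrow> expr_val (mem_size N) m (ncomp e) = Some (real (nval N s e))"
proof (induction e)
  case NN
  then show ?case using N_val by simp
next
  case (NV k)
  then show ?case using nreg_load by simp
next
  case (NA a e)
  then have "expr_val (mem_size N) m (cell a (ncomp e)) = Some (real (aaddr N a (nval N s e)))"
    by (intro cell_val) simp
  moreover have "m (aaddr N a (nval N s e)) = ra s a (nval N s e)"
    using NA rep unfolding represents_def by simp
  moreover have "real (nat \<lfloor>ra s a (nval N s e)\<rfloor>) = ra s a (nval N s e)"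
    using NA.prems by (auto simp: Nats_def)
  ultimately show ?case
    using address_of_nat[OF addr_bounds(3)[OF N]] NA.prems
    unfolding ncomp.simps expr_val.simps(2) by simp
qed (auto simp: of_nat_diff)

lemma rcomp_val: "rdef N s e \<Longrightarrow> expr_val (mem_size N) m (rcomp e) = Some (rval N s e)"
proof (induction e)
  case (RV k)
  then show ?case
    using rreg_val[of k] address_of_nat[OF addr_bounds(2)[OF N]] rep
    unfolding rcomp.simps expr_val.simps(2) represents_def by simp
next
  case (RA a e)
  then have "expr_val (mem_size N) m (cell a (ncomp e)) = Some (real (aaddr N a (nval N s e)))"
    using ncomp_val by (intro cell_val) simp
  moreover have "m (aaddr N a (nval N s e)) = ra s a (nval N s e)"
    using RA rep unfolding represents_def by simp
  ultimately show ?case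
    using address_of_nat[OF addr_bounds(3)[OF N]] RA.prems
    unfolding rcomp.simps expr_val.simps(2) by simp
next
  case (RLow e)
  then show ?case
    using ncomp_val[of e] address_of_nat[OF addr_bounds(4)[OF N]] rep unfolding represents_def by simp
qed auto

lemma tcomp_val: "tdef N s b \<Longrightarrow> cond_val (mem_size N) m (tcomp b) = Some (tval N s b)"
  using ncomp_val rcomp_val by (cases b) auto

lemma rep_nreg: "k < 32 \<Longrightarrow> represents N (s\<lparr>nv := (nv s)(k := x)\<rparr>) (m(naddr N k := real x))"
  using rep N unfolding represents_def by (auto simp: naddr_def raddr_def aaddr_def)

lemma rep_rreg: "k < 32 \<Longrightarrow> represents N (s\<lparr>rv := (rv s)(k := x)\<rparr>) (m(raddr N k := x))"
  using rep N unfolding represents_def by (auto simp: naddr_def raddr_def aaddr_def)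

lemma rep_cell:
  assumes "a < 32" "i < N"
  shows "represents N (s\<lparr>ra := (ra s)(a := (ra s a)(i := x))\<rparr>) (m(aaddr N a i := x))"
proof -
  have "aaddr N a i \<noteq> 0" "aaddr N a i \<ge> 6 * N * N" "\<forall>k<32. naddr N k \<noteq> aaddr N a i \<and> raddr N k \<noteq> aaddr N a i"
    by (auto simp: naddr_def raddr_def aaddr_def)
  then show ?thesis
    using rep assms unfolding represents_def by (auto simp: aaddr_inj)
qed

lemma rep_low:
  assumes "0 < i" "i < 6 * N * N"
  shows "represents N (s\<lparr>low := (low s)(i := x)\<rparr>) (m(i := x))"
  using rep assms unfolding represents_def by (auto simp: naddr_def raddr_def aaddr_def)

end

lemma for_ops:
  "cond_ops (Less (Load (nreg v)) (Mul (Const (int k)) (Load (Const 0)))) = 9"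
  "expr_ops (nreg v) + expr_ops (Add (Load (nreg v)) (Const 1)) + 1 = 13"
  "expr_ops (nreg v) + expr_ops (Const 0) + 1 = 6"
  by (simp_all add: base_def)

lemma loop_correct:
  fixes k :: nat
  assumes N: "N \<ge> 1" and v: "v < 32"
    and body: "\<And>Q s m. wp N c Q s \<Longrightarrow> represents N s m \<Longrightarrow>
      \<exists>t m' s'. exec (mem_size N) (compile c) m t m' \<and> represents N s' m' \<and> Q s' \<and> t \<le> B"
  defines "L \<equiv> Loop (Less (Load (nreg v)) (Mul (Const (int k)) (Load (Const 0))))
       (Seq (compile c) (Store (nreg v) (Add (Load (nreg v)) (Const 1))))"
  shows "for_wp (wp N c) v n Q s \<Longrightarrow> represents N s m \<Longrightarrow> nv s v + n = k * N \<Longrightarrow>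
    \<exists>t m' s'. exec (mem_size N) L m t m' \<and> represents N s' m' \<and> Q s' \<and> t \<le> n * (B + 40) + 20"
proof (induction n arbitrary: s m)
  case 0
  have "cond_val (mem_size N) m (Less (Load (nreg v)) (Mul (Const (int k)) (Load (Const 0)))) = Some False"
    using for_test_val[OF N 0(2) v, of k] 0(3) by simp
  from exec_Loop_False[OF this] have "exec (mem_size N) L m 9 m"
    unfolding L_def for_ops .
  then show ?case using 0 by (intro exI[of _ 9] exI[of _ m] exI[of _ s]) auto
next
  case (Suc n)
  have cv: "cond_val (mem_size N) m (Less (Load (nreg v)) (Mul (Const (int k)) (Load (Const 0)))) = Some True"
    using for_test_val[OF N Suc(3) v, of k] Suc(4) by simp
  obtain t1 m1 s1 where 1: "exec (mem_size N) (compile c) m t1 m1" "represents N s1 m1" "t1 \<le> B"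
    "nv s1 v = nv s v" "for_wp (wp N c) v n Q (s1\<lparr>nv := (nv s1)(v := Suc (nv s v))\<rparr>)"
    using body[OF Suc.prems(1)[unfolded for_wp.simps] Suc.prems(2)] by blast
  let ?m2 = "m1(naddr N v := real (Suc (nv s v)))"
  have ex2: "exec (mem_size N) (Store (nreg v) (Add (Load (nreg v)) (Const 1))) m1 13 ?m2"
  proof -
    have "expr_val (mem_size N) m1 (Add (Load (nreg v)) (Const 1)) = Some (real (Suc (nv s v)))"
      using incr_val[OF N 1(2) v] 1(4) by simp
    from exec_Store[OF nreg_val[OF N 1(2)] address_of_nat[OF addr_bounds(1)[OF N v]] this]
    show ?thesis unfolding for_ops .
  qed
  obtain t3 m3 s3 where 3: "exec (mem_size N) L ?m2 t3 m3" "represents N s3 m3" "Q s3" "t3 \<le> n * (B + 40) + 20"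
  proof -
    have "nv (s1\<lparr>nv := (nv s1)(v := Suc (nv s v))\<rparr>) v + n = k * N" using Suc.prems(3) by simp
    from Suc.IH[OF 1(5) rep_nreg[OF N 1(2) v] this] that show thesis by blast
  qed
  have "exec (mem_size N) L m (9 + (t1 + 13) + t3) m3"
    using exec_Loop_True[OF cv exec_Seq[OF 1(1) ex2] 3(1)[unfolded L_def]] unfolding L_def for_ops .
  then show ?case
    using 1(3) 3 by (intro exI[of _ "9 + (t1 + 13) + t3"] exI[of _ m3] exI[of _ s3]) auto
qed

lemma ex_result:
  "exec S p m t m' \<Longrightarrow> represents N s' m' \<Longrightarrow> Q s' \<Longrightarrow> t \<le> B \<Longrightarrow>
    \<exists>t m' s'. exec S p m t m' \<and> represents N s' m' \<and> Q s' \<and> t \<le> B"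
  by blast

theorem compile_correct:
  assumes N: "N \<ge> 1"
  shows "wp N c Q s \<Longrightarrow> represents N s m \<Longrightarrow>
    \<exists>t m' s'. exec (mem_size N) (compile c) m t m' \<and> represents N s' m' \<and> Q s' \<and> t \<le> cost c * N ^ nesting c"
proof (induction c arbitrary: Q s m)
  case CSkip
  then show ?case by (auto intro!: exec_Skip)
next
  case (CNat k e)
  then have k: "k < 32" and e: "ndef N s e" and Q: "Q (s\<lparr>nv := (nv s)(k := nval N s e)\<rparr>)" by simp_all
  show ?case unfolding compile.simps
    by (rule ex_result[where Q = Q, OF exec_Store[OF nreg_val[OF N CNat(2)] address_of_nat[OF addr_bounds(1)[OF N k]]
          ncomp_val[OF N CNat(2) e]] rep_nreg[OF N CNat(2) k] Q]) simp
next
  case (CReal k e)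
  then have k: "k < 32" and e: "rdef N s e" and Q: "Q (s\<lparr>rv := (rv s)(k := rval N s e)\<rparr>)" by simp_all
  show ?case unfolding compile.simps
    by (rule ex_result[where Q = Q, OF exec_Store[OF rreg_val[OF N CReal(2)] address_of_nat[OF addr_bounds(2)[OF N k]]
          rcomp_val[OF N CReal(2) e]] rep_rreg[OF N CReal(2) k] Q]) simp
next
  case (CArr a i e)
  then have a: "a < 32" "nval N s i < N" and i: "ndef N s i" and e: "rdef N s e"
    and Q: "Q (s\<lparr>ra := (ra s)(a := (ra s a)(nval N s i := rval N s e))\<rparr>)" by simp_all
  show ?case unfolding compile.simps
    by (rule ex_result[where Q = Q, OF exec_Store[OF cell_val[OF N CArr(2) ncomp_val[OF N CArr(2) i]]
          address_of_nat[OF addr_bounds(3)[OF N a]] rcomp_val[OF N CArr(2) e]] rep_cell[OF N CArr(2) a] Q]) simp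
next
  case (CNArr a i e)
  then have a: "a < 32" "nval N s i < N" and i: "ndef N s i" and e: "ndef N s e"
    and Q: "Q (s\<lparr>ra := (ra s)(a := (ra s a)(nval N s i := real (nval N s e)))\<rparr>)" by simp_all
  show ?case unfolding compile.simps
    by (rule ex_result[where Q = Q, OF exec_Store[OF cell_val[OF N CNArr(2) ncomp_val[OF N CNArr(2) i]]
          address_of_nat[OF addr_bounds(3)[OF N a]] ncomp_val[OF N CNArr(2) e]] rep_cell[OF N CNArr(2) a] Q]) simp
next
  case (CLow i e)
  then have a: "0 < nval N s i" "nval N s i < 6 * N * N" and i: "ndef N s i" and e: "rdef N s e"
    and Q: "Q (s\<lparr>low := (low s)(nval N s i := rval N s e)\<rparr>)" by simp_all
  show ?case unfolding compile.simps
    by (rule ex_result[where Q = Q, OF exec_Store[OF ncomp_val[OF N CLow(2) i]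
          address_of_nat[OF addr_bounds(4)[OF N a(2)]] rcomp_val[OF N CLow(2) e]] rep_low[OF N CLow(2) a] Q]) simp
next
  case (CSeq c d)
  obtain t1 m1 s1 where 1: "exec (mem_size N) (compile c) m t1 m1" "represents N s1 m1" "wp N d Q s1"
    "t1 \<le> cost c * N ^ nesting c"
    using CSeq.IH(1)[OF CSeq.prems(1)[unfolded wp.simps] CSeq.prems(2)] by blast
  obtain t2 m2 s2 where 2: "exec (mem_size N) (compile d) m1 t2 m2" "represents N s2 m2" "Q s2"
    "t2 \<le> cost d * N ^ nesting d"
    using CSeq.IH(2)[OF 1(3,2)] by blast
  have "cost c * N ^ nesting c \<le> cost c * N ^ nesting (c;; d)" "cost d * N ^ nesting d \<le> cost d * N ^ nesting (c;; d)"
    using N by (auto intro!: mult_left_mono power_increasing)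
  then have "t1 + t2 \<le> cost (c;; d) * N ^ nesting (c;; d)"     using 1(4) 2(4) unfolding cost.simps add_mult_distrib by linarith
  from ex_result[where Q = Q, OF exec_Seq[OF 1(1) 2(1)] 2(2,3) this] show ?case by simp
next
  case (CIf b c d)
  have cv: "cond_val (mem_size N) m (tcomp b) = Some (tval N s b)"
    using tcomp_val[OF N CIf.prems(2)] CIf.prems(1) by simp
  have "cost c * N ^ nesting c \<le> cost c * N ^ nesting (CIf b c d)" "cost d * N ^ nesting d \<le> cost d * N ^ nesting (CIf b c d)"
    "cond_ops (tcomp b) * 1 \<le> cond_ops (tcomp b) * N ^ nesting (CIf b c d)"
    using N by (auto intro!: mult_left_mono power_increasing simp del: mult_1_right)
  then have le: "cond_ops (tcomp b) + t \<le> cost (CIf b c d) * N ^ nesting (CIf b c d)"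
    if "t \<le> cost c * N ^ nesting c \<or> t \<le> cost d * N ^ nesting d" for t
    using that unfolding cost.simps add_mult_distrib mult_1_right by linarith
  show ?case
  proof (cases "tval N s b")
    case True
    then have True_eq: "tval N s b = True" by simp
    obtain t1 m1 s1 where "exec (mem_size N) (compile c) m t1 m1" "represents N s1 m1" "Q s1"
      "t1 \<le> cost c * N ^ nesting c"
      using CIf.IH(1)[OF _ CIf.prems(2), of Q] CIf.prems(1) True by auto
    from ex_result[where Q = Q, OF exec_Branch_True[OF cv[unfolded True_eq] this(1)] this(2,3) le] this(4) show ?thesis by simp
  next
    case False
    then have False_eq: "tval N s b = False" by simp
    obtain t1 m1 s1 where "exec (mem_size N) (compile d) m t1 m1" "represents N s1 m1" "Q s1"
      "t1 \<le> cost d * N ^ nesting d"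
      using CIf.IH(2)[OF _ CIf.prems(2), of Q] CIf.prems(1) False by auto
    from ex_result[where Q = Q, OF exec_Branch_False[OF cv[unfolded False_eq] this(1)] this(2,3) le] this(4) show ?thesis by simp
  qed
next
  case (CFor v k c)
  have v: "v < 32" and W: "for_wp (wp N c) v (k * N) Q (s\<lparr>nv := (nv s)(v := 0)\<rparr>)"
    using CFor.prems by simp_all
  let ?m = "m(naddr N v := real 0)" and ?B = "cost c * N ^ nesting c"
  have ex1: "exec (mem_size N) (Store (nreg v) (Const 0)) m 6 ?m"
    using exec_Store[OF nreg_val[OF N CFor.prems(2)] address_of_nat[OF addr_bounds(1)[OF N v]], of "Const 0" "real 0"]
    unfolding for_ops by simp
  have "\<exists>t m' s'. exec (mem_size N) (Loop (Less (Load (nreg v)) (Mul (Const (int k)) (Load (Const 0))))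
       (Seq (compile c) (Store (nreg v) (Add (Load (nreg v)) (Const 1))))) ?m t m' \<and>
       represents N s' m' \<and> Q s' \<and> t \<le> k * N * (?B + 40) + 20"
    by (rule loop_correct[OF N v CFor.IH W rep_nreg[OF N CFor.prems(2) v]]) (assumption | simp)+
  then obtain t m' s' where *: "represents N s' m'" "Q s'" "t \<le> k * N * (?B + 40) + 20"
    "exec (mem_size N) (Loop (Less (Load (nreg v)) (Mul (Const (int k)) (Load (Const 0))))
       (Seq (compile c) (Store (nreg v) (Add (Load (nreg v)) (Const 1))))) ?m t m'"
    by blast
  \<comment> \<open>The factors 1 mark the overhead of the loop; since \<open>N \<ge> 1\<close> they
    may grow to powers of \<open>N\<close>, which absorbs the overhead into the leading
    term.\<close>
  have "6 + t \<le> 60 * 1 + k * N * (?B + 60 * 1)" using *(3) by (simp add: algebra_simps)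
  also have "\<dots> \<le> 60 * N ^ Suc (nesting c) + k * N * (?B + 60 * N ^ nesting c)"
    using N by (intro add_mono mult_left_mono) auto
  also have "\<dots> = cost (CFor v k c) * N ^ nesting (CFor v k c)" by (simp add: algebra_simps)
  finally show ?case using ex_result[where Q = Q, OF exec_Seq[OF ex1 *(4)] *(1,2)] by simp
qed

text \<open>Loops are left out on purpose: straight-line code is evaluated by rewriting, while a
  loop is treated through an invariant with \<open>wp_for\<close>.\<close>

lemma wp_applied:
  "wp N CSkip post s \<longleftrightarrow> post s"
  "wp N (CNat k e) post s \<longleftrightarrow> k < 32 \<and> ndef N s e \<and> post (s\<lparr>nv := (nv s)(k := nval N s e)\<rparr>)"
  "wp N (CReal k r) post s \<longleftrightarrow> k < 32 \<and> rdef N s r \<and> post (s\<lparr>rv := (rv s)(k := rval N s r)\<rparr>)"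
  "wp N (CArr a i r) post s \<longleftrightarrow> a < 32 \<and> ndef N s i \<and> nval N s i < N \<and> rdef N s r \<and>
     post (s\<lparr>ra := (ra s)(a := (ra s a)(nval N s i := rval N s r))\<rparr>)"
  "wp N (CNArr a i e) post s \<longleftrightarrow> a < 32 \<and> ndef N s i \<and> nval N s i < N \<and> ndef N s e \<and>
     post (s\<lparr>ra := (ra s)(a := (ra s a)(nval N s i := real (nval N s e)))\<rparr>)"
  "wp N (CLow i r) post s \<longleftrightarrow> ndef N s i \<and> 0 < nval N s i \<and> nval N s i < 6 * N * N \<and> rdef N s r \<and>
     post (s\<lparr>low := (low s)(nval N s i := rval N s r)\<rparr>)"
  "wp N (c;; d) post s \<longleftrightarrow> wp N c (wp N d post) s"
  "wp N (CIf b c d) post s \<longleftrightarrow> tdef N s b \<and> (if tval N s b then wp N c post s else wp N d post s)"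
  by simp_all

declare wp.simps [simp del] wp_applied [simp]

section \<open>Sweeping lines sorted by slope\<close>

text \<open>The flag \<open>h\<close> stands in for the value minus infinity of an empty maximum,
  which no real cell can hold.\<close>

definition is_max :: "nat \<Rightarrow> real \<Rightarrow> real set \<Rightarrow> bool" where
  "is_max h a S \<longleftrightarrow> (h = 0 \<and> S = {}) \<or> (h = 1 \<and> a \<in> S \<and> (\<forall>r\<in>S. r \<le> a))"

definition raise_max :: "nat \<Rightarrow> real \<Rightarrow> real \<Rightarrow> real" where
  "raise_max h A r = (if h = 0 then r else max A r)"

lemma is_max_raise: "is_max h A S \<Longrightarrow> is_max 1 (raise_max h A r) (insert r S)"
  unfolding is_max_def raise_max_def by (auto simp: max_def)

text \<open>
  Line \<open>i\<close> is \<open>t \<mapsto> m i * t + b i\<close>; kind 1 lines bound the region from below, kind 2 lines from above,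
  kind 3 entries are vertical bounds \<open>b i\<close>, and kind 0 entries are ignored.  \<open>\<pi>\<close> lists the lines by
  increasing slope.
\<close>
locale sweep =
  fixes N :: nat and m b :: "nat \<Rightarrow> real" and kd \<pi> :: "nat \<Rightarrow> nat"
  assumes sorted: "a < c \<Longrightarrow> c < N \<Longrightarrow> m (\<pi> a) \<le> m (\<pi> c)"
    and strict: "a < c \<Longrightarrow> c < N \<Longrightarrow> kd (\<pi> a) = 1 \<Longrightarrow> kd (\<pi> c) = 2 \<Longrightarrow> m (\<pi> a) < m (\<pi> c)"
begin

definition line :: "nat \<Rightarrow> real \<Rightarrow> real" where
  "line i t = m i * t + b i"

definition meet :: "nat \<Rightarrow> nat \<Rightarrow> real" where
  "meet i j = (b i - b j) / (m j - m i)"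

text \<open>In sorted order, a lower and an upper line with increasing slopes are exactly a kind 1
  line listed before a kind 2 line. Hence the elements found in a prefix are the roots of that
  prefix.\<close>

definition bounds :: "nat \<Rightarrow> real set" where
  "bounds pos = {b (\<pi> a) | a. a < pos \<and> kd (\<pi> a) = 3} \<union>
     {meet (\<pi> a) (\<pi> c) | a c. a < c \<and> c < pos \<and> kd (\<pi> a) = 1 \<and> kd (\<pi> c) = 2}"

text \<open>The last clause says, without division, that the breakpoints of the envelope occur in
  the order of the deque: where a line is not above its predecessor, the next one is not above it
  either.\<close>

definition deque_ok :: "nat \<Rightarrow> nat \<Rightarrow> nat \<Rightarrow> (nat \<Rightarrow> nat) \<Rightarrow> bool" where
  "deque_ok pos p q D \<longleftrightarrow> p \<le> q \<and> q \<le> pos \<and>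
     (\<forall>k. p \<le> k \<longrightarrow> k < q \<longrightarrow> (\<exists>a<pos. D k = \<pi> a \<and> kd (\<pi> a) = 1)) \<and>
     (\<forall>k. p \<le> k \<longrightarrow> k + 1 < q \<longrightarrow> m (D k) < m (D (k + 1))) \<and>
     (\<forall>k t. p \<le> k \<longrightarrow> k + 2 < q \<longrightarrow> line (D (k + 1)) t \<le> line (D k) t \<longrightarrow> line (D (k + 2)) t \<le> line (D (k + 1)) t)"

definition covered :: "nat \<Rightarrow> nat \<Rightarrow> nat \<Rightarrow> (nat \<Rightarrow> nat) \<Rightarrow> nat \<Rightarrow> real \<Rightarrow> nat \<Rightarrow> bool" where
  "covered pos p q D h A a \<longleftrightarrow> (\<forall>t. (h = 1 \<longrightarrow> A \<le> t) \<longrightarrow>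
     (\<exists>k. p \<le> k \<and> k < q \<and> line (\<pi> a) t \<le> line (D k) t) \<or>
     (pos < N \<and> kd (\<pi> pos) = 1 \<and> line (\<pi> a) t \<le> line (\<pi> pos) t))"

text \<open>\<open>A\<close> is only required to lie in the final set \<open>bounds N\<close>,
  because a meeting with the current upper line is recorded before that line counts as
  processed.\<close>

definition bound_ok :: "nat \<Rightarrow> nat \<Rightarrow> real \<Rightarrow> bool" where
  "bound_ok pos h A \<longleftrightarrow> (if h = 0 then bounds pos = {} else h = 1 \<and> A \<in> bounds N \<and> (\<forall>r\<in>bounds pos. r \<le> A))"

text \<open>
  The deque \<open>D p, \<dots>, D (q - 1)\<close> is the upper envelope, restricted to \<open>t \<ge> A\<close>, of the kind 1 lines
  seen so far; the current line may stand in for lines popped while it is being inserted.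
\<close>
definition sweep_inv :: "nat \<Rightarrow> nat \<Rightarrow> nat \<Rightarrow> (nat \<Rightarrow> nat) \<Rightarrow> nat \<Rightarrow> real \<Rightarrow> bool" where
  "sweep_inv pos p q D h A \<longleftrightarrow> pos \<le> N \<and> deque_ok pos p q D \<and>
     (\<forall>a<pos. kd (\<pi> a) = 1 \<longrightarrow> covered pos p q D h A a) \<and> bound_ok pos h A"

lemma invI:
  assumes "pos \<le> N" "deque_ok pos p q D"
    and "\<And>a t. a < pos \<Longrightarrow> kd (\<pi> a) = 1 \<Longrightarrow> (h = 1 \<Longrightarrow> A \<le> t) \<Longrightarrow>
        (\<exists>k. p \<le> k \<and> k < q \<and> line (\<pi> a) t \<le> line (D k) t) \<or>
        (pos < N \<and> kd (\<pi> pos) = 1 \<and> line (\<pi> a) t \<le> line (\<pi> pos) t)"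
    and "bound_ok pos h A"
  shows "sweep_inv pos p q D h A"
  using assms unfolding sweep_inv_def covered_def by blast

lemma deque_okD:
  assumes "deque_ok pos p q D"
  shows "p \<le> q" "q \<le> pos"
    and "\<And>k. p \<le> k \<Longrightarrow> k < q \<Longrightarrow> \<exists>a<pos. D k = \<pi> a \<and> kd (\<pi> a) = 1"
    and "\<And>k. p \<le> k \<Longrightarrow> k + 1 < q \<Longrightarrow> m (D k) < m (D (k + 1))"
    and "\<And>k t. p \<le> k \<Longrightarrow> k + 2 < q \<Longrightarrow> line (D (k + 1)) t \<le> line (D k) t \<Longrightarrow> line (D (k + 2)) t \<le> line (D (k + 1)) t"
  using assms unfolding deque_ok_def by blast+

lemma invD:
  assumes "sweep_inv pos p q D h A"
  shows "p \<le> q" "q \<le> pos" "pos \<le> N"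
    and "\<And>k. p \<le> k \<Longrightarrow> k < q \<Longrightarrow> \<exists>a<pos. D k = \<pi> a \<and> kd (\<pi> a) = 1"
    and "\<And>k. p \<le> k \<Longrightarrow> k + 1 < q \<Longrightarrow> m (D k) < m (D (k + 1))"
    and "\<And>k t. p \<le> k \<Longrightarrow> k + 2 < q \<Longrightarrow> line (D (k + 1)) t \<le> line (D k) t \<Longrightarrow> line (D (k + 2)) t \<le> line (D (k + 1)) t"
    and "\<And>a t. a < pos \<Longrightarrow> kd (\<pi> a) = 1 \<Longrightarrow> (h = 1 \<Longrightarrow> A \<le> t) \<Longrightarrow>
        (\<exists>k. p \<le> k \<and> k < q \<and> line (\<pi> a) t \<le> line (D k) t) \<or>
        (pos < N \<and> kd (\<pi> pos) = 1 \<and> line (\<pi> a) t \<le> line (\<pi> pos) t)"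
    and "bound_ok pos h A" "deque_ok pos p q D"
proof -
  show D: "deque_ok pos p q D" and "pos \<le> N" "bound_ok pos h A"
    using assms unfolding sweep_inv_def by blast+
  note deque_okD[OF D]
  then show "p \<le> q" "q \<le> pos"
    "\<And>k. p \<le> k \<Longrightarrow> k < q \<Longrightarrow> \<exists>a<pos. D k = \<pi> a \<and> kd (\<pi> a) = 1"
    "\<And>k. p \<le> k \<Longrightarrow> k + 1 < q \<Longrightarrow> m (D k) < m (D (k + 1))"
    "\<And>k t. p \<le> k \<Longrightarrow> k + 2 < q \<Longrightarrow> line (D (k + 1)) t \<le> line (D k) t \<Longrightarrow> line (D (k + 2)) t \<le> line (D (k + 1)) t"
    by blast+
  show "\<And>a t. a < pos \<Longrightarrow> kd (\<pi> a) = 1 \<Longrightarrow> (h = 1 \<Longrightarrow> A \<le> t) \<Longrightarrow>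
        (\<exists>k. p \<le> k \<and> k < q \<and> line (\<pi> a) t \<le> line (D k) t) \<or>
        (pos < N \<and> kd (\<pi> pos) = 1 \<and> line (\<pi> a) t \<le> line (\<pi> pos) t)"
    using assms unfolding sweep_inv_def covered_def by blast
qed

lemma deque_okI:
  assumes "p \<le> q" "q \<le> pos"
    and "\<And>k. p \<le> k \<Longrightarrow> k < q \<Longrightarrow> \<exists>a<pos. D k = \<pi> a \<and> kd (\<pi> a) = 1"
    and "\<And>k. p \<le> k \<Longrightarrow> k + 1 < q \<Longrightarrow> m (D k) < m (D (k + 1))"
    and "\<And>k t. p \<le> k \<Longrightarrow> k + 2 < q \<Longrightarrow> line (D (k + 1)) t \<le> line (D k) t \<Longrightarrow> line (D (k + 2)) t \<le> line (D (k + 1)) t"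
  shows "deque_ok pos p q D"
  using assms unfolding deque_ok_def by blast

lemma deque_ok_Suc:
  assumes "deque_ok pos p q D"
  shows "deque_ok (Suc pos) p q D"
proof (rule deque_okI)
  note I = deque_okD[OF assms]
  show "p \<le> q" "q \<le> Suc pos" using I(1,2) by auto
  show "\<exists>a<Suc pos. D k = \<pi> a \<and> kd (\<pi> a) = 1" if "p \<le> k" "k < q" for k
    using I(3)[OF that] less_SucI by blast
qed (use deque_okD[OF assms] in blast)+

lemma deque_ok_shrink:
  assumes "deque_ok pos p q D" "p \<le> p'" "p' \<le> q'" "q' \<le> q"
  shows "deque_ok pos p' q' D"
proof (rule deque_okI)
  note I = deque_okD[OF assms(1)]
  show "p' \<le> q'" "q' \<le> pos" using I(1,2) assms by auto
  show "\<exists>a<pos. D k = \<pi> a \<and> kd (\<pi> a) = 1" if "p' \<le> k" "k < q'" for k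
    by (rule I(3)) (use that assms in auto)
  show "m (D k) < m (D (k + 1))" if "p' \<le> k" "k + 1 < q'" for k
    by (rule I(4)) (use that assms in auto)
  show "line (D (k + 2)) t \<le> line (D (k + 1)) t"
    if "p' \<le> k" "k + 2 < q'" "line (D (k + 1)) t \<le> line (D k) t" for k t
    by (rule I(5)[OF _ _ that(3)]) (use that assms in auto)
qed

lemma line_mono:
  assumes "m i \<le> m j" "line i t \<le> line j t" "t \<le> t'"
  shows "line i t' \<le> line j t'"
proof -
  have "(m j - m i) * t \<le> (m j - m i) * t'" using assms by (intro mult_left_mono) auto
  then show ?thesis using assms(2) unfolding line_def by (simp add: algebra_simps)
qed

lemma line_mono_left:
  assumes "m i \<le> m j" "line j t \<le> line i t" "t' \<le> t"
  shows "line j t' \<le> line i t'"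
proof -
  have "(m j - m i) * t' \<le> (m j - m i) * t" using assms by (intro mult_left_mono) auto
  then show ?thesis using assms(2) unfolding line_def by (simp add: algebra_simps)
qed

lemma line_strict:
  assumes "m i < m j" "line i t \<le> line j t" "t < t'"
  shows "line i t' < line j t'"
proof -
  have "(m j - m i) * t < (m j - m i) * t'" using assms by simp
  then show ?thesis using assms(2) unfolding line_def by (simp add: algebra_simps)
qed

lemma line_meet: "m i < m j \<Longrightarrow> line i (meet i j) = line j (meet i j)"
  unfolding line_def meet_def by (simp add: field_simps)

section \<open>Preservation of the sweep invariant\<close>

lemma inv_init: "sweep_inv 0 0 0 D 0 A"
  by (rule invI) (auto simp: bounds_def bound_ok_def deque_ok_def)

lemma inv_done: "sweep_inv N p q D h A \<Longrightarrow> is_max h A (bounds N)"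
  using invD(8)[of N p q D h A] unfolding is_max_def bound_ok_def by (auto split: if_splits)

lemma bounds_Suc_other: "kd (\<pi> pos) \<noteq> 2 \<Longrightarrow> kd (\<pi> pos) \<noteq> 3 \<Longrightarrow> bounds (Suc pos) = bounds pos"
  unfolding bounds_def by (auto simp: less_Suc_eq)

text \<open>Raising \<open>A\<close> only shrinks the range of \<open>t\<close> on which the deque
  has to represent the envelope.\<close>

lemma inv_raise:
  assumes "sweep_inv pos p q D h A" "r \<in> bounds N"
  shows "sweep_inv pos p q D 1 (raise_max h A r)"
proof (rule invI)
  note I = invD[OF assms(1)]
  show "pos \<le> N" "deque_ok pos p q D" using I by blast+
  show "(\<exists>k. p \<le> k \<and> k < q \<and> line (\<pi> a) t \<le> line (D k) t) \<or>
      (pos < N \<and> kd (\<pi> pos) = 1 \<and> line (\<pi> a) t \<le> line (\<pi> pos) t)"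
    if "a < pos" "kd (\<pi> a) = 1" "1 = (1::nat) \<Longrightarrow> raise_max h A r \<le> t" for a t
  proof (rule I(7)[OF that(1,2)])
    assume "h = 1" then show "A \<le> t" using that(3) unfolding raise_max_def by simp
  qed
  show "bound_ok pos 1 (raise_max h A r)"
    using I(8) assms(2) unfolding raise_max_def bound_ok_def by (auto split: if_splits simp: max_def)
qed

lemma inv_next:
  assumes "sweep_inv pos p q D h A" "pos < N" "kd (\<pi> pos) \<noteq> 1" "\<forall>r\<in>bounds (Suc pos) - bounds pos. h = 1 \<and> r \<le> A"
  shows "sweep_inv (Suc pos) p q D h A"
proof (rule invI)
  note I = invD[OF assms(1)]
  show "Suc pos \<le> N" "deque_ok (Suc pos) p q D" using deque_ok_Suc[OF I(9)] assms(2) by auto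
  show "(\<exists>k. p \<le> k \<and> k < q \<and> line (\<pi> a) t \<le> line (D k) t) \<or>
      (Suc pos < N \<and> kd (\<pi> (Suc pos)) = 1 \<and> line (\<pi> a) t \<le> line (\<pi> (Suc pos)) t)"
    if "a < Suc pos" "kd (\<pi> a) = 1" "h = 1 \<Longrightarrow> A \<le> t" for a t
  proof -
    have "a < pos" using that assms(3) by (cases "a = pos") auto
    from I(7)[OF this that(2,3)] show ?thesis using assms(3) by auto
  qed
  show "bound_ok (Suc pos) h A"
    using I(8) assms(4) unfolding bound_ok_def by (auto split: if_splits)
qed

lemma inv_skip:
  assumes "sweep_inv pos p q D h A" "pos < N" "kd (\<pi> pos) \<notin> {1, 2, 3}"
  shows "sweep_inv (Suc pos) p q D h A"
  using assms by (intro inv_next) (auto simp: bounds_Suc_other)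

lemma inv_vertical:
  assumes "sweep_inv pos p q D h A" "pos < N" "kd (\<pi> pos) = 3"
  shows "sweep_inv (Suc pos) p q D 1 (raise_max h A (b (\<pi> pos)))"
proof -
  have "b (\<pi> pos) \<in> bounds N" unfolding bounds_def using assms(2,3) by blast
  note R = inv_raise[OF assms(1) this]
  have "r = b (\<pi> pos)" if "r \<in> bounds (Suc pos)" "r \<notin> bounds pos" for r
    using that assms(3) unfolding bounds_def by (auto simp: less_Suc_eq)
  then show ?thesis
    using assms(3) by (intro inv_next[OF R assms(2)]) (auto simp: raise_max_def)
qed

lemma inv_upper_empty:
  assumes "sweep_inv pos p q D h A" "pos < N" "kd (\<pi> pos) = 2" "\<not> p < q"
  shows "sweep_inv (Suc pos) p q D h A"
proof (rule inv_next[OF assms(1,2)])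
  \<comment> \<open>The value \<open>t = A\<close> is admissible in \<open>covered\<close>. With an
    empty deque and a current line of kind 2 neither alternative there can hold, so no lower line
    has been seen.\<close>
  have "kd (\<pi> a) \<noteq> 1" if "a < pos" for a
    using invD(7)[OF assms(1) that, of A] assms(3,4) by auto
  then have "bounds (Suc pos) = bounds pos"
    using assms(3) unfolding bounds_def by (auto simp: less_Suc_eq)
  then show "\<forall>r\<in>bounds (Suc pos) - bounds pos. h = 1 \<and> r \<le> A" by simp
qed (use assms(3) in simp)

lemma deque_below:
  assumes "sweep_inv pos p q D h A" "pos < N" "kd (\<pi> pos) = 2" "p \<le> k" "k < q"
  shows "m (D k) < m (\<pi> pos)" and "meet (D k) (\<pi> pos) \<in> bounds N"
proof -
  obtain a where a: "a < pos" "D k = \<pi> a" "kd (\<pi> a) = 1" using invD(4)[OF assms(1,4,5)] by blast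
  show "m (D k) < m (\<pi> pos)" using strict[OF a(1) assms(2) a(3) assms(3)] a(2) by simp
  show "meet (D k) (\<pi> pos) \<in> bounds N"
    unfolding bounds_def a(2) using a assms(2,3) by blast
qed

lemma inv_upper_advance:
  assumes I: "sweep_inv pos p q D h A" "pos < N" "kd (\<pi> pos) = 2" and q: "p + 1 < q"
    and t: "line (D p) \<tau> \<le> line (D (p + 1)) \<tau>" "\<tau> = meet (D p) (\<pi> pos)"
  shows "sweep_inv pos (p + 1) q D 1 (raise_max h A \<tau>)"
proof (rule invI)
  have "\<tau> \<in> bounds N" using deque_below(2)[OF I, of p] q t(2) by simp
  note R = invD[OF inv_raise[OF I(1) this]]
  show "pos \<le> N" using R(3) .
  show "deque_ok pos (p + 1) q D" using deque_ok_shrink[OF R(9)] q by simp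
  show "(\<exists>k. p + 1 \<le> k \<and> k < q \<and> line (\<pi> a) t \<le> line (D k) t) \<or>
      (pos < N \<and> kd (\<pi> pos) = 1 \<and> line (\<pi> a) t \<le> line (\<pi> pos) t)"
    if a: "a < pos" "kd (\<pi> a) = 1" "1 = (1::nat) \<Longrightarrow> raise_max h A \<tau> \<le> t" for a t
  proof -
    obtain k where k: "p \<le> k" "k < q" "line (\<pi> a) t \<le> line (D k) t"
      using R(7)[OF a] I(3) by auto
    show ?thesis
    proof (cases "k = p")
      case True
      have "\<tau> \<le> t" using a(3) unfolding raise_max_def by (auto split: if_splits)
      then have "line (D p) t \<le> line (D (p + 1)) t"
        using line_mono[OF _ t(1)] R(5)[of p] q by simp
      then show ?thesis using True k(3) q by (intro disjI1 exI[of _ "p + 1"]) simp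
    next
      case False
      then show ?thesis using k by (intro disjI1 exI[of _ k]) simp
    qed
  qed
  show "bound_ok pos 1 (raise_max h A \<tau>)" using R(8) .
qed

text \<open>By the order of the breakpoints the front is the highest deque line at
  \<open>\<tau>\<close>, and there it meets the upper line. All deque lines have smaller slope than
  the upper line, so they stay strictly below it to the right of \<open>\<tau>\<close>, and no
  further meeting can exceed the recorded bound.\<close>

lemma inv_upper_finish:
  assumes I: "sweep_inv pos p q D h A" "pos < N" "kd (\<pi> pos) = 2" and q: "p < q"
    and t: "p + 1 < q \<Longrightarrow> line (D (p + 1)) \<tau> \<le> line (D p) \<tau>" "\<tau> = meet (D p) (\<pi> pos)"
  shows "sweep_inv (Suc pos) p q D 1 (raise_max h A \<tau>)"
proof -
  have "\<tau> \<in> bounds N" using deque_below(2)[OF I, of p] q t(2) by simp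
  note R' = inv_raise[OF I(1) this]
  note R = invD[OF R']
  let ?j = "\<pi> pos"
  have desc: "line (D (k + 1)) \<tau> \<le> line (D k) \<tau>" if "p \<le> k" "k + 1 < q" for k
    using that
  proof (induction k rule: dec_induct)
    case base then show ?case using t by simp
  next
    case (step k)
    then show ?case using R(6)[of k \<tau>] by simp
  qed
  have top: "line (D k) \<tau> \<le> line ?j \<tau>" if "p \<le> k" "k < q" for k
    using that
  proof (induction k rule: dec_induct)
    case base
    then show ?case using line_meet[of "D p" ?j] deque_below(1)[OF I, of p] t(2) q by simp
  next
    case (step k)
    then show ?case using desc[of k] by simp
  qed
  \<comment> \<open>A larger root would lie in the range still represented by the deque: the lower
    line meeting the upper one there would be dominated by a deque line strictly below the upper
    one.\<close>
  have "r \<le> raise_max h A \<tau>" if new: "r \<in> bounds (Suc pos)" "r \<notin> bounds pos" for r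
  proof (rule ccontr)
    assume "\<not> r \<le> raise_max h A \<tau>"
    then have r: "raise_max h A \<tau> < r" by simp
    obtain a where a: "a < pos" "kd (\<pi> a) = 1" "r = meet (\<pi> a) ?j"
      using new I(3) unfolding bounds_def by (auto simp: less_Suc_eq)
    obtain k where k: "p \<le> k" "k < q" "line (\<pi> a) r \<le> line (D k) r"
      using R(7)[OF a(1,2), of r] r I(3) by auto
    have "\<tau> < r" using r unfolding raise_max_def by (auto split: if_splits)
    then have "line (D k) r < line ?j r"
      using line_strict[OF deque_below(1)[OF I k(1,2)] top[OF k(1,2)]] by blast
    moreover have "line (\<pi> a) r = line ?j r"
      using line_meet[OF strict[OF a(1) I(2) a(2) I(3)]] a(3) by simp
    ultimately show False using k(3) by simp
  qed
  then show ?thesis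
    by (intro inv_next[OF R' I(2)]) (use I(3) in auto)
qed

lemma inv_lower_skip:
  assumes I: "sweep_inv pos p q D h A" "pos < N" "kd (\<pi> pos) = 1" and q: "p < q"
    and eq: "m (D (q - 1)) = m (\<pi> pos)" "b (\<pi> pos) \<le> b (D (q - 1))"
  shows "sweep_inv (Suc pos) p q D h A"
proof (rule invI)
  note R = invD[OF I(1)]
  have le: "line (\<pi> pos) t \<le> line (D (q - 1)) t" for t unfolding line_def using eq by simp
  show "Suc pos \<le> N" "deque_ok (Suc pos) p q D" using deque_ok_Suc[OF R(9)] I(2) by auto
  show "(\<exists>k. p \<le> k \<and> k < q \<and> line (\<pi> a) t \<le> line (D k) t) \<or>
      (Suc pos < N \<and> kd (\<pi> (Suc pos)) = 1 \<and> line (\<pi> a) t \<le> line (\<pi> (Suc pos)) t)"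
    if a: "a < Suc pos" "kd (\<pi> a) = 1" "h = 1 \<Longrightarrow> A \<le> t" for a t
  proof -
    consider "\<exists>k. p \<le> k \<and> k < q \<and> line (\<pi> a) t \<le> line (D k) t" | "line (\<pi> a) t \<le> line (\<pi> pos) t"
      using R(7)[of a t] a by (cases "a = pos") auto
    then show ?thesis
    proof cases
      case 2
      then show ?thesis using le[of t] q by (intro disjI1 exI[of _ "q - 1"]) auto
    qed blast
  qed
  show "bound_ok (Suc pos) h A"
    using R(8) bounds_Suc_other[of pos] I(3) unfolding bound_ok_def by (auto split: if_splits)
qed

lemma inv_lower_pop:
  assumes I: "sweep_inv pos p q D h A" "pos < N" "kd (\<pi> pos) = 1" and q: "p < q"
    and dom: "\<And>t. line (D (q - 1)) t \<le> line (\<pi> pos) t \<or> (p + 1 < q \<and> line (D (q - 1)) t \<le> line (D (q - 2)) t)"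
  shows "sweep_inv pos p (q - 1) D h A"
proof (rule invI)
  note R = invD[OF I(1)]
  show "pos \<le> N" using R(3) .
  show "deque_ok pos p (q - 1) D" using deque_ok_shrink[OF R(9)] q by simp
  show "(\<exists>k. p \<le> k \<and> k < q - 1 \<and> line (\<pi> a) t \<le> line (D k) t) \<or>
      (pos < N \<and> kd (\<pi> pos) = 1 \<and> line (\<pi> a) t \<le> line (\<pi> pos) t)"
    if a: "a < pos" "kd (\<pi> a) = 1" "h = 1 \<Longrightarrow> A \<le> t" for a t
  proof -
    have "(\<exists>k. p \<le> k \<and> k < q \<and> line (\<pi> a) t \<le> line (D k) t) \<or> line (\<pi> a) t \<le> line (\<pi> pos) t"
      using R(7)[of a t] a by blast
    then show ?thesis
    proof
      assume "\<exists>k. p \<le> k \<and> k < q \<and> line (\<pi> a) t \<le> line (D k) t"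
      then obtain k where k: "p \<le> k" "k < q" "line (\<pi> a) t \<le> line (D k) t" by blast
      show ?thesis
      proof (cases "k = q - 1")
        case True
        from dom[of t] show ?thesis
        proof
          assume "line (D (q - 1)) t \<le> line (\<pi> pos) t"
          then show ?thesis using I(2,3) k(3) True by auto
        next
          assume "p + 1 < q \<and> line (D (q - 1)) t \<le> line (D (q - 2)) t"
          then show ?thesis using k(3) True by (intro disjI1 exI[of _ "q - 2"]) auto
        qed
      next
        case False
        then show ?thesis using k by (intro disjI1 exI[of _ k]) simp
      qed
    qed (use I(2,3) in simp)
  qed
  show "bound_ok pos h A" using R(8) .
qed

lemma top_slope_le:
  assumes I: "sweep_inv pos p q D h A" "pos < N" "p < q"
  shows "m (D (q - 1)) \<le> m (\<pi> pos)"
  using invD(4)[OF I(1), of "q - 1"] I(2,3) sorted by fastforce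

lemma inv_lower_pop_equal:
  assumes I: "sweep_inv pos p q D h A" "pos < N" "kd (\<pi> pos) = 1" "p < q"
    and eq: "m (D (q - 1)) = m (\<pi> pos)" "b (D (q - 1)) \<le> b (\<pi> pos)"
  shows "sweep_inv pos p (q - 1) D h A"
  using eq by (intro inv_lower_pop[OF I]) (simp add: line_def)

text \<open>To the left of the breakpoint \<open>\<tau>\<close> the top line is dominated by its
  predecessor, to the right of it by the new line, which is at least as steep and not lower at
  \<open>\<tau>\<close>.\<close>

lemma inv_lower_pop_hidden:
  assumes I: "sweep_inv pos p q D h A" "pos < N" "kd (\<pi> pos) = 1" and q: "p + 1 < q"
    and t: "\<tau> = meet (D (q - 2)) (D (q - 1))" "line (D (q - 1)) \<tau> \<le> line (\<pi> pos) \<tau>"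
  shows "sweep_inv pos p (q - 1) D h A"
proof (rule inv_lower_pop[OF I])
  show "p < q" using q by simp
  have lt: "m (D (q - 2)) < m (D (q - 1))"
    using invD(5)[OF I(1), of "q - 2"] q by (simp add: numeral_2_eq_2 Suc_diff_Suc)
  show "line (D (q - 1)) t \<le> line (\<pi> pos) t \<or> (p + 1 < q \<and> line (D (q - 1)) t \<le> line (D (q - 2)) t)" for t
  proof (cases "\<tau> \<le> t")
    case True
    then show ?thesis using line_mono[OF top_slope_le[OF I(1,2)] t(2)] q by simp
  next
    case False
    then show ?thesis
      using line_mono_left[of "D (q - 2)" "D (q - 1)" \<tau> t] line_meet[OF lt] lt t(1) q by simp
  qed
qed

lemma inv_lower_push:
  assumes I: "sweep_inv pos p q D h A" "pos < N" "kd (\<pi> pos) = 1"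
    and lt: "p < q \<Longrightarrow> m (D (q - 1)) < m (\<pi> pos)"
    and t: "p + 1 < q \<Longrightarrow> line (\<pi> pos) (meet (D (q - 2)) (D (q - 1))) \<le> line (D (q - 1)) (meet (D (q - 2)) (D (q - 1)))"
  shows "sweep_inv (Suc pos) p (Suc q) (D(q := \<pi> pos)) h A"
proof (rule invI)
  note R = invD[OF I(1)]
  let ?D = "D(q := \<pi> pos)"
  show "Suc pos \<le> N" using I(2) by simp
  have le: "p \<le> Suc q" "Suc q \<le> Suc pos" using R(1,2) by auto
  have 1: "\<exists>a<Suc pos. ?D k = \<pi> a \<and> kd (\<pi> a) = 1" if "p \<le> k" "k < Suc q" for k
  proof (cases "k = q")
    case True
    then show ?thesis using I(3) by auto
  next
    case False
    then show ?thesis using R(4)[of k] that by (auto simp: less_Suc_eq)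
  qed
  have 2: "m (?D k) < m (?D (k + 1))" if "p \<le> k" "k + 1 < Suc q" for k
    using that R(5)[of k] lt by (cases "k + 1 = q") auto
  have 3: "line (?D (k + 2)) t \<le> line (?D (k + 1)) t"
    if k: "p \<le> k" "k + 2 < Suc q" "line (?D (k + 1)) t \<le> line (?D k) t" for k t
  proof (cases "k + 2 = q")
    case True
    then have D: "D k = D (q - 2)" "D (k + 1) = D (q - 1)" "p + 1 < q" using k by auto
    \<comment> \<open>Only the triple ending in the new line has to be examined. To the right of
      \<open>?\<tau>\<close> the old top is strictly above its predecessor, so the premise forces
      \<open>t \<le> ?\<tau>\<close>; there the steeper new line, not above the old top at
      \<open>?\<tau>\<close>, remains so.\<close>
    let ?\<tau> = "meet (D (q - 2)) (D (q - 1))"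
    have lt': "m (D (q - 2)) < m (D (q - 1))" using R(5)[of k] k(1) True D by simp
    have le: "line (D (q - 1)) t \<le> line (D (q - 2)) t" using k(3) True D by simp
    have "t \<le> ?\<tau>"
    proof (rule ccontr)
      assume "\<not> t \<le> ?\<tau>"
      then have "line (D (q - 2)) t < line (D (q - 1)) t"
        using line_strict[OF lt', of ?\<tau> t] line_meet[OF lt'] by simp
      then show False using le by simp
    qed
    then have "line (\<pi> pos) t \<le> line (D (q - 1)) t"
      using line_mono_left[OF _ t[OF D(3)]] lt D(3) by simp
    then show ?thesis using True D by simp
  next
    case False
    then show ?thesis using R(6)[of k t] k by simp
  qed
  show "deque_ok (Suc pos) p (Suc q) ?D"
    unfolding deque_ok_def using le 1 2 3 by blast
  show "(\<exists>k. p \<le> k \<and> k < Suc q \<and> line (\<pi> a) t \<le> line (?D k) t) \<or>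
      (Suc pos < N \<and> kd (\<pi> (Suc pos)) = 1 \<and> line (\<pi> a) t \<le> line (\<pi> (Suc pos)) t)"
    if a: "a < Suc pos" "kd (\<pi> a) = 1" "h = 1 \<Longrightarrow> A \<le> t" for a t
  proof -
    consider k where "p \<le> k" "k < q" "line (\<pi> a) t \<le> line (D k) t" | "line (\<pi> a) t \<le> line (\<pi> pos) t"
      using R(7)[of a t] a by (cases "a = pos") auto
    then show ?thesis
    proof cases
      case 1
      then show ?thesis by (intro disjI1 exI[of _ k]) simp
    next
      case 2
      then show ?thesis using R(1) by (intro disjI1 exI[of _ q]) simp
    qed
  qed
  show "bound_ok (Suc pos) h A"
    using R(8) bounds_Suc_other[of pos] I(3) unfolding bound_ok_def by (auto split: if_splits)
qed

end

section \<open>Sorting by rank\<close>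

text \<open>Quadratic time is affordable, so the position of an element in the sorted order is
  obtained by counting its predecessors; for a strict total order the positions are a
  bijection.\<close>

definition rank_of :: "('a \<Rightarrow> 'a \<Rightarrow> bool) \<Rightarrow> 'a set \<Rightarrow> 'a \<Rightarrow> nat" where
  "rank_of before M i = card {j \<in> M. before j i}"

lemma rank_of_less:
  assumes "finite M" "i \<in> M" "before i j" "\<not> before i i"
    and "\<And>k. k \<in> M \<Longrightarrow> before k i \<Longrightarrow> before k j"
  shows "rank_of before M i < rank_of before M j"
  unfolding rank_of_def using assms by (intro psubset_card_mono psubsetI) auto

lemma bij_betw_rank_of:
  assumes fin: "finite M" and irr: "\<And>i. i \<in> M \<Longrightarrow> \<not> before i i"
    and trans: "\<And>i j k. i \<in> M \<Longrightarrow> j \<in> M \<Longrightarrow> k \<in> M \<Longrightarrow> before i j \<Longrightarrow> before j k \<Longrightarrow> before i k"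
    and tot: "\<And>i j. i \<in> M \<Longrightarrow> j \<in> M \<Longrightarrow> i \<noteq> j \<Longrightarrow> before i j \<or> before j i"
  shows "bij_betw (rank_of before M) M {..<card M}"
proof -
  have less: "rank_of before M i < rank_of before M j" if "i \<in> M" "j \<in> M" "before i j" for i j
    using that fin irr trans by (intro rank_of_less) blast+
  have inj: "inj_on (rank_of before M) M"
    by (rule inj_onI) (metis less tot less_irrefl)
  have "rank_of before M i < card M" if "i \<in> M" for i
    unfolding rank_of_def using that fin irr by (intro psubset_card_mono) auto
  then have "rank_of before M ` M \<subseteq> {..<card M}" by auto
  moreover have "card (rank_of before M ` M) = card M" by (rule card_image[OF inj])
  ultimately have "rank_of before M ` M = {..<card M}" by (intro card_subset_eq) auto
  then show ?thesis using inj unfolding bij_betw_def by blast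
qed

section \<open>The program\<close>

text \<open>
  Natural registers: 0, 2, 6, 13 loop counters (2 is the current point \<open>x\<close>), 3 position of the sweep,
  4 and 5 deque limits, 7 rank, 8 current line, 9 and 10 deque entries, 11 presence flag of real
  register 2 (the running maximum), 12 success flag.  Arrays: 0, 20, 2 normalised half-planes,
  3 slopes, 4 sorted order, 5 kinds, 6 intercepts, 7 deque, 8 and 9 minima over the polygons with
  presence flags, \<open>10 + d\<close> and \<open>14 + d\<close> bounds of the intersected boxes with presence flags, 18 and 19
  the selection.
\<close>

definition rho_at :: rexp where
  "rho_at = RLow (NPlus (NC 2) (NPlus (NMul NN (NV 2)) (NV 13)))"

definition lambda :: rexp where
  "lambda = RLow (NC 1)"

definition dir_expr :: "nat \<Rightarrow> nexp \<Rightarrow> rexp" where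
  "dir_expr d e = (if d = 0 then RA 0 e else if d = 1 then RMinus (RC 0) (RA 0 e)
     else if d = 2 then RA 20 e else RMinus (RC 0) (RA 20 e))"

definition other_expr :: "nat \<Rightarrow> nexp \<Rightarrow> rexp" where
  "other_expr d e = (if d < 2 then RA 20 e else RA 0 e)"

lemma dir_expr_simps [simp]:
  "rval N s (dir_expr d e) = dir_coeff d (ra s 0) (ra s 20) (nval N s e)"
  "rdef N s (dir_expr d e) \<longleftrightarrow> ndef N s e \<and> nval N s e < N"
  "rval N s (other_expr d e) = other_coeff d (ra s 0) (ra s 20) (nval N s e)"
  "rdef N s (other_expr d e) \<longleftrightarrow> ndef N s e \<and> nval N s e < N"
  by (simp_all add: dir_expr_def other_expr_def dir_coeff_def other_coeff_def)

definition abs_cmd :: "nat \<Rightarrow> cmd" where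
  "abs_cmd k = CIf (RLt (RV k) (RC 0)) (CReal k (RMinus (RC 0) (RV k))) CSkip"

definition input :: "nat \<Rightarrow> rexp" where
  "input k = RLow (NPlus (NC k) (NPlus (NMul NN NN) (NMul (NC 3) (NV 0))))"

definition normalise_cmd :: cmd where
  "normalise_cmd = CFor 0 1 (
     CReal 4 (input 2);; abs_cmd 4;; CReal 5 (input 3);; abs_cmd 5;;
     CReal 4 (RPlus (RV 4) (RV 5));;
     CArr 0 (NV 0) (RDiv (input 2) (RV 4));;
     CArr 20 (NV 0) (RDiv (input 3) (RV 4));;
     CArr 2 (NV 0) (RDiv (input 4) (RV 4)))"

text \<open>If the coefficient vanishes, 0 is stored explicitly: this is the value of
  \<open>slope\<close>, where division by zero gives 0, while the machine would get stuck on the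
  division.\<close>

definition slope_cmd :: "nat \<Rightarrow> cmd" where
  "slope_cmd d = (let m = CArr 3 (NV 0) (RDiv (RMinus (RC 0) (dir_expr d (NV 0))) (other_expr d (NV 0))) in
     CFor 0 1 (CIf (RLt (other_expr d (NV 0)) (RC 0)) m
       (CIf (RLt (RC 0) (other_expr d (NV 0))) m (CArr 3 (NV 0) (RC 0)))))"

definition count_cmd :: "nat \<Rightarrow> cmd" where
  "count_cmd d = (let count = CNat 7 (NPlus (NV 7) (NC 1)) in
     CNat 7 (NC 0);;
     CFor 13 1 (
       CIf (RLt (RA 3 (NV 13)) (RA 3 (NV 0))) count
       (CIf (RLt (RA 3 (NV 0)) (RA 3 (NV 13))) CSkip
       (CIf (RLt (other_expr d (NV 0)) (other_expr d (NV 13))) count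
       (CIf (RLt (other_expr d (NV 13)) (other_expr d (NV 0))) CSkip
       (CIf (NLt (NV 13) (NV 0)) count CSkip))))))"

definition sort_cmd :: "nat \<Rightarrow> cmd" where
  "sort_cmd d = CFor 0 1 (count_cmd d;; CNArr 4 (NV 7) (NV 0))"

text \<open>A negative table entry encodes an infinite distance and gives kind 0. The lines are thus
  switched off individually for each point, and one sorted order serves all points. Vertical
  constraints bounding \<open>dir d\<close> from above also get kind 0.\<close>

definition kind_cmd :: "nat \<Rightarrow> cmd" where
  "kind_cmd d = CFor 13 1 (
     CReal 0 rho_at;;
     CIf (RLt (RV 0) (RC 0)) (CNArr 5 (NV 13) (NC 0);; CArr 6 (NV 13) (RC 0)) (
       CReal 20 (RMinus (RMul lambda (RV 0)) (RA 2 (NV 13)));;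
       CIf (RLt (other_expr d (NV 13)) (RC 0))
         (CNArr 5 (NV 13) (NC 1);; CArr 6 (NV 13) (RDiv (RV 20) (other_expr d (NV 13))))
       (CIf (RLt (RC 0) (other_expr d (NV 13)))
         (CNArr 5 (NV 13) (NC 2);; CArr 6 (NV 13) (RDiv (RV 20) (other_expr d (NV 13))))
       (CIf (RLt (dir_expr d (NV 13)) (RC 0))
         (CNArr 5 (NV 13) (NC 3);; CArr 6 (NV 13) (RDiv (RV 20) (dir_expr d (NV 13))))
         (CNArr 5 (NV 13) (NC 0);; CArr 6 (NV 13) (RC 0))))))"

section \<open>Input data and the order of the lines\<close>

locale program_data =
  fixes N :: nat and l :: real and \<rho> :: "nat \<Rightarrow> nat \<Rightarrow> ennreal" and h :: "nat \<Rightarrow> real \<times> real"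
    and \<alpha> :: "nat \<Rightarrow> real" and lw :: "nat \<Rightarrow> real"
  assumes N_pos: "N \<ge> 1" and l_pos: "l > 0" and metric: "pseudometric_on {..<N} \<rho>"
    and h_ne: "\<forall>i<N. h i \<noteq> 0"
    and lw_lambda: "lw 1 = l"
    and lw_rho: "i < N \<Longrightarrow> j < N \<Longrightarrow> lw (2 + N * i + j) = encode_dist (\<rho> i j)"
    and lw_h: "i < N \<Longrightarrow> lw (2 + N\<^sup>2 + 3 * i) = fst (h i)" "i < N \<Longrightarrow> lw (2 + N\<^sup>2 + 3 * i + 1) = snd (h i)"
      "i < N \<Longrightarrow> lw (2 + N\<^sup>2 + 3 * i + 2) = \<alpha> i"
begin

definition P :: "nat \<Rightarrow> real" where "P i = fst (h i) / (\<bar>fst (h i)\<bar> + \<bar>snd (h i)\<bar>)"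
definition Q :: "nat \<Rightarrow> real" where "Q i = snd (h i) / (\<bar>fst (h i)\<bar> + \<bar>snd (h i)\<bar>)"
definition B :: "nat \<Rightarrow> real" where "B i = \<alpha> i / (\<bar>fst (h i)\<bar> + \<bar>snd (h i)\<bar>)"

sublocale halfplane_space l "{..<N}" \<rho> "\<lambda>x. half_plane (h x) (\<alpha> x)" P Q B
  using halfplane_space_normalised[OF l_pos _ metric, of h \<alpha>] h_ne
  unfolding P_def[abs_def] Q_def[abs_def] B_def[abs_def] by simp

definition W :: "nat \<Rightarrow> nat \<Rightarrow> real" where "W x y = l * enn2real (\<rho> x y)"

lemma index_less:
  assumes "x < N" "y < N"
  shows "Suc (Suc (N * x + y)) < 6 * N * N"
proof -
  have "N * x + y < N * (x + 1)" using assms by simp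
  also have "\<dots> \<le> N * N" using assms by (intro mult_left_mono) auto
  finally have "N * x + y < N * N" .
  moreover have "N * N \<ge> 1" using N_pos by simp
  moreover have "6 * N * N = 6 * (N * N)" by simp
  ultimately show ?thesis by linarith
qed

lemma input_less:
  assumes "i < N"
  shows "4 + (N * N + 3 * i) < 6 * N * N"
proof -
  have "3 * i + 3 \<le> 3 * N" using assms by simp
  moreover have "N \<le> N * N" using N_pos by simp
  moreover have "6 * N * N = 6 * (N * N)" by simp
  ultimately show ?thesis using N_pos by linarith
qed

lemma lw_neg_iff: "x < N \<Longrightarrow> y < N \<Longrightarrow> lw (Suc (Suc (N * x + y))) < 0 \<longleftrightarrow> \<rho> x y = top"
  using lw_rho[of x y] by (simp add: encode_dist_def not_less)

lemma lw_scaled: "x < N \<Longrightarrow> y < N \<Longrightarrow> \<rho> x y \<noteq> top \<Longrightarrow> l * lw (Suc (Suc (N * x + y))) = W x y"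
  using lw_rho[of x y] by (simp add: encode_dist_def W_def)

lemma lw_input:
  assumes "i < N"
  shows "lw (Suc (Suc (N * N + 3 * i))) = fst (h i)" "lw (Suc (Suc (Suc (N * N + 3 * i)))) = snd (h i)"
    "lw (Suc (Suc (Suc (Suc (N * N + 3 * i))))) = \<alpha> i" "lw (3 + (N * N + 3 * i)) = snd (h i)"
    "lw (4 + (N * N + 3 * i)) = \<alpha> i"
  using lw_h[OF assms] by (simp_all add: power2_eq_square eval_nat_numeral)

lemma rho_at_simps:
  assumes "low s = lw" "nv s 2 < N" "nv s 13 < N"
  shows "rdef N s rho_at" "rval N s rho_at = lw (Suc (Suc (N * nv s 2 + nv s 13)))"
  using assms index_less[of "nv s 2" "nv s 13"] by (simp_all add: rho_at_def)

lemma lambda_simps: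
  assumes "low s = lw"
  shows "rdef N s lambda" "rval N s lambda = l"
proof -
  have "1 < 6 * N * N" using index_less[of 0 0] N_pos by simp
  then show "rdef N s lambda" "rval N s lambda = l"
    using assms lw_lambda by (simp_all add: lambda_def)
qed

lemma input_simps:
  assumes "low s = lw" "nv s 0 < N"
  shows "rdef N s (input 2)" "rdef N s (input 3)" "rdef N s (input 4)"
    "rval N s (input 2) = fst (h (nv s 0))" "rval N s (input 3) = snd (h (nv s 0))"
    "rval N s (input 4) = \<alpha> (nv s 0)"
  using assms input_less[OF assms(2)] lw_input[OF assms(2)] by (simp_all add: input_def)

lemma wp_abs: "k < 32 \<Longrightarrow> wp N (abs_cmd k) post s \<longleftrightarrow> post (s\<lparr>rv := (rv s)(k := \<bar>rv s k\<bar>)\<rparr>)"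
  by (auto simp: abs_cmd_def)

definition normed :: "store \<Rightarrow> bool" where
  "normed s \<longleftrightarrow> low s = lw \<and> (\<forall>i<N. ra s 0 i = P i \<and> ra s 20 i = Q i \<and> ra s 2 i = B i)"

lemma normedD: "normed s \<Longrightarrow> low s = lw" "normed s \<Longrightarrow> i < N \<Longrightarrow> ra s 0 i = P i"
  "normed s \<Longrightarrow> i < N \<Longrightarrow> ra s 20 i = Q i" "normed s \<Longrightarrow> i < N \<Longrightarrow> ra s 2 i = B i"
  unfolding normed_def by simp_all

lemma normed_coeff:
  assumes "normed s" "i < N"
  shows "dir_coeff d (ra s 0) (ra s 20) i = dir_coeff d P Q i"
    "other_coeff d (ra s 0) (ra s 20) i = other_coeff d P Q i"
  using normedD[OF assms(1)] assms(2) by (simp_all add: dir_coeff_def other_coeff_def)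

lemma normed_frame:
  assumes "normed s" "frame c s s'" "LArr 0 \<notin> mods c" "LArr 20 \<notin> mods c" "LArr 2 \<notin> mods c" "LLow \<notin> mods c"
  shows "normed s'"
  using assms frameD[OF assms(2)] unfolding normed_def by simp

lemma normalise_correct:
  assumes "low s = lw"
  shows "wp N normalise_cmd normed s"
  unfolding normalise_cmd_def
proof (rule wp_for[where I = "\<lambda>i s. low s = lw \<and> (\<forall>i'<i. ra s 0 i' = P i' \<and> ra s 20 i' = Q i' \<and> ra s 2 i' = B i')"], goal_cases)
  case (4 i s')
  then have i: "nv s' 0 = i" "i < N" and low: "low s' = lw" by simp_all
  have n: "\<bar>fst (h i)\<bar> + \<bar>snd (h i)\<bar> \<noteq> 0" using h_ne i by (auto simp: prod_eq_iff)
  have I: "\<forall>i'<i. ra s' 0 i' = P i' \<and> ra s' 20 i' = Q i' \<and> ra s' 2 i' = B i'" using 4(4) by blast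
  show ?case
    using i low n I
    by (simp add: input_simps wp_abs less_Suc_eq P_def[of i] Q_def[of i] B_def[of i])
qed (use assms in \<open>auto simp: normed_def abs_cmd_def\<close>)

lemma slope_correct:
  assumes "normed s"
  shows "wp N (slope_cmd d) (\<lambda>s. \<forall>i<N. ra s 3 i = slope (dir_coeff d P Q) (other_coeff d P Q) i) s"
  unfolding slope_cmd_def Let_def
proof (rule wp_for[where I = "\<lambda>i s. \<forall>i'<i. ra s 3 i' = slope (dir_coeff d P Q) (other_coeff d P Q) i'"], goal_cases)
  case (4 i s')
  then have "normed s'" by (elim normed_frame[OF assms]) simp_all
  then show ?case
    using 4 by (auto simp: normed_coeff slope_def less_Suc_eq)
qed auto

text \<open>Among equal slopes the larger coefficient comes first, so upper lines precede parallel
  lower lines. A lower line listed before an upper one therefore has strictly smaller slope, as the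
  assumption \<open>strict\<close> of \<open>sweep\<close> demands. The index breaks the remaining
  ties.\<close>

definition before :: "nat \<Rightarrow> nat \<Rightarrow> nat \<Rightarrow> bool" where
  "before d i j \<longleftrightarrow> (let m = slope (dir_coeff d P Q) (other_coeff d P Q); V = other_coeff d P Q in
     m i < m j \<or> m i = m j \<and> (V j < V i \<or> V i = V j \<and> i < j))"

definition sorted_order :: "nat \<Rightarrow> (nat \<Rightarrow> nat) \<Rightarrow> bool" where
  "sorted_order d \<pi> \<longleftrightarrow> bij_betw \<pi> {..<N} {..<N} \<and> (\<forall>a c. a < c \<and> c < N \<longrightarrow> before d (\<pi> a) (\<pi> c))"

lemma count_correct:
  assumes s: "normed s" "\<forall>i<N. ra s 3 i = slope (dir_coeff d P Q) (other_coeff d P Q) i"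
    and i: "nv s 0 = i" "i < N"
  shows "wp N (count_cmd d) (\<lambda>s. nv s 7 = rank_of (before d) {..<N} i) s"
proof -
  let ?I = "\<lambda>j s. nv s 7 = card {j'. j' < j \<and> before d j' i}"
  have Suc: "card {j'. j' < Suc j \<and> before d j' i} =
    card {j'. j' < j \<and> before d j' i} + (if before d j i then 1 else 0)" for j
  proof (cases "before d j i")
    case True
    then have "{j'. j' < Suc j \<and> before d j' i} = insert j {j'. j' < j \<and> before d j' i}"
      using less_Suc_eq by blast
    then show ?thesis using True by simp
  next
    case False
    then have "{j'. j' < Suc j \<and> before d j' i} = {j'. j' < j \<and> before d j' i}"
      using less_Suc_eq by blast
    then show ?thesis using False by simp
  qed
  let ?m = "slope (dir_coeff d P Q) (other_coeff d P Q)" and ?V = "other_coeff d P Q"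
  have before_iff: "before d j i \<longleftrightarrow> (if ?m j < ?m i then True else if ?m i < ?m j then False
    else if ?V i < ?V j then True else if ?V j < ?V i then False else j < i)" for j
    unfolding before_def Let_def by auto
  let ?s = "s\<lparr>nv := (nv s)(7 := 0)\<rparr>"
  have n: "normed ?s" using s(1) unfolding normed_def by simp
  show ?thesis
    unfolding count_cmd_def Let_def wp_applied(2,7) nval.simps ndef.simps
  proof (intro conjI, goal_cases)
    case 3
    show ?case
    proof (rule wp_for[where I = ?I], goal_cases)
      case (4 j s')
      have "normed s'" using 4(3) by (elim normed_frame[OF n]) simp_all
      moreover have "nv s' 0 = i" "ra s' 3 = ra s 3"
        using frameD(1)[OF 4(3), of 0] frameD(3)[OF 4(3), of 3] i by simp_all
      ultimately show ?case
        using 4(1,2,4) i s(2) by (simp add: Suc normed_coeff before_iff[of j])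
    next
      case (5 s')
      then show ?case by (simp add: rank_of_def lessThan_def)
    qed simp_all
  qed simp_all
qed

lemma before_irrefl: "\<not> before d i i"
  unfolding before_def by simp

lemma before_trans: "before d i j \<Longrightarrow> before d j k \<Longrightarrow> before d i k"
  unfolding before_def Let_def by auto

lemma before_total: "i \<noteq> j \<Longrightarrow> before d i j \<or> before d j i"
  unfolding before_def Let_def by auto

lemma sort_correct:
  assumes s: "normed s" "\<forall>i<N. ra s 3 i = slope (dir_coeff d P Q) (other_coeff d P Q) i"
  shows "wp N (sort_cmd d) (\<lambda>s. \<exists>\<pi>. sorted_order d \<pi> \<and> (\<forall>k<N. ra s 4 k = real (\<pi> k))) s"
proof -
  let ?r = "rank_of (before d) {..<N}"
  have bij: "bij_betw ?r {..<N} {..<N}"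
    using bij_betw_rank_of[of "{..<N}" "before d"] before_irrefl before_trans before_total by auto
  then have r: "?r i < N" if "i < N" for i using that by (auto simp: bij_betw_def)
  have inj: "?r i = ?r j \<longleftrightarrow> i = j" if "i < N" "j < N" for i j
    using bij that by (auto simp: bij_betw_def inj_on_def)
  \<comment> \<open>Writing \<open>i\<close> into the cell with number \<open>?r i\<close>, for all
    \<open>i\<close>, stores the inverse of the rank.\<close>
  define \<pi> where "\<pi> = the_inv_into {..<N} ?r"
  have \<pi>: "bij_betw \<pi> {..<N} {..<N}" unfolding \<pi>_def by (rule bij_betw_the_inv_into[OF bij])
  have r\<pi>: "?r (\<pi> k) = k" if "k < N" for k
    unfolding \<pi>_def using bij that by (intro f_the_inv_into_f) (auto simp: bij_betw_def)
  have \<pi>N: "\<pi> k < N" if "k < N" for k using \<pi> that by (auto simp: bij_betw_def)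
  have mono: "?r i < ?r j" if "before d i j" "i < N" for i j
    using that before_irrefl before_trans by (intro rank_of_less) auto
  have "before d (\<pi> a) (\<pi> c)" if ac: "a < c" "c < N" for a c
  proof (rule ccontr)
    assume no: "\<not> before d (\<pi> a) (\<pi> c)"
    have a: "?r (\<pi> a) = a" and c: "?r (\<pi> c) = c" using r\<pi> ac by simp_all
    then have "\<pi> a \<noteq> \<pi> c" using ac by auto
    then have "before d (\<pi> c) (\<pi> a)" using before_total no by blast
    then have "c < a" using mono[of "\<pi> c" "\<pi> a"] \<pi>N[OF ac(2)] a c by simp
    then show False using ac by simp
  qed
  then have so: "sorted_order d \<pi>" using \<pi> unfolding sorted_order_def by blast
  have "wp N (sort_cmd d) (\<lambda>s. \<forall>i<N. ra s 4 (?r i) = real i) s"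
    unfolding sort_cmd_def Let_def
  proof (rule wp_for[where I = "\<lambda>i s. \<forall>i'<i. ra s 4 (?r i') = real i'"], goal_cases)
    case (4 i s')
    have n: "normed s'" using 4(3) by (elim normed_frame[OF s(1)]) (simp_all add: count_cmd_def Let_def)
    have m: "ra s' 3 = ra s 3" using frameD(3)[OF 4(3), of 3] by (simp add: count_cmd_def Let_def)
    have "wp N (count_cmd d) (wp N (CNArr 4 (NV 7) (NV 0))
      (\<lambda>s. \<forall>i'<Suc i. ra (s\<lparr>nv := (nv s)(0 := Suc i)\<rparr>) 4 (?r i') = real i')) s'"
    proof (rule wp_cons[OF count_correct[OF n, of d i]], goal_cases)
      case (4 s'')
      have "nv s'' 0 = i" "ra s'' 4 = ra s' 4"
        using frameD(1)[OF 4(2), of 0] frameD(3)[OF 4(2), of 4] \<open>nv s' 0 = i\<close> by (simp_all add: count_cmd_def Let_def)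
      then show ?case using 4(1) \<open>i < 1 * N\<close> \<open>\<forall>i'<i. ra s' 4 (?r i') = real i'\<close>
        by (auto simp: r inj less_Suc_eq)
    qed (use 4 m s(2) in simp_all)
    then show ?case by simp
  qed (auto simp: count_cmd_def Let_def)
  then show ?thesis
    by (rule wp_mono) (use so r\<pi> \<pi>N in metis)
qed

end

section \<open>The sweep as a loop with a fixed trip count\<close>

definition next_cmd :: cmd where "next_cmd = CNat 3 (NPlus (NV 3) (NC 1))"

definition upd_cmd :: cmd where
  "upd_cmd = CIf (NLt (NV 11) (NC 1)) (CReal 2 (RV 3);; CNat 11 (NC 1))
     (CIf (RLt (RV 2) (RV 3)) (CReal 2 (RV 3)) CSkip)"

definition line_expr :: "nat \<Rightarrow> rexp" where
  "line_expr k = RPlus (RMul (RA 3 (NV k)) (RV 3)) (RA 6 (NV k))"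

definition meet_expr :: "nat \<Rightarrow> nat \<Rightarrow> rexp" where
  "meet_expr i j = RDiv (RMinus (RA 6 (NV i)) (RA 6 (NV j))) (RMinus (RA 3 (NV j)) (RA 3 (NV i)))"

definition push_cmd :: cmd where
  "push_cmd = CNArr 7 (NV 5) (NV 8);; CNat 5 (NPlus (NV 5) (NC 1));; next_cmd"

definition pop_cmd :: cmd where
  "pop_cmd = CNat 5 (NMinus (NV 5) (NC 1))"

definition lower_cmd :: cmd where
  "lower_cmd = CIf (NLt (NV 4) (NV 5)) (
     CNat 10 (NA 7 (NMinus (NV 5) (NC 1)));;
     CIf (RLt (RA 3 (NV 10)) (RA 3 (NV 8)))
       (CIf (NLt (NPlus (NV 4) (NC 1)) (NV 5)) (
          CNat 9 (NA 7 (NMinus (NV 5) (NC 2)));;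
          CReal 3 (meet_expr 9 10);;
          CIf (RLt (line_expr 8) (line_expr 10)) push_cmd pop_cmd) push_cmd)
       (CIf (RLt (RA 6 (NV 10)) (RA 6 (NV 8))) pop_cmd next_cmd)) push_cmd"

definition upper_cmd :: cmd where
  "upper_cmd = CIf (NLt (NV 4) (NV 5)) (
     CNat 9 (NA 7 (NV 4));;
     CReal 3 (meet_expr 9 8);;
     upd_cmd;;
     CIf (NLt (NPlus (NV 4) (NC 1)) (NV 5)) (
       CNat 10 (NA 7 (NPlus (NV 4) (NC 1)));;
       CIf (RLt (line_expr 10) (line_expr 9)) next_cmd (CNat 4 (NPlus (NV 4) (NC 1)))) next_cmd) next_cmd"

definition vertical_cmd :: cmd where
  "vertical_cmd = CReal 3 (RA 6 (NV 8));; upd_cmd;; next_cmd"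

text \<open>One step performs a single deque operation or finishes a line. Dissolving the inner
  while loops in this way keeps two nested loops over the points and the steps, and a step after the
  end of the list is idle.\<close>

definition step_cmd :: cmd where
  "step_cmd = CIf (NLt (NV 3) NN) (
     CNat 8 (NA 4 (NV 3));;
     CIf (RLt (RA 5 (NV 8)) (RC 1)) next_cmd
     (CIf (RLt (RA 5 (NV 8)) (RC 2)) lower_cmd
     (CIf (RLt (RA 5 (NV 8)) (RC 3)) upper_cmd vertical_cmd))) CSkip"

definition sweep_cmd :: cmd where
  "sweep_cmd = CNat 3 (NC 0);; CNat 4 (NC 0);; CNat 5 (NC 0);; CNat 11 (NC 0);; CFor 6 2 step_cmd"

lemma wp_upd:
  assumes "nv s 11 \<le> 1"
  shows "wp N upd_cmd post s \<longleftrightarrow>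
    post (s\<lparr>rv := (rv s)(2 := raise_max (nv s 11) (rv s 2) (rv s 3)), nv := (nv s)(11 := 1)\<rparr>)"
proof (cases "nv s 11 = 0")
  case True
  then show ?thesis by (simp add: upd_cmd_def raise_max_def)
next
  case False
  then have h: "nv s 11 = 1" using assms by simp
  then have "(nv s)(11 := 1) = nv s" by auto
  moreover have "(rv s)(2 := rv s 2) = rv s" by simp
  ultimately show ?thesis using h by (cases s) (auto simp: upd_cmd_def max_def raise_max_def)
qed

context sweep
begin

definition static :: "store \<Rightarrow> bool" where
  "static s \<longleftrightarrow> (\<forall>k<N. \<pi> k < N \<and> ra s 4 k = real (\<pi> k)) \<and>
     (\<forall>i<N. ra s 3 i = m i \<and> ra s 5 i = real (kd i) \<and> ra s 6 i = b i \<and> kd i \<le> 3)"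

text \<open>
  Amortisation: an unprocessed line weighs 2 and a deque entry 1, and every step lowers the total
  weight.
\<close>
definition loop_inv :: "nat \<Rightarrow> store \<Rightarrow> bool" where
  "loop_inv c s \<longleftrightarrow> static s \<and> (\<exists>D. (\<forall>k. nv s 4 \<le> k \<and> k < nv s 5 \<longrightarrow> ra s 7 k = real (D k)) \<and>
     sweep_inv (nv s 3) (nv s 4) (nv s 5) D (nv s 11) (rv s 2)) \<and>
     (nv s 3 < N \<longrightarrow> 2 * (N - nv s 3) + (nv s 5 - nv s 4) + c \<le> 2 * N)"

lemma loop_invI:
  assumes "static s" "sweep_inv (nv s 3) (nv s 4) (nv s 5) D (nv s 11) (rv s 2)"
    "\<And>k. nv s 4 \<le> k \<Longrightarrow> k < nv s 5 \<Longrightarrow> ra s 7 k = real (D k)"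
    "nv s 3 < N \<Longrightarrow> 2 * (N - nv s 3) + (nv s 5 - nv s 4) + c \<le> 2 * N"
  shows "loop_inv c s"
  using assms unfolding loop_inv_def by blast

context
  fixes s :: store and c :: nat and D :: "nat \<Rightarrow> nat"
  assumes st: "static s"
    and inv: "sweep_inv (nv s 3) (nv s 4) (nv s 5) D (nv s 11) (rv s 2)"
    and deq: "\<And>k. nv s 4 \<le> k \<Longrightarrow> k < nv s 5 \<Longrightarrow> ra s 7 k = real (D k)"
    and fuel: "2 * (N - nv s 3) + (nv s 5 - nv s 4) + c \<le> 2 * N"
    and pos: "nv s 3 < N" and cur: "nv s 8 = \<pi> (nv s 3)"
begin

lemma cur_less: "\<pi> (nv s 3) < N" using st pos unfolding static_def by blast

lemma deque_less: "nv s 4 \<le> k \<Longrightarrow> k < nv s 5 \<Longrightarrow> D k < N"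
  using invD(4)[OF inv, of k] invD(3)[OF inv] st unfolding static_def by fastforce

lemma deque_limits: "nv s 4 \<le> nv s 5" "nv s 5 \<le> nv s 3"
  using invD(1,2)[OF inv] .

lemma static_at: "i < N \<Longrightarrow> ra s 3 i = m i" "i < N \<Longrightarrow> ra s 6 i = b i"
  using st unfolding static_def by blast+

lemma presence: "nv s 11 \<le> 1"
  using invD(8)[OF inv] unfolding bound_ok_def by (auto split: if_splits)

lemma skip_loop_inv:
  assumes "sweep_inv (Suc (nv s 3)) (nv s 4) (nv s 5) D (nv s 11) (rv s 2)"
    and "nv s' 3 = Suc (nv s 3)" "nv s' 4 = nv s 4" "nv s' 5 = nv s 5" "nv s' 11 = nv s 11" "rv s' 2 = rv s 2"
      "ra s' = ra s"
  shows "loop_inv (Suc c) s'"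
proof (rule loop_invI[where D = D])
  show "static s'" using st assms unfolding static_def by simp
qed (use assms deq fuel pos in auto)

lemma skip_correct:
  assumes "kd (\<pi> (nv s 3)) = 0"
  shows "wp N next_cmd (loop_inv (Suc c)) s"
proof -
  have I: "sweep_inv (Suc (nv s 3)) (nv s 4) (nv s 5) D (nv s 11) (rv s 2)"
    using inv_skip[OF inv pos] assms by simp
  show ?thesis unfolding next_cmd_def by simp (rule skip_loop_inv[OF I]; simp)
qed

lemma vertical_correct:
  assumes k: "kd (\<pi> (nv s 3)) = 3"
  shows "wp N vertical_cmd (loop_inv (Suc c)) s"
proof -
  have "sweep_inv (Suc (nv s 3)) (nv s 4) (nv s 5) D 1 (raise_max (nv s 11) (rv s 2) (b (\<pi> (nv s 3))))"
    using inv_vertical[OF inv pos k] .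
  then show ?thesis
    unfolding vertical_cmd_def next_cmd_def
    using cur cur_less static_at presence
    apply (simp add: wp_upd)
    apply (rule loop_invI[where D = D])
    using st deq fuel pos by (auto simp: static_def)
qed

lemma upper_correct:
  assumes k: "kd (\<pi> (nv s 3)) = 2"
  shows "wp N upper_cmd (loop_inv (Suc c)) s"
proof (cases "nv s 4 < nv s 5")
  case False
  then have "sweep_inv (Suc (nv s 3)) (nv s 4) (nv s 5) D (nv s 11) (rv s 2)"
    using inv_upper_empty[OF inv pos k] by simp
  then show ?thesis
    unfolding upper_cmd_def next_cmd_def
    using False
    apply simp
    apply (rule loop_invI[where D = D])
    using st deq fuel pos by (auto simp: static_def)
next
  case True
  let ?j = "\<pi> (nv s 3)" and ?p = "nv s 4" and ?q = "nv s 5"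
  let ?\<tau> = "meet (D ?p) ?j"
  have lt: "m (D ?p) < m ?j" using deque_below(1)[OF inv pos k, of ?p] True by simp
  have p: "D ?p < N" "ra s 7 ?p = real (D ?p)" using deque_less deq True by auto
  have pN: "?p < N" using True deque_limits pos by simp
  have tau: "(b (D ?p) - b ?j) / (m ?j - m (D ?p)) = ?\<tau>" unfolding meet_def ..
  show ?thesis
  proof (cases "?p + 1 < ?q")
    case False
    have "sweep_inv (Suc (nv s 3)) ?p ?q D 1 (raise_max (nv s 11) (rv s 2) ?\<tau>)"
      using inv_upper_finish[OF inv pos k True] False by blast
    then show ?thesis
      unfolding upper_cmd_def next_cmd_def meet_expr_def
      using True False cur cur_less static_at presence p lt pN
      apply (simp add: wp_upd tau)
      apply (rule loop_invI[where D = D])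
      using st deq fuel pos by (auto simp: static_def)
  next
    case q: True
    have p': "D (Suc ?p) < N" "ra s 7 (Suc ?p) = real (D (Suc ?p))" "Suc ?p < N"
      using deque_less[of "Suc ?p"] deq[of "Suc ?p"] q deque_limits pos by auto
    show ?thesis
    proof (cases "line (D (?p + 1)) ?\<tau> < line (D ?p) ?\<tau>")
      case less: True
      then have "sweep_inv (Suc (nv s 3)) ?p ?q D 1 (raise_max (nv s 11) (rv s 2) ?\<tau>)"
        using inv_upper_finish[OF inv pos k True] by simp
      then show ?thesis
        unfolding upper_cmd_def next_cmd_def meet_expr_def line_expr_def
        using True q cur cur_less static_at presence p p' lt pN less[unfolded line_def]
        apply (simp add: wp_upd tau)
        apply (rule loop_invI[where D = D])
        using st deq fuel pos by (auto simp: static_def)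
    next
      case less: False
      then have "sweep_inv (nv s 3) (?p + 1) ?q D 1 (raise_max (nv s 11) (rv s 2) ?\<tau>)"
        using inv_upper_advance[OF inv pos k q] by simp
      then show ?thesis
        unfolding upper_cmd_def next_cmd_def meet_expr_def line_expr_def
        using True q cur cur_less static_at presence p p' lt pN less[unfolded line_def]
        apply (simp add: wp_upd tau)
        apply (rule loop_invI[where D = D])
        using st deq fuel pos by (auto simp: static_def)
    qed
  qed
qed

lemma push_inv:
  assumes k: "kd (\<pi> (nv s 3)) = 1"
    and "nv s 4 < nv s 5 \<Longrightarrow> m (D (nv s 5 - 1)) < m (\<pi> (nv s 3))"
    and "nv s 4 + 1 < nv s 5 \<Longrightarrow> line (\<pi> (nv s 3)) (meet (D (nv s 5 - 2)) (D (nv s 5 - 1))) \<le>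
       line (D (nv s 5 - 1)) (meet (D (nv s 5 - 2)) (D (nv s 5 - 1)))"
  shows "sweep_inv (Suc (nv s 3)) (nv s 4) (Suc (nv s 5)) (D(nv s 5 := \<pi> (nv s 3))) (nv s 11) (rv s 2)"
  using inv_lower_push[OF inv pos k assms(2,3)] .

lemma push_loop_inv:
  assumes "sweep_inv (Suc (nv s 3)) (nv s 4) (Suc (nv s 5)) (D(nv s 5 := \<pi> (nv s 3))) (nv s 11) (rv s 2)"
    and "nv s' 3 = Suc (nv s 3)" "nv s' 4 = nv s 4" "nv s' 5 = Suc (nv s 5)" "nv s' 11 = nv s 11" "rv s' 2 = rv s 2"
      "ra s' = (ra s)(7 := (ra s 7)(nv s 5 := real (\<pi> (nv s 3))))"
  shows "loop_inv (Suc c) s'"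
proof (rule loop_invI[where D = "D(nv s 5 := \<pi> (nv s 3))"])
  show "static s'" using st assms unfolding static_def by simp
  show "sweep_inv (nv s' 3) (nv s' 4) (nv s' 5) (D(nv s 5 := \<pi> (nv s 3))) (nv s' 11) (rv s' 2)"
    using assms by simp
  show "ra s' 7 k = real ((D(nv s 5 := \<pi> (nv s 3))) k)" if "nv s' 4 \<le> k" "k < nv s' 5" for k
    using that assms deq[of k] by (auto simp: less_Suc_eq)
  show "2 * (N - nv s' 3) + (nv s' 5 - nv s' 4) + Suc c \<le> 2 * N"
    using fuel assms pos deque_limits by simp
qed

lemma pop_loop_inv:
  assumes "sweep_inv (nv s 3) (nv s 4) (nv s 5 - 1) D (nv s 11) (rv s 2)" "nv s 4 < nv s 5"
    and "nv s' 3 = nv s 3" "nv s' 4 = nv s 4" "nv s' 5 = nv s 5 - 1" "nv s' 11 = nv s 11" "rv s' 2 = rv s 2"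
      "ra s' = ra s"
  shows "loop_inv (Suc c) s'"
proof (rule loop_invI[where D = D])
  show "static s'" using st assms unfolding static_def by simp
qed (use assms deq fuel in auto)

lemma lower_correct:
  assumes k: "kd (\<pi> (nv s 3)) = 1"
  shows "wp N lower_cmd (loop_inv (Suc c)) s"
proof -
  let ?i = "\<pi> (nv s 3)" and ?p = "nv s 4" and ?q = "nv s 5"
  have qN: "?q < N" using deque_limits pos by simp
  note defs = lower_cmd_def push_cmd_def pop_cmd_def next_cmd_def meet_expr_def line_expr_def
  note facts = qN cur cur_less static_at
  show ?thesis
  proof (cases "?p < ?q")
    case False
    then have I: "sweep_inv (Suc (nv s 3)) ?p (Suc ?q) (D(?q := ?i)) (nv s 11) (rv s 2)"
      by (intro push_inv[OF k]) auto
    show ?thesis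
      unfolding defs by (simp add: facts False) (rule push_loop_inv[OF I]; simp)
  next
    case True
    let ?t = "D (?q - Suc 0)"
    have t: "?t < N" "ra s 7 (?q - Suc 0) = real ?t" "?q - Suc 0 < N" "Suc 0 \<le> ?q"
      using deque_less[of "?q - 1"] deq[of "?q - 1"] True qN by auto
    show ?thesis
    proof (cases "m ?t < m ?i")
      case less: True
      show ?thesis
      proof (cases "Suc ?p < ?q")
        case False
        then have I: "sweep_inv (Suc (nv s 3)) ?p (Suc ?q) (D(?q := ?i)) (nv s 11) (rv s 2)"
          using less by (intro push_inv[OF k]) auto
        show ?thesis
          unfolding defs by (simp add: facts True False less t) (rule push_loop_inv[OF I]; simp)
      next
        case q: True
        let ?u = "D (?q - 2)"
        let ?\<tau> = "meet ?u ?t"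
        have u: "?u < N" "ra s 7 (?q - 2) = real ?u" "?q - 2 < N" "2 \<le> ?q"
          using deque_less[of "?q - 2"] deq[of "?q - 2"] q qN by auto
        have "m ?u < m ?t"
          using invD(5)[OF inv, of "?q - 2"] q by (simp add: numeral_2_eq_2 Suc_diff_Suc)
        then have ut: "m ?t \<noteq> m ?u" by simp
        have tau: "(b ?u - b ?t) / (m ?t - m ?u) = ?\<tau>" unfolding meet_def by simp
        show ?thesis
        proof (cases "line ?i ?\<tau> < line ?t ?\<tau>")
          case less': True
          then have I: "sweep_inv (Suc (nv s 3)) ?p (Suc ?q) (D(?q := ?i)) (nv s 11) (rv s 2)"
            using less by (intro push_inv[OF k]) auto
          show ?thesis
            unfolding defs
            by (simp add: facts True less q t u ut tau less'[unfolded line_def]) (rule push_loop_inv[OF I]; simp)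
        next
          case less': False
          then have I: "sweep_inv (nv s 3) ?p (?q - 1) D (nv s 11) (rv s 2)"
            using q by (intro inv_lower_pop_hidden[OF inv pos k]) auto
          show ?thesis
            unfolding defs
            by (simp add: facts True less q t u ut tau less'[unfolded line_def]) (rule pop_loop_inv[OF I True]; simp)
        qed
      qed
    next
      case False
      then have eq: "m ?t = m ?i" using top_slope_le[OF inv pos True] by simp
      show ?thesis
      proof (cases "b ?t < b ?i")
        case less': True
        then have I: "sweep_inv (nv s 3) ?p (?q - 1) D (nv s 11) (rv s 2)"
          using True eq by (intro inv_lower_pop_equal[OF inv pos k]) auto
        show ?thesis
          unfolding defs by (simp add: facts True eq t less') (rule pop_loop_inv[OF I True]; simp)
      next
        case less': False
        then have I: "sweep_inv (Suc (nv s 3)) ?p ?q D (nv s 11) (rv s 2)"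
          using True eq by (intro inv_lower_skip[OF inv pos k]) auto
        show ?thesis
          unfolding defs by (simp add: facts True eq t less') (rule skip_loop_inv[OF I]; simp)
      qed
    qed
  qed
qed

end

lemma step_correct:
  assumes "loop_inv c s"
  shows "wp N step_cmd (loop_inv (Suc c)) s"
proof (cases "nv s 3 < N")
  case False
  then show ?thesis using assms unfolding step_cmd_def loop_inv_def by simp
next
  case True
  obtain D where D: "\<forall>k. nv s 4 \<le> k \<and> k < nv s 5 \<longrightarrow> ra s 7 k = real (D k)"
    "sweep_inv (nv s 3) (nv s 4) (nv s 5) D (nv s 11) (rv s 2)"
    using assms unfolding loop_inv_def by blast
  have st: "static s" and fuel: "2 * (N - nv s 3) + (nv s 5 - nv s 4) + c \<le> 2 * N"
    using assms True unfolding loop_inv_def by blast+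
  let ?i = "\<pi> (nv s 3)"
  have i: "?i < N" "ra s 4 (nv s 3) = real ?i" "ra s 5 ?i = real (kd ?i)" "kd ?i \<le> 3"
    using st True unfolding static_def by blast+
  let ?s = "s\<lparr>nv := (nv s)(8 := ?i)\<rparr>"
  have st': "static ?s" using st unfolding static_def by simp
  have pre: "sweep_inv (nv ?s 3) (nv ?s 4) (nv ?s 5) D (nv ?s 11) (rv ?s 2)"
    "\<And>k. nv ?s 4 \<le> k \<Longrightarrow> k < nv ?s 5 \<Longrightarrow> ra ?s 7 k = real (D k)"
    "2 * (N - nv ?s 3) + (nv ?s 5 - nv ?s 4) + c \<le> 2 * N" "nv ?s 3 < N" "nv ?s 8 = \<pi> (nv ?s 3)"
    using D fuel True by simp_all
  note correct = skip_correct[OF st' pre] vertical_correct[OF st' pre] upper_correct[OF st' pre] lower_correct[OF st' pre]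
  consider "kd ?i = 0" | "kd ?i = 1" | "kd ?i = 2" | "kd ?i = 3" using i(4) by linarith
  then show ?thesis
    using correct i True by cases (simp_all add: step_cmd_def)
qed

lemma sweep_correct:
  assumes "static s"
  shows "wp N sweep_cmd (\<lambda>s. is_max (nv s 11) (rv s 2) (bounds N)) s"
proof -
  let ?s = "s\<lparr>nv := (nv s)(3 := 0, 4 := 0, 5 := 0, 11 := 0)\<rparr>"
  have "wp N (CFor 6 2 step_cmd) (\<lambda>s. is_max (nv s 11) (rv s 2) (bounds N)) ?s"
  proof (rule wp_for[where I = loop_inv], goal_cases)
    case 2
    show ?case
      by (simp add: step_cmd_def lower_cmd_def upper_cmd_def vertical_cmd_def push_cmd_def pop_cmd_def next_cmd_def upd_cmd_def)
  next
    case 3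
    show ?case
      using assms inv_init by (intro loop_invI) (auto simp: static_def)
  next
    case (4 c s')
    show ?case
    proof (rule wp_mono[OF step_correct[OF 4(4)]])
      fix s'' assume "loop_inv (Suc c) s''"
      then show "loop_inv (Suc c) (s''\<lparr>nv := (nv s'')(6 := Suc c)\<rparr>)"
        unfolding loop_inv_def static_def by simp
    qed
  next
    case (5 s')
    then obtain D where D: "sweep_inv (nv s' 3) (nv s' 4) (nv s' 5) D (nv s' 11) (rv s' 2)"
      unfolding loop_inv_def by blast
    \<comment> \<open>After \<open>2 * N\<close> steps the whole budget is spent, which leaves no
      weight for an unprocessed line.\<close>
    have "\<not> nv s' 3 < N" using 5(1) unfolding loop_inv_def by auto
    then have "nv s' 3 = N" using invD(3)[OF D] by simp
    then show ?case using inv_done D by metis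
  qed simp
  then show ?thesis unfolding sweep_cmd_def by simp
qed

end

section \<open>Bounding boxes and their intersections\<close>

definition min_cmd :: "nat \<Rightarrow> cmd" where
  "min_cmd d = CFor 2 1 (kind_cmd d;; sweep_cmd;; CArr 8 (NV 2) (RV 2);; CNArr 9 (NV 2) (NV 11))"

definition box_row_cmd :: cmd where
  "box_row_cmd = CNat 11 (NC 0);; CFor 13 1 (
     CReal 0 rho_at;;
     CIf (RLt (RV 0) (RC 0)) CSkip
     (CIf (RLt (RA 9 (NV 13)) (RC 1)) CSkip
     (CReal 3 (RMinus (RA 8 (NV 13)) (RMul lambda (RV 0)));; upd_cmd)))"

definition box_cmd :: "nat \<Rightarrow> cmd" where
  "box_cmd d = CFor 2 1 (box_row_cmd;; CArr (10 + d) (NV 2) (RV 2);; CNArr (14 + d) (NV 2) (NV 11))"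

definition dir_cmd :: "nat \<Rightarrow> cmd" where
  "dir_cmd d = slope_cmd d;; sort_cmd d;; min_cmd d;; box_cmd d"

lemmas sweep_defs = sweep_cmd_def step_cmd_def lower_cmd_def upper_cmd_def vertical_cmd_def push_cmd_def
  pop_cmd_def next_cmd_def upd_cmd_def

lemmas dir_defs = dir_cmd_def slope_cmd_def sort_cmd_def count_cmd_def min_cmd_def box_cmd_def box_row_cmd_def
  kind_cmd_def sweep_defs Let_def

definition flagged_max :: "store \<Rightarrow> nat \<Rightarrow> nat \<Rightarrow> nat \<Rightarrow> real set \<Rightarrow> bool" where
  "flagged_max s a h x S \<longleftrightarrow> (\<exists>k. ra s h x = real k \<and> is_max k (ra s a x) S)"

context program_data
begin

definition kind :: "nat \<Rightarrow> nat \<Rightarrow> nat \<Rightarrow> nat" where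
  "kind d x i = (if \<rho> x i = top then 0 else if other_coeff d P Q i < 0 then 1
     else if 0 < other_coeff d P Q i then 2 else if dir_coeff d P Q i < 0 then 3 else 0)"

definition icept :: "nat \<Rightarrow> nat \<Rightarrow> nat \<Rightarrow> real" where
  "icept d x i = (if \<rho> x i = top then 0
     else if other_coeff d P Q i \<noteq> 0 then (W x i - B i) / other_coeff d P Q i
     else if dir_coeff d P Q i < 0 then (W x i - B i) / dir_coeff d P Q i else 0)"

abbreviation slopes :: "nat \<Rightarrow> nat \<Rightarrow> real" where
  "slopes d \<equiv> slope (dir_coeff d P Q) (other_coeff d P Q)"

lemma kind_correct:
  assumes "normed s" "nv s 2 = x" "x < N"
  shows "wp N (kind_cmd d) (\<lambda>s. \<forall>i<N. ra s 5 i = real (kind d x i) \<and> ra s 6 i = icept d x i) s"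
  unfolding kind_cmd_def
proof (rule wp_for[where I = "\<lambda>i s. \<forall>i'<i. ra s 5 i' = real (kind d x i') \<and> ra s 6 i' = icept d x i'"], goal_cases)
  case (4 i s')
  have n: "normed s'" using 4(3) by (elim normed_frame[OF assms(1)]) simp_all
  have x: "nv s' 2 = x" using frameD(1)[OF 4(3), of 2] assms(2) by simp
  have i: "i < N" "nv s' 13 = i" using 4 by simp_all
  have low: "low s' = lw" using normedD(1)[OF n] .
  show ?case
    using 4(4) i x low n lw_neg_iff[OF assms(3) i(1)] lw_scaled[OF assms(3) i(1)] normedD(4)[OF n i(1)] assms(3)
    by (simp add: rho_at_simps lambda_simps normed_coeff less_Suc_eq kind_def icept_def)
qed auto

lemma sweep_sorted:
  assumes "sorted_order d \<pi>"
  shows "sweep N (slopes d) (kind d x) \<pi>"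
proof
  fix a c assume ac: "a < c" "c < N"
  then have b: "before d (\<pi> a) (\<pi> c)" using assms unfolding sorted_order_def by blast
  then show "slopes d (\<pi> a) \<le> slopes d (\<pi> c)" unfolding before_def Let_def by auto
  assume "kind d x (\<pi> a) = 1" "kind d x (\<pi> c) = 2"
  then have "other_coeff d P Q (\<pi> a) < 0" "0 < other_coeff d P Q (\<pi> c)"
    unfolding kind_def by (auto split: if_splits)
  then show "slopes d (\<pi> a) < slopes d (\<pi> c)" using b unfolding before_def Let_def by auto
qed

text \<open>The enumeration \<open>\<pi>\<close> runs through all indices, and comparing slopes is
  the same as comparing positions for a lower and an upper line: one direction is
  \<open>strict\<close>, the other follows from \<open>sorted\<close>.\<close>

lemma bounds_eq:
  assumes so: "sorted_order d \<pi>"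
  shows "sweep.bounds (slopes d) (icept d x) (kind d x) \<pi> N =
    dir_roots d {y \<in> {..<N}. \<rho> x y \<noteq> top} P Q (\<lambda>y. W x y - B y)"
proof -
  interpret sw: sweep N "slopes d" "icept d x" "kind d x" \<pi> by (rule sweep_sorted[OF so])
  let ?U = "dir_coeff d P Q" and ?V = "other_coeff d P Q" and ?c = "\<lambda>y. W x y - B y"
  have pi: "\<pi> a < N" if "a < N" for a
    using so that unfolding sorted_order_def bij_betw_def by auto
  have ex: "\<exists>a<N. i = \<pi> a" if "i < N" for i
    using so that unfolding sorted_order_def bij_betw_def by (metis imageE lessThan_iff)
  have k1: "kind d x i = 1 \<longleftrightarrow> \<rho> x i \<noteq> top \<and> ?V i < 0" for i by (simp add: kind_def)
  have k2: "kind d x i = 2 \<longleftrightarrow> \<rho> x i \<noteq> top \<and> 0 < ?V i" for i by (simp add: kind_def)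
  have k3: "kind d x i = 3 \<longleftrightarrow> \<rho> x i \<noteq> top \<and> ?V i = 0 \<and> ?U i < 0" for i by (auto simp: kind_def)
  have i12: "icept d x i = ?c i / ?V i" if "kind d x i = 1 \<or> kind d x i = 2" for i
    using that unfolding k1 k2 by (auto simp: icept_def)
  have i3: "icept d x i = ?c i / ?U i" if "kind d x i = 3" for i
    using that unfolding k3 by (auto simp: icept_def)
  have "{icept d x (\<pi> a) | a. a < N \<and> kind d x (\<pi> a) = 3} =
    {?c i / ?U i | i. i \<in> {y \<in> {..<N}. \<rho> x y \<noteq> top} \<and> ?V i = 0 \<and> ?U i < 0}" (is "?L1 = ?R1")
  proof (intro set_eqI iffI)
    fix r assume "r \<in> ?L1"
    then obtain a where a: "a < N" "kind d x (\<pi> a) = 3" "r = icept d x (\<pi> a)" by blast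
    then show "r \<in> ?R1" using pi[OF a(1)] a(2)[unfolded k3] i3[OF a(2)] by auto
  next
    fix r assume "r \<in> ?R1"
    then obtain i where i: "i < N" "\<rho> x i \<noteq> top" "?V i = 0" "?U i < 0" "r = ?c i / ?U i" by blast
    obtain a where a: "a < N" "i = \<pi> a" using ex[OF i(1)] by blast
    have "kind d x (\<pi> a) = 3" using i a k3 by blast
    moreover from this have "r = icept d x (\<pi> a)" using i3[of "\<pi> a"] i(5) a(2) by simp
    ultimately show "r \<in> ?L1" using a(1) by blast
  qed
  moreover have "{sw.meet (\<pi> a) (\<pi> c) | a c. a < c \<and> c < N \<and> kind d x (\<pi> a) = 1 \<and> kind d x (\<pi> c) = 2} =
    {(?c i / ?V i - ?c j / ?V j) / (slopes d j - slopes d i) | i j. i \<in> {y \<in> {..<N}. \<rho> x y \<noteq> top} \<and>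
        j \<in> {y \<in> {..<N}. \<rho> x y \<noteq> top} \<and> ?V i < 0 \<and> 0 < ?V j \<and> slopes d i < slopes d j}" (is "?L2 = ?R2")
  proof (intro set_eqI iffI)
    fix r assume "r \<in> ?L2"
    then obtain a c where a: "a < c" "c < N" "kind d x (\<pi> a) = 1" "kind d x (\<pi> c) = 2"
      "r = sw.meet (\<pi> a) (\<pi> c)" by blast
    have "slopes d (\<pi> a) < slopes d (\<pi> c)" using sw.strict[OF a(1-4)] .
    moreover have "\<pi> a < N" "\<pi> c < N" using pi a by auto
    moreover have "r = (?c (\<pi> a) / ?V (\<pi> a) - ?c (\<pi> c) / ?V (\<pi> c)) / (slopes d (\<pi> c) - slopes d (\<pi> a))"
      unfolding a(5) sw.meet_def using i12 a(3,4) by simp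
    ultimately show "r \<in> ?R2" using a(3,4)[unfolded k1 k2] by blast
  next
    fix r assume "r \<in> ?R2"
    then obtain i j where ij: "i < N" "\<rho> x i \<noteq> top" "?V i < 0" "j < N" "\<rho> x j \<noteq> top" "0 < ?V j"
      "slopes d i < slopes d j" "r = (?c i / ?V i - ?c j / ?V j) / (slopes d j - slopes d i)" by blast
    obtain a c where ac: "a < N" "i = \<pi> a" "c < N" "j = \<pi> c" using ex ij(1,4) by blast
    have "a < c"
    proof (rule ccontr)
      assume "\<not> a < c"
      then have "slopes d (\<pi> c) \<le> slopes d (\<pi> a)" using sw.sorted[of c a] ac by (cases "a = c") auto
      then show False using ij(7) ac by simp
    qed
    moreover have k: "kind d x (\<pi> a) = 1" "kind d x (\<pi> c) = 2" using ij ac k1 k2 by blast+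
    moreover have "r = sw.meet (\<pi> a) (\<pi> c)"
      unfolding ij(8) sw.meet_def using i12 k ac by simp
    ultimately show "r \<in> ?L2" using ac by blast
  qed
  ultimately show ?thesis
    unfolding sw.bounds_def dir_roots_def roots_def by simp
qed

text \<open>The result concerns the roots alone, so it holds for empty polygons as well; its reading
  as a minimum over the polygon is postponed to \<open>box_bounds_eq_lower_bounds\<close>.\<close>

lemma min_correct:
  assumes s: "normed s" "\<forall>i<N. ra s 3 i = slopes d i"
    and so: "sorted_order d \<pi>" "\<forall>k<N. ra s 4 k = real (\<pi> k)"
  shows "wp N (min_cmd d) (\<lambda>s. \<forall>x<N. flagged_max s 8 9 x
    (dir_roots d {y \<in> {..<N}. \<rho> x y \<noteq> top} P Q (\<lambda>y. W x y - B y))) s"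
  unfolding min_cmd_def
proof (rule wp_for[where I = "\<lambda>x s. \<forall>x'<x. flagged_max s 8 9 x'
    (dir_roots d {y \<in> {..<N}. \<rho> x' y \<noteq> top} P Q (\<lambda>y. W x' y - B y))"], goal_cases)
  case (4 x s')
  interpret sw: sweep N "slopes d" "icept d x" "kind d x" \<pi> by (rule sweep_sorted[OF so(1)])
  note fr = frameD[OF 4(3)]
  have n: "normed s'" using 4(3) by (elim normed_frame[OF s(1)]) (simp_all add: kind_cmd_def sweep_defs)
  have x: "x < N" "nv s' 2 = x" using 4 by simp_all
  have arr: "ra s' 3 = ra s 3" "ra s' 4 = ra s 4"
    using fr(3)[of 3] fr(3)[of 4] by (simp_all add: kind_cmd_def sweep_defs)
  have pi: "\<pi> k < N" if "k < N" for k
    using so(1) that unfolding sorted_order_def bij_betw_def by auto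
  show ?case
    unfolding wp_applied(7)
  proof (rule wp_cons[OF kind_correct[OF n x(2,1), of d]])
    fix s1 assume s1: "\<forall>i<N. ra s1 5 i = real (kind d x i) \<and> ra s1 6 i = icept d x i" "frame (kind_cmd d) s' s1"
    note fr1 = frameD[OF s1(2)]
    have "sw.static s1"
      unfolding sw.static_def
      using s1(1) fr1(3)[of 3] fr1(3)[of 4] arr s(2) so(2) pi
      by (auto simp: kind_cmd_def) (simp add: kind_def)
    from sw.sweep_correct[OF this]
    show "wp N sweep_cmd (wp N (CArr 8 (NV 2) (RV 2)) (wp N (CNArr 9 (NV 2) (NV 11)) (\<lambda>s''. \<forall>x'<Suc x.
       flagged_max (s''\<lparr>nv := (nv s'')(2 := Suc x)\<rparr>) 8 9 x'
         (dir_roots d {y \<in> {..<N}. \<rho> x' y \<noteq> top} P Q (\<lambda>y. W x' y - B y))))) s1"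
    proof (rule wp_cons)
      fix s2 assume s2: "is_max (nv s2 11) (rv s2 2) (sw.bounds N)" "frame sweep_cmd s1 s2"
      note fr2 = frameD[OF s2(2)]
      have "nv s2 2 = x" "ra s2 8 = ra s' 8" "ra s2 9 = ra s' 9"
        using fr2(1)[of 2] fr2(3)[of 8] fr2(3)[of 9] fr1(1)[of 2] fr1(3)[of 8] fr1(3)[of 9] x(2)
        by (simp_all add: kind_cmd_def sweep_defs)
      then show "wp N (CArr 8 (NV 2) (RV 2)) (wp N (CNArr 9 (NV 2) (NV 11)) (\<lambda>s''. \<forall>x'<Suc x.
         flagged_max (s''\<lparr>nv := (nv s'')(2 := Suc x)\<rparr>) 8 9 x'
         (dir_roots d {y \<in> {..<N}. \<rho> x' y \<noteq> top} P Q (\<lambda>y. W x' y - B y)))) s2"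
        using s2(1) 4(4) x unfolding bounds_eq[OF so(1)]
        by (auto simp: flagged_max_def less_Suc_eq)
    qed
  qed
qed (auto simp: kind_cmd_def sweep_defs)

definition box_bounds :: "store \<Rightarrow> nat \<Rightarrow> nat \<Rightarrow> real set" where
  "box_bounds s n x = {ra s 8 y - W x y | y. y < n \<and> \<rho> x y \<noteq> top \<and> ra s 9 y = 1}"

lemma box_row_correct:
  assumes s: "normed s" "\<forall>y<N. \<exists>k\<le>1. ra s 9 y = real k" and x: "nv s 2 = x" "x < N"
  shows "wp N box_row_cmd (\<lambda>s'. is_max (nv s' 11) (rv s' 2) (box_bounds s N x)) s"
proof -
  let ?s = "s\<lparr>nv := (nv s)(11 := 0)\<rparr>"
  have n0: "normed ?s" using s(1) unfolding normed_def by simp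
  have "wp N (CFor 13 1 (
     CReal 0 rho_at;;
     CIf (RLt (RV 0) (RC 0)) CSkip
     (CIf (RLt (RA 9 (NV 13)) (RC 1)) CSkip
     (CReal 3 (RMinus (RA 8 (NV 13)) (RMul lambda (RV 0)));; upd_cmd))))
     (\<lambda>s'. is_max (nv s' 11) (rv s' 2) (box_bounds s N x)) ?s"
  proof (rule wp_for[where I = "\<lambda>y s'. is_max (nv s' 11) (rv s' 2) (box_bounds s y x)"], goal_cases)
    case 3
    then show ?case by (simp add: is_max_def box_bounds_def)
  next
    case (4 y s')
    have n: "normed s'" using 4(3) by (elim normed_frame[OF n0]) (simp_all add: upd_cmd_def)
    have y: "y < N" "nv s' 13 = y" using 4 by simp_all
    have fr: "nv s' 2 = x" "ra s' 8 = ra s 8" "ra s' 9 = ra s 9"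
      using frameD(1)[OF 4(3), of 2] frameD(3)[OF 4(3), of 8] frameD(3)[OF 4(3), of 9] x
      by (simp_all add: upd_cmd_def)
    have h: "nv s' 11 \<le> 1" using 4(4) unfolding is_max_def by auto
    have Suc: "box_bounds s (Suc y) x = (if \<rho> x y \<noteq> top \<and> ra s 9 y = 1
      then insert (ra s 8 y - W x y) (box_bounds s y x) else box_bounds s y x)"
      unfolding box_bounds_def by (auto simp: less_Suc_eq)
    have flag: "ra s 9 y < 1 \<longleftrightarrow> ra s 9 y \<noteq> 1"
      using s(2) y(1) by fastforce
    show ?case
      using y fr normedD(1)[OF n] x lw_neg_iff[OF x(2) y(1)] lw_scaled[OF x(2) y(1)] flag h 4(4)
        is_max_raise[OF 4(4), of "ra s 8 y - W x y"]
      by (simp add: rho_at_simps lambda_simps Suc wp_upd)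
  next
    case (5 s')
    then show ?case by simp
  qed (simp_all add: upd_cmd_def)
  then show ?thesis unfolding box_row_cmd_def by simp
qed

lemma box_correct:
  assumes s: "normed s" "\<forall>y<N. \<exists>k\<le>1. ra s 9 y = real k" and d: "d < 4"
  shows "wp N (box_cmd d) (\<lambda>s'. \<forall>x<N. flagged_max s' (10 + d) (14 + d) x (box_bounds s N x)) s"
  unfolding box_cmd_def
proof (rule wp_for[where I = "\<lambda>n s'. \<forall>x<n. flagged_max s' (10 + d) (14 + d) x (box_bounds s N x)"], goal_cases)
  case (4 x s')
  have n: "normed s'" using 4(3) by (elim normed_frame[OF s(1)]) (use d in \<open>simp_all add: box_row_cmd_def upd_cmd_def\<close>)
  have x: "x < N" "nv s' 2 = x" using 4 by simp_all
  have arr: "ra s' 8 = ra s 8" "ra s' 9 = ra s 9"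
    using frameD(3)[OF 4(3), of 8] frameD(3)[OF 4(3), of 9] by (simp_all add: box_row_cmd_def upd_cmd_def)
  have bb: "box_bounds s' N x = box_bounds s N x" unfolding box_bounds_def arr ..
  show ?case
    unfolding wp_applied(7)
  proof (rule wp_cons[OF box_row_correct[OF n _ x(2,1)]], goal_cases)
    case 1
    then show ?case using s(2) arr by simp
  next
    case (2 s1)
    have "nv s1 2 = x" "\<forall>a. ra s1 a = ra s' a"
      using frameD(1)[OF 2(2), of 2] frameD(3)[OF 2(2)] x(2) by (simp_all add: box_row_cmd_def upd_cmd_def)
    then show ?case
      using 2(1) 4(4) x d unfolding bb by (auto simp: flagged_max_def less_Suc_eq)
  qed
qed (auto simp: box_row_cmd_def upd_cmd_def)

lemma box_bounds_eq_lower_bounds: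
  assumes K: "\<forall>y<N. K y \<noteq> {}"
    and s: "\<forall>y<N. flagged_max s 8 9 y (dir_roots d {z \<in> {..<N}. \<rho> y z \<noteq> top} P Q (\<lambda>z. W y z - B z))"
  shows "box_bounds s N x = lower_bounds d x"
proof -
  have "dir_min d (K y) = (if ra s 9 y = 1 then {ra s 8 y} else {})" if y: "y < N" for y
  proof -
    let ?R = "dir_roots d {z \<in> {..<N}. \<rho> y z \<noteq> top} P Q (\<lambda>z. W y z - B z)"
    have fin: "finite ?R" unfolding dir_roots_def by (rule finite_roots) simp
    have eq: "dir_min d (K y) = (if ?R = {} then {} else {Max ?R})"
      using dir_min_eq[of "{z \<in> {..<N}. \<rho> y z \<noteq> top}" P Q "\<lambda>z. W y z - B z" d] K y
      unfolding K_def W_def by simp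
    obtain k where k: "ra s 9 y = real k" "is_max k (ra s 8 y) ?R"
      using s y unfolding flagged_max_def by blast
    show ?thesis
    proof (cases "?R = {}")
      case True
      then show ?thesis using eq k unfolding is_max_def by auto
    next
      case False
      then have "k = 1" "ra s 8 y \<in> ?R" "\<forall>r\<in>?R. r \<le> ra s 8 y" using k(2) unfolding is_max_def by auto
      then have "Max ?R = ra s 8 y" using fin by (intro Max_eqI) auto
      then show ?thesis using eq k(1) \<open>k = 1\<close> False by simp
    qed
  qed
  then show ?thesis
    unfolding box_bounds_def lower_bounds_def W_def by (auto split: if_splits)
qed

lemma finite_box_bounds: "finite (box_bounds s n x)"
proof -
  have "box_bounds s n x \<subseteq> (\<lambda>y. ra s 8 y - W x y) ` {..<n}" unfolding box_bounds_def by auto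
  then show ?thesis by (rule finite_subset) simp
qed

text \<open>While the program runs it is unknown whether a polygon is empty. Finiteness and the
  stored maximum are therefore recorded for some set \<open>S x\<close>, and its identification with
  \<open>lower_bounds\<close> is conditional.\<close>

definition boxed :: "nat \<Rightarrow> store \<Rightarrow> (nat \<Rightarrow> real set) \<Rightarrow> bool" where
  "boxed d s S \<longleftrightarrow> (\<forall>x<N. finite (S x) \<and> flagged_max s (10 + d) (14 + d) x (S x) \<and>
     ((\<forall>y<N. K y \<noteq> {}) \<longrightarrow> S x = lower_bounds d x))"

lemma dir_correct:
  assumes s: "normed s" and d: "d < 4"
  shows "wp N (dir_cmd d) (\<lambda>s. \<exists>S. boxed d s S) s"
  unfolding dir_cmd_def wp_applied(7)
proof (rule wp_cons[OF slope_correct[OF s]])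
  fix s1 assume s1: "\<forall>i<N. ra s1 3 i = slopes d i" "frame (slope_cmd d) s s1"
  have n1: "normed s1" using s1(2) by (elim normed_frame[OF s]) (simp_all add: slope_cmd_def Let_def)
  show "wp N (sort_cmd d) (wp N (min_cmd d) (wp N (box_cmd d) (\<lambda>s. \<exists>S. boxed d s S))) s1"
  proof (rule wp_cons[OF sort_correct[OF n1 s1(1)]])
    fix s2 assume "\<exists>\<pi>. sorted_order d \<pi> \<and> (\<forall>k<N. ra s2 4 k = real (\<pi> k))" and fr: "frame (sort_cmd d) s1 s2"
    then obtain \<pi> where \<pi>: "sorted_order d \<pi>" "\<forall>k<N. ra s2 4 k = real (\<pi> k)" by blast
    have n2: "normed s2" using fr by (elim normed_frame[OF n1]) (simp_all add: sort_cmd_def count_cmd_def Let_def)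
    have sl: "\<forall>i<N. ra s2 3 i = slopes d i"
      using frameD(3)[OF fr, of 3] s1(1) by (simp add: sort_cmd_def count_cmd_def Let_def)
    show "wp N (min_cmd d) (wp N (box_cmd d) (\<lambda>s. \<exists>S. boxed d s S)) s2"
    proof (rule wp_cons[OF min_correct[OF n2 sl \<pi>]])
      fix s3 assume s3: "\<forall>x<N. flagged_max s3 8 9 x (dir_roots d {y \<in> {..<N}. \<rho> x y \<noteq> top} P Q (\<lambda>y. W x y - B y))"
        and fr: "frame (min_cmd d) s2 s3"
      have n3: "normed s3" using fr by (elim normed_frame[OF n2]) (simp_all add: min_cmd_def kind_cmd_def sweep_defs)
      have "\<forall>y<N. \<exists>k\<le>1. ra s3 9 y = real k"
        using s3 unfolding flagged_max_def is_max_def by fastforce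
      from box_correct[OF n3 this d]
      show "wp N (box_cmd d) (\<lambda>s. \<exists>S. boxed d s S) s3"
        by (rule wp_mono)
          (use s3 finite_box_bounds box_bounds_eq_lower_bounds in \<open>auto simp: boxed_def intro!: exI[of _ "box_bounds s3 N"]\<close>)
    qed
  qed
qed

end

section \<open>Centres, radii and the final check\<close>

definition conflict_cmd :: "nat \<Rightarrow> nat \<Rightarrow> cmd" where
  "conflict_cmd d d' = CIf (RLt (RA (14 + d) (NV 2)) (RC 1)) CSkip (CIf (RLt (RA (14 + d') (NV 2)) (RC 1)) CSkip
     (CIf (RLt (RC 0) (RPlus (RA (10 + d) (NV 2)) (RA (10 + d') (NV 2)))) (CNat 12 (NC 0)) CSkip))"

definition bump_cmd :: "nat \<Rightarrow> nat \<Rightarrow> cmd" where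
  "bump_cmd k d = CIf (RLt (RA (14 + d) (NV 2)) (RC 1)) CSkip
     (CIf (RLt (RV k) (RA (10 + d) (NV 2))) (CReal k (RA (10 + d) (NV 2))) CSkip)"

definition point_cmd :: cmd where
  "point_cmd = conflict_cmd 0 1;; conflict_cmd 2 3;;
     CReal 6 (RC 0);; bump_cmd 6 0;; bump_cmd 6 1;; bump_cmd 6 2;; bump_cmd 6 3;;
     CReal 7 (RMinus (RC 0) (RV 6));; bump_cmd 7 0;;
     CReal 8 (RMinus (RC 0) (RV 6));; bump_cmd 8 1;;
     CReal 9 (RMinus (RC 0) (RV 6));; bump_cmd 9 2;;
     CReal 10 (RMinus (RC 0) (RV 6));; bump_cmd 10 3;;
     CReal 11 (RDiv (RMinus (RV 7) (RV 8)) (RC 2));;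
     CReal 12 (RDiv (RMinus (RV 9) (RV 10)) (RC 2))"

definition lhs_expr :: "rexp \<Rightarrow> rexp \<Rightarrow> rexp" where
  "lhs_expr e e' = RPlus (RPlus (RMul (RA 0 (NV 13)) e) (RMul (RA 20 (NV 13)) e')) (RA 2 (NV 13))"

definition sign_cmd :: "nat \<Rightarrow> nat \<Rightarrow> cmd" where
  "sign_cmd a k = CIf (RLt (RC 0) (RA a (NV 13))) (CReal k (RC 1)) (CReal k (RC (- 1)))"

definition radius_cmd :: cmd where
  "radius_cmd = CReal 13 (RC 0);; CFor 13 1 (
     CReal 0 rho_at;;
     CIf (RLt (RV 0) (RC 0)) CSkip (
       CReal 20 (RMinus (lhs_expr (RV 11) (RV 12)) (RMul lambda (RV 0)));;
       CIf (RLt (RV 13) (RV 20)) (CReal 13 (RV 20);; sign_cmd 0 14;; sign_cmd 20 15) CSkip))"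

text \<open>This check also detects emptiness of polygons: no candidate point can pass it for an
  empty one.\<close>

definition check_cmd :: cmd where
  "check_cmd = CFor 13 1 (
     CReal 0 rho_at;;
     CIf (RLt (RV 0) (RC 0)) CSkip
     (CIf (RLt (RMul lambda (RV 0)) (lhs_expr (RA 18 (NV 2)) (RA 19 (NV 2)))) (CNat 12 (NC 0)) CSkip))"

definition select_row_cmd :: cmd where
  "select_row_cmd = point_cmd;; radius_cmd;;
     CArr 18 (NV 2) (RMinus (RV 11) (RMul (RV 13) (RV 14)));;
     CArr 19 (NV 2) (RMinus (RV 12) (RMul (RV 13) (RV 15)));;
     check_cmd"

definition select_cmd :: cmd where
  "select_cmd = CNat 12 (NC 1);; CFor 2 1 select_row_cmd"

definition output_cmd :: cmd where
  "output_cmd = CIf (NLt (NC 0) (NV 12)) (CFor 2 1 (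
     CLow (NPlus (NC 1) (NMul (NC 2) (NV 2))) (RA 18 (NV 2));;
     CLow (NPlus (NC 2) (NMul (NC 2) (NV 2))) (RA 19 (NV 2)))) CSkip"

definition main_cmd :: cmd where
  "main_cmd = normalise_cmd;; dir_cmd 0;; dir_cmd 1;; dir_cmd 2;; dir_cmd 3;; select_cmd;; output_cmd"

lemmas select_defs = select_row_cmd_def point_cmd_def conflict_cmd_def bump_cmd_def radius_cmd_def
  check_cmd_def sign_cmd_def

definition bump :: "real \<Rightarrow> real \<Rightarrow> real \<Rightarrow> real" where
  "bump h a v = (if h < 1 then v else max v a)"

lemma wp_bump:
  assumes "k < 32" "d < 4" "nv s 2 < N"
  shows "wp N (bump_cmd k d) post s \<longleftrightarrow>
    post (s\<lparr>rv := (rv s)(k := bump (ra s (14 + d) (nv s 2)) (ra s (10 + d) (nv s 2)) (rv s k))\<rparr>)"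
proof -
  have "(rv s)(k := rv s k) = rv s" by simp
  then show ?thesis using assms by (cases s) (auto simp: bump_cmd_def bump_def max_def)
qed

lemma wp_conflict:
  assumes "d < 4" "d' < 4" "nv s 2 < N"
  shows "wp N (conflict_cmd d d') post s \<longleftrightarrow> post (s\<lparr>nv := (nv s)(12 :=
    if \<not> ra s (14 + d) (nv s 2) < 1 \<and> \<not> ra s (14 + d') (nv s 2) < 1 \<and>
      0 < ra s (10 + d) (nv s 2) + ra s (10 + d') (nv s 2) then 0 else nv s 12)\<rparr>)"
proof -
  have "(nv s)(12 := nv s 12) = nv s" by simp
  then show ?thesis using assms by (cases s) (auto simp: conflict_cmd_def)
qed

lemma flagged_bump:
  assumes "flagged_max s a h x S" "finite S"
  shows "bump (ra s h x) (ra s a x) v = Max (insert v S)"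
proof -
  obtain k where k: "ra s h x = real k" "is_max k (ra s a x) S" using assms(1) unfolding flagged_max_def by blast
  show ?thesis
  proof (cases "S = {}")
    case True
    then show ?thesis using k unfolding bump_def is_max_def by auto
  next
    case False
    then have "k = 1" "Max S = ra s a x"
      using k(2) assms(2) unfolding is_max_def by (auto intro: Max_eqI)
    then show ?thesis using False assms(2) k(1) by (simp add: bump_def)
  qed
qed

lemma flagged_conflict:
  assumes "flagged_max s a h x S" "flagged_max s a' h' x S'"
  shows "(\<not> ra s h x < 1 \<and> \<not> ra s h' x < 1 \<and> 0 < ra s a x + ra s a' x) \<longleftrightarrow>
    \<not> (\<forall>u\<in>S. \<forall>v\<in>S'. u + v \<le> 0)"
proof -
  obtain k k' where k: "ra s h x = real k" "is_max k (ra s a x) S" "ra s h' x = real k'" "is_max k' (ra s a' x) S'"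
    using assms unfolding flagged_max_def by blast
  show ?thesis
  proof
    assume *: "\<not> ra s h x < 1 \<and> \<not> ra s h' x < 1 \<and> 0 < ra s a x + ra s a' x"
    then have "ra s a x \<in> S" "ra s a' x \<in> S'" using k unfolding is_max_def by auto
    then show "\<not> (\<forall>u\<in>S. \<forall>v\<in>S'. u + v \<le> 0)" using * by fastforce
  next
    assume "\<not> (\<forall>u\<in>S. \<forall>v\<in>S'. u + v \<le> 0)"
    then obtain u v where uv: "u \<in> S" "v \<in> S'" "0 < u + v" by auto
    then have "k = 1" "k' = 1" "u \<le> ra s a x" "v \<le> ra s a' x" using k unfolding is_max_def by auto
    then show "\<not> ra s h x < 1 \<and> \<not> ra s h' x < 1 \<and> 0 < ra s a x + ra s a' x"
      using uv(3) k by simp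
  qed
qed

lemma Max_insert_Max:
  fixes S T :: "real set"
  assumes "finite S" "finite T"
  shows "Max (insert (Max (insert v S)) T) = Max (insert v (S \<union> T))"
proof (cases "T = {}")
  case False
  have "Max (insert v S \<union> T) = max (Max (insert v S)) (Max T)" using assms False by (intro Max_Un) auto
  then show ?thesis using assms False by simp
qed simp

lemma UN_less_4: "(\<Union>d<4. S d) = S 0 \<union> S (Suc 0) \<union> S 2 \<union> S (3::nat)"
  by (auto simp: numeral_eq_Suc less_Suc_eq)

text \<open>Stated for arbitrary finite sets \<open>S d\<close>, because the equality with
  \<open>lower_bounds\<close> is available only when all polygons are nonempty.\<close>

lemma point_correct:
  assumes S: "\<forall>d<4. flagged_max s (10 + d) (14 + d) x (S d) \<and> finite (S d)" and x: "nv s 2 = x" "x < N"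
  defines "r \<equiv> Max (insert 0 (\<Union>d<4. S d))"
  shows "wp N point_cmd (\<lambda>s'.
      rv s' 11 = (Max (insert (- r) (S 0)) - Max (insert (- r) (S 1))) / 2 \<and>
      rv s' 12 = (Max (insert (- r) (S 2)) - Max (insert (- r) (S 3))) / 2 \<and>
      nv s' 12 = (if (\<forall>u\<in>S 0. \<forall>v\<in>S 1. u + v \<le> 0) \<and> (\<forall>u\<in>S 2. \<forall>v\<in>S 3. u + v \<le> 0) then nv s 12 else 0)) s"
proof -
  have S': "flagged_max s 10 14 x (S 0)" "flagged_max s 11 15 x (S (Suc 0))"
    "flagged_max s 12 16 x (S 2)" "flagged_max s 13 17 x (S 3)"
    "finite (S 0)" "finite (S (Suc 0))" "finite (S 2)" "finite (S 3)"
    using S[unfolded all_less_4] by simp_all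
  note bumps = flagged_bump[OF S'(1,5)] flagged_bump[OF S'(2,6)] flagged_bump[OF S'(3,7)] flagged_bump[OF S'(4,8)]
  have r: "r = Max (insert (Max (insert (Max (insert (Max (insert 0 (S 0))) (S (Suc 0)))) (S 2))) (S 3))"
    unfolding r_def UN_less_4 using S'(5-8) by (simp only: Max_insert_Max finite_UnI Un_assoc)
  note conflicts = flagged_conflict[OF S'(1,2)] flagged_conflict[OF S'(3,4)]
  show ?thesis
    unfolding point_cmd_def
    using x by (simp add: wp_bump wp_conflict bumps conflicts r[symmetric] del: de_Morgan_conj)
qed

context program_data
begin

definition at_point :: "nat \<Rightarrow> real \<Rightarrow> real \<Rightarrow> real" where
  "at_point y u v = P y * u + Q y * v + B y"

lemma lhs_expr_simps:
  assumes "normed s" "nv s 13 = y" "y < N"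
  shows "rval N s (lhs_expr e e') = at_point y (rval N s e) (rval N s e')"
    "rdef N s (lhs_expr e e') \<longleftrightarrow> rdef N s e \<and> rdef N s e'"
  using normedD(2-4)[OF assms(1), of y] assms(2,3) by (auto simp: lhs_expr_def at_point_def)

text \<open>A comparison has only two outcomes. Agreement with \<open>sgn\<close> is used for a
  positive radius at a feasible point of nonempty polygons, where \<open>Pr_K\<close> makes both
  coefficients nonzero.\<close>

definition sg :: "real \<Rightarrow> real" where
  "sg t = (if 0 < t then 1 else - 1)"

lemma wp_sign:
  "a < 32 \<Longrightarrow> k < 32 \<Longrightarrow> nv s 13 < N \<Longrightarrow>
    wp N (sign_cmd a k) post s \<longleftrightarrow> post (s\<lparr>rv := (rv s)(k := sg (ra s a (nv s 13)))\<rparr>)"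
  by (simp add: sign_cmd_def sg_def)

text \<open>As long as \<open>r = 0\<close> the sign registers hold arbitrary contents; in the
  selected point they are multiplied by \<open>r\<close>.\<close>

definition max_excess :: "nat \<Rightarrow> real \<Rightarrow> real \<Rightarrow> nat \<Rightarrow> real \<Rightarrow> real \<Rightarrow> real \<Rightarrow> bool" where
  "max_excess x u v n r a b \<longleftrightarrow>
     r = Max (insert 0 ((\<lambda>y. at_point y u v - W x y) ` {y. y < n \<and> \<rho> x y \<noteq> top})) \<and>
     (r = 0 \<or> (\<exists>y<n. \<rho> x y \<noteq> top \<and> at_point y u v - W x y = r \<and> a = sg (P y) \<and> b = sg (Q y)))"

lemma active_Suc:
  "{y. y < Suc n \<and> \<rho> x y \<noteq> top} =
    (if \<rho> x n = top then {y. y < n \<and> \<rho> x y \<noteq> top} else insert n {y. y < n \<and> \<rho> x y \<noteq> top})"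
  by (auto simp: less_Suc_eq)

lemma max_excess_skip:
  assumes "max_excess x u v n r a b" "\<rho> x n = top \<or> at_point n u v - W x n \<le> r"
  shows "max_excess x u v (Suc n) r a b"
proof -
  let ?S = "insert 0 ((\<lambda>y. at_point y u v - W x y) ` {y. y < n \<and> \<rho> x y \<noteq> top})"
  have "Max (insert (at_point n u v - W x n) ?S) = r" if "\<rho> x n \<noteq> top"
    using assms that unfolding max_excess_def by (subst Max_insert) auto
  then have "r = Max (insert 0 ((\<lambda>y. at_point y u v - W x y) ` {y. y < Suc n \<and> \<rho> x y \<noteq> top}))"
    using assms(1) unfolding active_Suc max_excess_def by (auto simp: insert_commute)
  then show ?thesis
    using assms(1) less_SucI unfolding max_excess_def by blast
qed

lemma max_excess_new:
  assumes "max_excess x u v n r a b" "\<rho> x n \<noteq> top" "r < at_point n u v - W x n"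
  shows "max_excess x u v (Suc n) (at_point n u v - W x n) (sg (P n)) (sg (Q n))"
proof -
  let ?S = "insert 0 ((\<lambda>y. at_point y u v - W x y) ` {y. y < n \<and> \<rho> x y \<noteq> top})"
  have "Max (insert (at_point n u v - W x n) ?S) = at_point n u v - W x n"
    using assms unfolding max_excess_def by (subst Max_insert) auto
  then have "at_point n u v - W x n = Max (insert 0 ((\<lambda>y. at_point y u v - W x y) ` {y. y < Suc n \<and> \<rho> x y \<noteq> top}))"
    using assms(2) unfolding active_Suc by (simp add: insert_commute)
  then show ?thesis
    using assms(2) lessI unfolding max_excess_def by blast
qed

lemma radius_correct:
  assumes s: "normed s" "nv s 2 = x" "x < N"
  shows "wp N radius_cmd (\<lambda>s'. max_excess x (rv s 11) (rv s 12) N (rv s' 13) (rv s' 14) (rv s' 15)) s"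
proof -
  let ?s = "s\<lparr>rv := (rv s)(13 := 0)\<rparr>"
  let ?I = "\<lambda>n s'. max_excess x (rv s 11) (rv s 12) n (rv s' 13) (rv s' 14) (rv s' 15)"
  have n0: "normed ?s" using s(1) unfolding normed_def by simp
  have "wp N (CFor 13 1 (
     CReal 0 rho_at;;
     CIf (RLt (RV 0) (RC 0)) CSkip (
       CReal 20 (RMinus (lhs_expr (RV 11) (RV 12)) (RMul lambda (RV 0)));;
       CIf (RLt (RV 13) (RV 20)) (CReal 13 (RV 20);; sign_cmd 0 14;; sign_cmd 20 15) CSkip))) (?I N) ?s"
  proof (rule wp_for[where I = ?I], goal_cases)
    case 3
    show ?case by (simp add: max_excess_def)
  next
    case (4 y s')
    have n: "normed s'" using 4(3) by (elim normed_frame[OF n0]) (simp_all add: sign_cmd_def)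
    have y: "y < N" "nv s' 13 = y" using 4 by simp_all
    have fr: "nv s' 2 = x" "rv s' 11 = rv s 11" "rv s' 12 = rv s 12"
      using frameD(1)[OF 4(3), of 2] frameD(2)[OF 4(3), of 11] frameD(2)[OF 4(3), of 12] s(2)
      by (simp_all add: sign_cmd_def)
    have nr: "normed (s'\<lparr>rv := g\<rparr>)" for g using n unfolding normed_def by simp
    have PQ: "ra s' 0 y = P y" "ra s' 20 y = Q y" using normedD(2,3)[OF n y(1)] .
    show ?case
    proof (cases "\<rho> x y = top")
      case True
      then show ?thesis
        using y fr normedD(1)[OF n] s(3) lw_neg_iff[OF s(3) y(1)] max_excess_skip[OF 4(4)]
        by (simp add: rho_at_simps)
    next
      case act: False
      let ?e = "at_point y (rv s 11) (rv s 12) - W x y"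
      show ?thesis
      proof (cases "rv s' 13 < ?e")
        case True
        then show ?thesis
          using act y fr normedD(1)[OF n] s(3) lw_neg_iff[OF s(3) y(1)] lw_scaled[OF s(3) y(1) act]
            max_excess_new[OF 4(4) act True]
          by (simp add: rho_at_simps lambda_simps lhs_expr_simps[where y = y] nr wp_sign PQ)
      next
        case False
        then show ?thesis
          using act y fr normedD(1)[OF n] s(3) lw_neg_iff[OF s(3) y(1)] lw_scaled[OF s(3) y(1) act]
            max_excess_skip[OF 4(4)]
          by (simp add: rho_at_simps lambda_simps lhs_expr_simps[where y = y] nr)
      qed
    qed
  next
    case (5 s')
    then show ?case by simp
  qed (simp_all add: sign_cmd_def)
  then show ?thesis unfolding radius_cmd_def by simp
qed

definition satisfied :: "nat \<Rightarrow> real \<Rightarrow> real \<Rightarrow> nat \<Rightarrow> bool" where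
  "satisfied x u v n \<longleftrightarrow> (\<forall>y<n. \<rho> x y \<noteq> top \<longrightarrow> at_point y u v \<le> W x y)"

lemma satisfied_Suc: "satisfied x u v (Suc n) \<longleftrightarrow> satisfied x u v n \<and> (\<rho> x n \<noteq> top \<longrightarrow> at_point n u v \<le> W x n)"
  unfolding satisfied_def by (auto simp: less_Suc_eq)

lemma satisfied_N: "satisfied x u v N \<longleftrightarrow> (u, v) \<in> K x"
  unfolding satisfied_def mem_K at_point_def W_def by auto

lemma check_correct:
  assumes s: "normed s" "nv s 2 = x" "x < N"
  shows "wp N check_cmd (\<lambda>s'. nv s' 12 = (if (ra s 18 x, ra s 19 x) \<in> K x then nv s 12 else 0)) s"
  unfolding check_cmd_def
proof (rule wp_for[where I = "\<lambda>n s'. nv s' 12 = (if satisfied x (ra s 18 x) (ra s 19 x) n then nv s 12 else 0)"], goal_cases)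
  case 3
  show ?case by (simp add: satisfied_def)
next
  case (4 y s')
  have n: "normed s'" using 4(3) by (elim normed_frame[OF s(1)]) simp_all
  have y: "y < N" "nv s' 13 = y" using 4 by simp_all
  have fr: "nv s' 2 = x" "ra s' 18 = ra s 18" "ra s' 19 = ra s 19"
    using frameD(1)[OF 4(3), of 2] frameD(3)[OF 4(3), of 18] frameD(3)[OF 4(3), of 19] s(2) by simp_all
  have nr: "normed (s'\<lparr>rv := g\<rparr>)" for g using n unfolding normed_def by simp
  show ?case
  proof (cases "\<rho> x y = top")
    case True
    then show ?thesis
      using 4(4) y fr normedD(1)[OF n] s(3) lw_neg_iff[OF s(3) y(1)]
      by (simp add: rho_at_simps satisfied_Suc)
  next
    case False
    then show ?thesis
      using 4(4) y fr normedD(1)[OF n] s(3) lw_neg_iff[OF s(3) y(1)] lw_scaled[OF s(3) y(1) False]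
      by (simp add: rho_at_simps lambda_simps lhs_expr_simps[where y = y] nr satisfied_Suc not_less)
  qed
next
  case (5 s')
  then show ?case by (simp add: satisfied_N)
qed simp_all

abbreviation nonempty :: bool where
  "nonempty \<equiv> \<forall>y<N. K y \<noteq> {}"

lemma selected_eq_f:
  assumes ne: nonempty and x: "x < N" "feasible x"
    and e: "max_excess x (fst (g x)) (snd (g x)) N r a b"
  shows "(fst (g x) - r * a, snd (g x) - r * b) = f x"
proof -
  have K: "\<And>y. y \<in> {..<N} \<Longrightarrow> K y \<noteq> {}" using ne by simp
  have ex: "at_point y (fst (g x)) (snd (g x)) - W x y = excess x y" for y
    unfolding at_point_def W_def excess_def by simp
  have r: "r = R x"
    using e unfolding max_excess_def ex R_def by simp
  have xM: "x \<in> {..<N}" using x(1) by simp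
  show ?thesis
  proof (cases "R x = 0")
    case True
    then show ?thesis using Pr_K(1)[OF K xM x(2)] r unfolding f_def by simp
  next
    case False
    obtain y where y: "y < N" "\<rho> x y \<noteq> top" "excess x y = R x" "a = sg (P y)" "b = sg (Q y)"
      using e False unfolding max_excess_def ex r by blast
    have yM: "y \<in> {..<N}" using y(1) by simp
    have "R x > 0" using False R_nonneg[of x] by simp
    then have "P y \<noteq> 0" "Q y \<noteq> 0" "f x = corner x y"
      using Pr_K(2)[OF K xM x(2) yM y(2,3)] unfolding f_def by simp_all
    then show ?thesis
      unfolding corner_def r y(4,5) sg_def by (simp add: sgn_if)
  qed
qed

text \<open>The postcondition has two layers. A surviving flag certifies membership in
  \<open>K x\<close> with no assumption on the polygons; under \<open>nonempty\<close> the flag also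
  decides feasibility and the point is \<open>f x\<close>.\<close>

lemma select_row_correct:
  assumes s: "normed s" "nv s 2 = x" "x < N" and S: "\<forall>d<4. boxed d s (S d)"
  shows "wp N select_row_cmd (\<lambda>s'.
    nv s' 12 = (if (ra s' 18 x, ra s' 19 x) \<in> K x \<and> nv s' 12 \<noteq> 0 then nv s 12 else 0) \<and>
    (nonempty \<longrightarrow> (if feasible x then (ra s' 18 x, ra s' 19 x) = f x \<and> nv s' 12 = nv s 12 else nv s' 12 = 0)) \<and>
    (\<forall>x'. x' \<noteq> x \<longrightarrow> ra s' 18 x' = ra s 18 x' \<and> ra s' 19 x' = ra s 19 x')) s"
  unfolding select_row_cmd_def wp_applied(7)
proof -
  let ?r = "Max (insert 0 (\<Union>d<4. S d x))"
  define gu where "gu = (Max (insert (- ?r) (S 0 x)) - Max (insert (- ?r) (S 1 x))) / 2"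
  define gv where "gv = (Max (insert (- ?r) (S 2 x)) - Max (insert (- ?r) (S 3 x))) / 2"
  let ?feas = "(\<forall>u\<in>S 0 x. \<forall>v\<in>S 1 x. u + v \<le> 0) \<and> (\<forall>u\<in>S 2 x. \<forall>v\<in>S 3 x. u + v \<le> 0)"
  let ?post = "\<lambda>s'.
    nv s' 12 = (if (ra s' 18 x, ra s' 19 x) \<in> K x \<and> nv s' 12 \<noteq> 0 then nv s 12 else 0) \<and>
    (nonempty \<longrightarrow> (if feasible x then (ra s' 18 x, ra s' 19 x) = f x \<and> nv s' 12 = nv s 12 else nv s' 12 = 0)) \<and>
    (\<forall>x'. x' \<noteq> x \<longrightarrow> ra s' 18 x' = ra s 18 x' \<and> ra s' 19 x' = ra s 19 x')"
  have box: "\<forall>d<4. flagged_max s (10 + d) (14 + d) x (S d x) \<and> finite (S d x)"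
    using S s(3) unfolding boxed_def by blast
  have lower_bounds: "S d x = lower_bounds d x" if "d < 4" nonempty for d
    using S s(3) that unfolding boxed_def by blast
  have g: "gu = fst (g x)" "gv = snd (g x)" "?feas \<longleftrightarrow> feasible x" if nonempty
  proof -
    have "?r = rad x" unfolding rad_def using lower_bounds[OF _ that] by simp
    then show "gu = fst (g x)" "gv = snd (g x)" "?feas \<longleftrightarrow> feasible x"
      using lower_bounds[OF _ that] unfolding gu_def gv_def g_def lo_def feasible_def by simp_all
  qed
  have n_frame: "normed s'" if "frame c s0 s'" "normed s0" "c = point_cmd \<or> c = radius_cmd" for c s0 s'
    using that by (elim normed_frame) (auto simp: select_defs)
  show "wp N point_cmd (wp N radius_cmd (wp N (CArr 18 (NV 2) (RMinus (RV 11) (RMul (RV 13) (RV 14))))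
    (wp N (CArr 19 (NV 2) (RMinus (RV 12) (RMul (RV 13) (RV 15)))) (wp N check_cmd ?post)))) s"
  proof (rule wp_cons[OF point_correct[OF box s(2,3), folded gu_def gv_def]])
    fix s1 assume s1: "rv s1 11 = gu \<and> rv s1 12 = gv \<and> nv s1 12 = (if ?feas then nv s 12 else 0)"
      and fr1: "frame point_cmd s s1"
    have n1: "normed s1" using n_frame[OF fr1 s(1)] by simp
    have a1: "nv s1 2 = x" "ra s1 18 = ra s 18" "ra s1 19 = ra s 19"
      using frameD(1)[OF fr1, of 2] frameD(3)[OF fr1, of 18] frameD(3)[OF fr1, of 19] s(2)
      by (simp_all add: select_defs)
    show "wp N radius_cmd (wp N (CArr 18 (NV 2) (RMinus (RV 11) (RMul (RV 13) (RV 14))))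
      (wp N (CArr 19 (NV 2) (RMinus (RV 12) (RMul (RV 13) (RV 15)))) (wp N check_cmd ?post))) s1"
    proof (rule wp_cons[OF radius_correct[OF n1 a1(1) s(3)]])
      fix s2 assume s2: "max_excess x (rv s1 11) (rv s1 12) N (rv s2 13) (rv s2 14) (rv s2 15)"
        and fr2: "frame radius_cmd s1 s2"
      have n2: "normed s2" using n_frame[OF fr2 n1] by simp
      have a2: "nv s2 2 = x" "nv s2 12 = nv s1 12" "rv s2 11 = gu" "rv s2 12 = gv"
        "ra s2 18 = ra s 18" "ra s2 19 = ra s 19"
        using frameD(1)[OF fr2, of 2] frameD(1)[OF fr2, of 12] frameD(2)[OF fr2, of 11] frameD(2)[OF fr2, of 12]
          frameD(3)[OF fr2, of 18] frameD(3)[OF fr2, of 19] a1 s1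
        by (simp_all add: select_defs)
      let ?a = "gu - rv s2 13 * rv s2 14" and ?b = "gv - rv s2 13 * rv s2 15"
      let ?s3 = "s2\<lparr>ra := (ra s2)(18 := (ra s 18)(x := ?a), 19 := (ra s 19)(x := ?b))\<rparr>"
      have n3: "normed ?s3" using n2 unfolding normed_def by simp
      have x3: "nv ?s3 2 = x" using a2(1) by simp
      have "wp N check_cmd ?post ?s3"
      proof (rule wp_cons[OF check_correct[OF n3 x3 s(3)]])
        fix s4 assume s4: "nv s4 12 = (if (ra ?s3 18 x, ra ?s3 19 x) \<in> K x then nv ?s3 12 else 0)"
          and fr4: "frame check_cmd ?s3 s4"
        have a4: "ra s4 18 = (ra s 18)(x := ?a)" "ra s4 19 = (ra s 19)(x := ?b)"
          using frameD(3)[OF fr4, of 18] frameD(3)[OF fr4, of 19] by (simp_all add: select_defs)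
        have ok: "nv s4 12 = (if (?a, ?b) \<in> K x then if ?feas then nv s 12 else 0 else 0)"
          using s4 a2(2) s1 by simp
        have strong: "if feasible x then (?a, ?b) = f x \<and> nv s4 12 = nv s 12 else nv s4 12 = 0" if ne: nonempty
        proof (cases "feasible x")
          case True
          have "max_excess x (fst (g x)) (snd (g x)) N (rv s2 13) (rv s2 14) (rv s2 15)"
            using s2 s1 g(1,2)[OF ne] by simp
          from selected_eq_f[OF ne s(3) True this] have f: "(?a, ?b) = f x" using g(1,2)[OF ne] by simp
          moreover have "f x \<in> K x" using f_in_K[of x] ne True s(3) by simp
          ultimately show ?thesis using ok g(3)[OF ne] True by simp
        next
          case False
          then have "\<not> ?feas" using g(3)[OF ne] by blast
          then show ?thesis using ok False by (simp only: if_False if_cancel)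
        qed
        have e: "ra s4 18 x = ?a" "ra s4 19 x = ?b" by (simp_all add: a4)
        have "nv s4 12 = (if (?a, ?b) \<in> K x \<and> nv s4 12 \<noteq> 0 then nv s 12 else 0)"
          using ok by simp
        moreover have "\<forall>x'. x' \<noteq> x \<longrightarrow> ra s4 18 x' = ra s 18 x' \<and> ra s4 19 x' = ra s 19 x'"
          by (simp add: a4)
        ultimately show "?post s4" unfolding e using strong by blast
      qed
      then show "wp N (CArr 18 (NV 2) (RMinus (RV 11) (RMul (RV 13) (RV 14))))
        (wp N (CArr 19 (NV 2) (RMinus (RV 12) (RMul (RV 13) (RV 15)))) (wp N check_cmd ?post)) s2"
        using a2 s(3) by simp
    qed
  qed
qed

text \<open>A flag 0 is justified by contraposition: if all polygons were nonempty and all points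
  feasible, every candidate would be \<open>f x\<close>, which lies in \<open>K x\<close>, and the
  flag would have survived.\<close>

definition selected :: "nat \<Rightarrow> store \<Rightarrow> bool" where
  "selected n s \<longleftrightarrow> nv s 12 \<le> 1 \<and>
     (nv s 12 = 1 \<longrightarrow> (\<forall>x<n. (ra s 18 x, ra s 19 x) \<in> K x \<and>
        (nonempty \<longrightarrow> feasible x \<and> (ra s 18 x, ra s 19 x) = f x))) \<and>
     (nv s 12 = 0 \<longrightarrow> \<not> (nonempty \<and> (\<forall>x<N. feasible x)))"

lemma select_correct:
  assumes s: "normed s" and S: "\<forall>d<4. boxed d s (S d)"
  shows "wp N select_cmd (selected N) s"
proof -
  let ?s = "s\<lparr>nv := (nv s)(12 := 1)\<rparr>"
  have n0: "normed ?s" using s unfolding normed_def by simp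
  have "wp N (CFor 2 1 select_row_cmd) (selected N) ?s"
  proof (rule wp_for[where I = selected], goal_cases)
    case 2
    show ?case by (simp add: select_defs)
  next
    case 3
    show ?case by (simp add: selected_def)
  next
    case (4 x s')
    have n: "normed s'" using 4(3) by (elim normed_frame[OF n0]) (simp_all add: select_defs)
    have x: "x < N" "nv s' 2 = x" using 4 by simp_all
    have arr: "ra s' a = ra s a" if "a \<in> {10..<18}" for a
      using frameD(3)[OF 4(3), of a] that by (auto simp: select_defs)
    have "\<forall>d<4. boxed d s' (S d)"
      using S unfolding boxed_def flagged_max_def by (simp add: arr)
    then show ?case
    proof (rule wp_mono[OF select_row_correct[OF n x(2,1)]])
      fix s'' :: store assume p: "nv s'' 12 = (if (ra s'' 18 x, ra s'' 19 x) \<in> K x \<and> nv s'' 12 \<noteq> 0 then nv s' 12 else 0) \<and>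
        (nonempty \<longrightarrow> (if feasible x then (ra s'' 18 x, ra s'' 19 x) = f x \<and> nv s'' 12 = nv s' 12 else nv s'' 12 = 0)) \<and>
        (\<forall>x'. x' \<noteq> x \<longrightarrow> ra s'' 18 x' = ra s' 18 x' \<and> ra s'' 19 x' = ra s' 19 x')"
      have "selected (Suc x) s''"
        unfolding selected_def
      proof (intro conjI impI)
        show "nv s'' 12 \<le> 1" using p 4(4) unfolding selected_def by (metis le0)
        assume "nv s'' 12 = 1"
        then have h: "(ra s'' 18 x, ra s'' 19 x) \<in> K x" "nv s' 12 = 1"
          using p by (metis zero_neq_one)+
        show "\<forall>x'<Suc x. (ra s'' 18 x', ra s'' 19 x') \<in> K x' \<and>
          (nonempty \<longrightarrow> feasible x' \<and> (ra s'' 18 x', ra s'' 19 x') = f x')"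
        proof (intro allI impI)
          fix x' assume "x' < Suc x"
          show "(ra s'' 18 x', ra s'' 19 x') \<in> K x' \<and>
            (nonempty \<longrightarrow> feasible x' \<and> (ra s'' 18 x', ra s'' 19 x') = f x')"
          proof (cases "x' = x")
            case True
            then show ?thesis using h p \<open>nv s'' 12 = 1\<close> by (metis zero_neq_one)
          next
            case False
            then show ?thesis using h p 4(4) \<open>x' < Suc x\<close> unfolding selected_def by simp
          qed
        qed
      next
        assume z: "nv s'' 12 = 0"
        show "\<not> (nonempty \<and> (\<forall>x<N. feasible x))"
        proof
          assume *: "nonempty \<and> (\<forall>x<N. feasible x)"
          then have "nv s' 12 = 0" using p x(1) z by metis
          then show False using * 4(4) unfolding selected_def by blast
        qed
      qed
      then show "selected (Suc x) (s''\<lparr>nv := (nv s'')(2 := Suc x)\<rparr>)"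
        unfolding selected_def by simp
    qed
  next
    case (5 s')
    then show ?case by simp
  qed simp
  then show ?thesis unfolding select_cmd_def by simp
qed

definition output_ok :: "store \<Rightarrow> bool" where
  "output_ok s \<longleftrightarrow> nv s 12 \<le> 1 \<and>
     (nv s 12 = 1 \<longrightarrow> nonempty \<and> (\<forall>x<N. feasible x \<and> low s (1 + 2 * x) = fst (f x) \<and> low s (2 + 2 * x) = snd (f x))) \<and>
     (nv s 12 = 0 \<longrightarrow> \<not> (nonempty \<and> (\<forall>x<N. feasible x)))"

lemma output_correct:
  assumes "selected N s"
  shows "wp N output_cmd output_ok s"
proof (cases "nv s 12 = 1")
  case False
  then have "nv s 12 = 0" using assms unfolding selected_def by auto
  then show ?thesis using assms unfolding output_cmd_def output_ok_def selected_def by simp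
next
  case True
  \<comment> \<open>The selected points themselves witness that no polygon is empty, which releases
    the conditional half of \<open>selected\<close>.\<close>
  then have ne: nonempty using assms unfolding selected_def by blast
  have f: "feasible x" "ra s 18 x = fst (f x)" "ra s 19 x = snd (f x)" if "x < N" for x
    using assms True ne that unfolding selected_def by (auto simp: prod_eq_iff)
  have "wp N (CFor 2 1 (
     CLow (NPlus (NC 1) (NMul (NC 2) (NV 2))) (RA 18 (NV 2));;
     CLow (NPlus (NC 2) (NMul (NC 2) (NV 2))) (RA 19 (NV 2)))) output_ok s"
  proof (rule wp_for[where I = "\<lambda>n s. \<forall>x<n. low s (1 + 2 * x) = fst (f x) \<and> low s (2 + 2 * x) = snd (f x)"], goal_cases)
    case (4 x s')
    have x: "x < N" "nv s' 2 = x" using 4 by simp_all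
    have arr: "ra s' 18 = ra s 18" "ra s' 19 = ra s 19"
      using frameD(3)[OF 4(3), of 18] frameD(3)[OF 4(3), of 19] by simp_all
    have "Suc (Suc (2 * x)) < 6 * N * N"
    proof -
      have "N \<le> N * N" using N_pos by simp
      moreover have "6 * N * N = 6 * (N * N)" by simp
      ultimately show ?thesis using x(1) by linarith
    qed
    moreover have "Suc (2 * x) \<noteq> 2 * x'" "2 * x' \<noteq> Suc (2 * x)" for x' by presburger+
    ultimately show ?case
      using 4(4) x f[OF x(1)] arr by (auto simp: less_Suc_eq)
  next
    case (5 s')
    have "nv s' 12 = 1" using frameD(1)[OF 5(2), of 12] True by simp
    then show ?case using 5(1) ne f unfolding output_ok_def by simp
  qed simp_all
  then show ?thesis using True unfolding output_cmd_def by simp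
qed

lemma boxed_frame:
  assumes "boxed d s S" "frame c s s'" "LArr (10 + d) \<notin> mods c" "LArr (14 + d) \<notin> mods c"
  shows "boxed d s' S"
  using assms(1) frameD(3)[OF assms(2)] assms(3,4) unfolding boxed_def flagged_max_def by simp

lemma dir_normed_frame: "normed s \<Longrightarrow> frame (dir_cmd d) s s' \<Longrightarrow> d < 4 \<Longrightarrow> normed s'"
  by (erule normed_frame, assumption) (auto simp: dir_defs)

lemma dir_boxed_frame:
  assumes "boxed d s S" "frame (dir_cmd d') s s'" "d < 4" "d' < 4" "d \<noteq> d'"
  shows "boxed d s' S"
  using assms by (intro boxed_frame[OF assms(1,2)]) (auto simp: dir_defs)

lemma main_correct:
  assumes "low s = lw"
  shows "wp N main_cmd output_ok s"
  unfolding main_cmd_def wp_applied(7)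
proof (rule wp_cons[OF normalise_correct[OF assms]])
  fix s0 assume n0: "normed s0"
  show "wp N (dir_cmd 0) (wp N (dir_cmd 1) (wp N (dir_cmd 2) (wp N (dir_cmd 3) (wp N select_cmd (wp N output_cmd output_ok))))) s0"
  proof (rule wp_cons[OF dir_correct[OF n0]])
    fix s1 assume "\<exists>S. boxed 0 s1 S" and fr1: "frame (dir_cmd 0) s0 s1"
    then obtain S0 where S0: "boxed 0 s1 S0" by blast
    have n1: "normed s1" using dir_normed_frame[OF n0 fr1] by simp
    show "wp N (dir_cmd 1) (wp N (dir_cmd 2) (wp N (dir_cmd 3) (wp N select_cmd (wp N output_cmd output_ok)))) s1"
    proof (rule wp_cons[OF dir_correct[OF n1]])
      fix s2 assume "\<exists>S. boxed 1 s2 S" and fr2: "frame (dir_cmd 1) s1 s2"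
      then obtain S1 where S1: "boxed 1 s2 S1" by blast
      have n2: "normed s2" using dir_normed_frame[OF n1 fr2] by simp
      show "wp N (dir_cmd 2) (wp N (dir_cmd 3) (wp N select_cmd (wp N output_cmd output_ok))) s2"
      proof (rule wp_cons[OF dir_correct[OF n2]])
        fix s3 assume "\<exists>S. boxed 2 s3 S" and fr3: "frame (dir_cmd 2) s2 s3"
        then obtain S2 where S2: "boxed 2 s3 S2" by blast
        have n3: "normed s3" using dir_normed_frame[OF n2 fr3] by simp
        show "wp N (dir_cmd 3) (wp N select_cmd (wp N output_cmd output_ok)) s3"
        proof (rule wp_cons[OF dir_correct[OF n3]])
          fix s4 assume "\<exists>S. boxed 3 s4 S" and fr4: "frame (dir_cmd 3) s3 s4"
          then obtain S3 where S3: "boxed 3 s4 S3" by blast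
          have n4: "normed s4" using dir_normed_frame[OF n3 fr4] by simp
          have "boxed 2 s4 S2" using dir_boxed_frame[OF S2 fr4] by simp
          moreover have "boxed 1 s4 S1"
            using dir_boxed_frame[OF dir_boxed_frame[OF S1 fr3] fr4] by simp
          moreover have "boxed 0 s4 S0"
            using dir_boxed_frame[OF dir_boxed_frame[OF dir_boxed_frame[OF S0 fr2] fr3] fr4] by simp
          ultimately have "\<forall>d<4. boxed d s4 ((\<lambda>d. if d = 0 then S0 else if d = 1 then S1 else if d = 2 then S2 else S3) d)"
            using S3 unfolding all_less_4 by simp
          from select_correct[OF n4 this]
          show "wp N select_cmd (wp N output_cmd output_ok) s4"
            by (rule wp_mono) (rule output_correct)
        qed simp
      qed simp
    qed simp
  qed simp
qed

end

section \<open>The complete program and its resource bounds\<close>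

lemma nesting_main: "nesting main_cmd = 2"
  by (simp add: main_cmd_def normalise_cmd_def abs_cmd_def dir_defs select_cmd_def select_defs output_cmd_def)

text \<open>The initial contents of the registers are arbitrary reals, whereas
  \<open>represents\<close> demands naturals in the natural registers; real registers and arrays can
  be taken over as they are.\<close>

primrec zero_regs :: "nat \<Rightarrow> prog" where
  "zero_regs 0 = Skip"
| "zero_regs (Suc k) = Seq (zero_regs k) (Store (nreg k) (Const 0))"

lemma zero_regs_exec:
  assumes N: "N \<ge> 1" and m: "m 0 = real N"
  shows "k \<le> 32 \<Longrightarrow> \<exists>t m'. exec (mem_size N) (zero_regs k) m t m' \<and> t \<le> 6 * k \<and>
    (\<forall>a. m' a = (if 6 * N * N \<le> a \<and> a < 6 * N * N + k then 0 else m a))"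
proof (induction k)
  case 0
  then show ?case by (auto intro: exec_Skip)
next
  case (Suc k)
  then obtain t m' where *: "exec (mem_size N) (zero_regs k) m t m'" "t \<le> 6 * k"
    "\<forall>a. m' a = (if 6 * N * N \<le> a \<and> a < 6 * N * N + k then 0 else m a)" by auto
  have "m' 0 = real N" using *(3) m N by simp
  then have "expr_val (mem_size N) m' (nreg k) = Some (real (naddr N k))"
    using address_of_nat[of 0 "mem_size N"] N by (simp add: base_def naddr_def mem_size_def)
  from exec_Store[OF this address_of_nat[OF addr_bounds(1)[OF N]], of "Const 0" 0]
  have "exec (mem_size N) (Store (nreg k) (Const 0)) m' 6 (m'(naddr N k := 0))"
    using Suc.prems unfolding for_ops by simp
  from exec_Seq[OF *(1) this]
  have "exec (mem_size N) (zero_regs (Suc k)) m (t + 6) (m'(naddr N k := 0))" by simp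
  moreover have "\<forall>a. (m'(naddr N k := 0)) a = (if 6 * N * N \<le> a \<and> a < 6 * N * N + Suc k then 0 else m a)"
    using *(3) by (auto simp: naddr_def)
  moreover have "t + 6 \<le> 6 * Suc k" using *(2) by simp
  ultimately show ?case by blast
qed

text \<open>The outcome overwrites cell 0 only as the very last action, since until then every
  address is computed from the \<open>N\<close> stored there.\<close>

definition program :: prog where
  "program = Seq (zero_regs 32) (Seq (compile main_cmd)
     (Branch (Less (Load (nreg 12)) (Const 1)) (Store (Const 0) (Const 0)) (Store (Const 0) (Const 1))))"

lemma represents_initial:
  assumes N: "N \<ge> 1" and m: "m 0 = real N"
    and m': "\<forall>a. m' a = (if 6 * N * N \<le> a \<and> a < 6 * N * N + 32 then 0 else m a)"
  shows "represents N \<lparr>nv = \<lambda>_. 0, rv = \<lambda>k. m (raddr N k), ra = \<lambda>a i. m (aaddr N a i), low = m\<rparr> m'"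
  unfolding represents_def using m m' N by (auto simp: naddr_def raddr_def aaddr_def)

theorem program_correct:
  assumes N: "N \<ge> 1" and l: "l > 0" and metric: "pseudometric_on {..<N} \<rho>" and h: "\<forall>x<N. h x \<noteq> 0"
    and enc: "encodes_input N l \<rho> h \<alpha> m"
  shows "\<exists>t m'. exec (mem_size N) program m t m' \<and>
    encodes_outcome N (projection_algorithm l {..<N} \<rho> (\<lambda>x. half_plane (h x) (\<alpha> x))) m' \<and>
    t \<le> (cost main_cmd + 300) * N\<^sup>2"
proof -
  interpret program_data N l \<rho> h \<alpha> m
    using N l metric h enc unfolding encodes_input_def by unfold_locales auto
  have m0: "m 0 = real N" using enc unfolding encodes_input_def by blast
  obtain t1 m1 where 1: "exec (mem_size N) (zero_regs 32) m t1 m1" "t1 \<le> 192"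
    "\<forall>a. m1 a = (if 6 * N * N \<le> a \<and> a < 6 * N * N + 32 then 0 else m a)"
    using zero_regs_exec[where m = m and k = 32, OF N m0] by auto
  let ?s = "\<lparr>nv = \<lambda>_. 0, rv = \<lambda>k. m (raddr N k), ra = \<lambda>a i. m (aaddr N a i), low = m\<rparr>"
  have "wp N main_cmd output_ok ?s" by (rule main_correct) simp
  from compile_correct[OF N this represents_initial[where m = m, OF N m0 1(3)]]
  obtain t2 m2 s where 2: "exec (mem_size N) (compile main_cmd) m1 t2 m2" "represents N s m2" "output_ok s"
    "t2 \<le> cost main_cmd * N ^ nesting main_cmd" by blast
  have "expr_val (mem_size N) m2 (Load (nreg 12)) = Some (real (nv s 12))"
    by (rule nreg_load[OF N 2(2)]) simp
  then have cv: "cond_val (mem_size N) m2 (Less (Load (nreg 12)) (Const 1)) = Some (nv s 12 < 1)"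
    by (simp del: expr_val.simps(2))
  have store: "exec (mem_size N) (Store (Const 0) (Const c)) m2 1 (m2(0 := of_int c))" for c
    using exec_Store[of "mem_size N" m2 "Const 0" 0 0 "Const c"] address_of_nat[of 0 "mem_size N"]
    by (simp add: mem_size_def)
  have ops: "cond_ops (Less (Load (nreg 12)) (Const 1)) = 7" by (simp add: base_def)
  \<comment> \<open>Zeroing the registers takes at most 192 operations and writing the outcome 8
    more; 300 covers both.\<close>
  have le: "t1 + (t2 + (7 + 1)) \<le> (cost main_cmd + 300) * N\<^sup>2"
  proof -
    have "300 * 1 \<le> 300 * N\<^sup>2" using N by (intro mult_left_mono) auto
    then show ?thesis using 1(2) 2(4) unfolding nesting_main add_mult_distrib by linarith
  qed
  have cells: "low s a = m2 a" if "0 < a" "a < 6 * N * N" for a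
    using 2(2) that unfolding represents_def by simp
  show ?thesis
  proof (cases "nv s 12 < 1")
    case True
    then have "\<not> (nonempty \<and> (\<forall>x<N. feasible x))" using 2(3) unfolding output_ok_def by simp
    then have "projection_algorithm l {..<N} \<rho> (\<lambda>x. half_plane (h x) (\<alpha> x)) = No_Go"
      using projection_algorithm_empty projection_algorithm_infeasible by blast
    moreover have "exec (mem_size N) program m (t1 + (t2 + (7 + 1))) (m2(0 := 0))"
    proof -
      have "cond_val (mem_size N) m2 (Less (Load (nreg 12)) (Const 1)) = Some True"
        unfolding cv using True by simp
      from exec_Seq[OF 1(1) exec_Seq[OF 2(1) exec_Branch_True[OF this store[of 0]]]]
      show ?thesis unfolding program_def ops of_int_0 .
    qed
    moreover have "encodes_outcome N No_Go (m2(0 := 0))" by simp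
    ultimately show ?thesis using le by metis
  next
    case False
    then have "nv s 12 = 1" using 2(3) unfolding output_ok_def by simp
    then have ok: "nonempty" "\<forall>x<N. feasible x \<and> low s (1 + 2 * x) = fst (f x) \<and> low s (2 + 2 * x) = snd (f x)"
      using 2(3) unfolding output_ok_def by blast+
    then have "\<forall>x\<in>{..<N}. K x \<noteq> {}" "\<forall>x\<in>{..<N}. feasible x" by simp_all
    from projection_algorithm_success[OF this]
    obtain f' where f': "projection_algorithm l {..<N} \<rho> (\<lambda>x. half_plane (h x) (\<alpha> x)) = Success f'"
      "\<forall>x<N. f' x = f x" by auto
    have "m2 (1 + 2 * x) = fst (f x) \<and> m2 (2 + 2 * x) = snd (f x)" if "x < N" for x
    proof -
      have "N \<le> N * N" using N by simp
      moreover have "6 * N * N = 6 * (N * N)" by simp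
      ultimately have "2 + 2 * x < 6 * N * N" using that by linarith
      then show ?thesis using ok(2) that cells[of "1 + 2 * x"] cells[of "2 + 2 * x"] by simp
    qed
    then have "encodes_outcome N (Success f') (m2(0 := 1))"
      using f'(2) by simp
    moreover have "exec (mem_size N) program m (t1 + (t2 + (7 + 1))) (m2(0 := 1))"
    proof -
      have "cond_val (mem_size N) m2 (Less (Load (nreg 12)) (Const 1)) = Some False"
        unfolding cv using False by simp
      from exec_Seq[OF 1(1) exec_Seq[OF 2(1) exec_Branch_False[OF this store[of 1]]]]
      show ?thesis unfolding program_def ops of_int_1 .
    qed
    ultimately show ?thesis using le f'(1) by metis
  qed
qed

theorem theorem1p3:
  "(\<forall>(l::real) (M::'a set) \<rho> F.
      l > 0 \<and> finite M \<and> M \<noteq> {} \<and> pseudometric_on M \<rho> \<and> (\<forall>x\<in>M. closed_half_plane (F x)) \<longrightarrow>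
      (case projection_algorithm l M \<rho> F of
         No_Go \<Rightarrow> \<not> (\<exists>f\<in>Lip M \<rho>. lip_seminorm M \<rho> f \<le> ennreal l \<and> (\<forall>x\<in>M. f x \<in> F x))
       | Success f \<Rightarrow> lip_seminorm M \<rho> f \<le> ennreal (3 * l) \<and> (\<forall>x\<in>M. f x \<in> F x)))
   \<and>
   (\<exists>C::real. C > 0 \<and> (\<exists>P::prog.
      \<forall>(N::nat) (l::real) \<rho> h \<alpha> m.
        N \<ge> 1 \<and> l > 0 \<and> pseudometric_on {..<N} \<rho> \<and> (\<forall>x<N. h x \<noteq> 0) \<and>
        encodes_input N l \<rho> h \<alpha> m \<longrightarrow>
        (\<exists>S t m'. exec S P m t m' \<and>
           encodes_outcome N (projection_algorithm l {..<N} \<rho> (\<lambda>x. half_plane (h x) (\<alpha> x))) m' \<and>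
           real t \<le> C * (real N)\<^sup>2 \<and> real S \<le> C * (real N)\<^sup>2)))"
proof (rule conjI, goal_cases)
  case 1
  show ?case by (intro allI impI projection_algorithm_correct) blast+
next
  case 2
  let ?C = "cost main_cmd + 300"
  have "\<exists>S t m'. exec S program m t m' \<and>
      encodes_outcome N (projection_algorithm l {..<N} \<rho> (\<lambda>x. half_plane (h x) (\<alpha> x))) m' \<and>
      real t \<le> real ?C * (real N)\<^sup>2 \<and> real S \<le> real ?C * (real N)\<^sup>2"
    if asm: "N \<ge> 1 \<and> l > 0 \<and> pseudometric_on {..<N} \<rho> \<and> (\<forall>x<N. h x \<noteq> 0) \<and> encodes_input N l \<rho> h \<alpha> m"
    for N l \<rho> h \<alpha> m
  proof -
    have N: "N \<ge> 1" using asm by blast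
    obtain t m' where *: "exec (mem_size N) program m t m'"
      "encodes_outcome N (projection_algorithm l {..<N} \<rho> (\<lambda>x. half_plane (h x) (\<alpha> x))) m'"
      "t \<le> ?C * N\<^sup>2"
      using program_correct[of N l \<rho> h \<alpha> m] asm by blast
    have "N \<le> N * N" "1 \<le> N * N" using N by simp_all
    moreover have "6 * N * N = 6 * (N * N)" by simp
    \<comment> \<open>The constant is 6 + 64 + 32, and the time constant exceeds it through its
      summand 300.\<close>
    ultimately have "mem_size N \<le> 102 * (N * N)" unfolding mem_size_def by linarith
    also have "\<dots> \<le> ?C * (N * N)" by (intro mult_right_mono) auto
    finally have "mem_size N \<le> ?C * N\<^sup>2" by (simp add: power2_eq_square)
    then have "real (mem_size N) \<le> real (?C * N\<^sup>2)" by (rule of_nat_mono)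
    moreover have "real t \<le> real (?C * N\<^sup>2)" using *(3) by (rule of_nat_mono)
    ultimately show ?thesis
      using *(1,2) by (intro exI[of _ "mem_size N"] exI[of _ t] exI[of _ m'] conjI) simp_all
  qed
  note main = this
  show ?case
  proof (rule exI[of _ "real ?C"], intro conjI exI[of _ program] allI impI)
    show "0 < real ?C" by simp
  qed (rule main)
qed

end
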